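(* Let $m<n$, let $g:\mathbb{R}^n\to\mathbb{R}^m$ be a constraint function with Jacobian $G(q)$, and let $M=\{q\in\mathbb{R}^n : g(q)=0\}$ be the configuration manifold, embedded in $\mathbb{R}^n$. Let $f:M\to\mathbb{R}$ be a $\mathcal{C}^2$ convex function (the potential energy), written in the coordinates $q$ of $\mathbb{R}^n$, and let $H(q,p)=T(p)+f(q)$ be a separable Hamiltonian with kinetic energy $T$ depending only on $p$. Let $H$ and $g$ be twice continuously differentiable, let $\gamma>0$, and let $$\mathcal{M}=\{(q,p) : g(q)=0,\ G(q)H_p(p)=0\}.$$ Assume that $G(q)H_{pp}(p)G(q)^T$ is invertible. Consider the numerical method with stepsize $h$ which, given $(q_n,p_n)\in\mathcal{M}$, determines $(q_{n+1},p_{n+1})$ (together with $p_{n+1/2}\in\mathbb{R}^n$ and $\lambda_n,\mu_n\in\mathbb{R}^m$) by $$\begin{aligned} p_{n+1/2} &= e^{-\gamma h}p_n-\tfrac{h}{2}\big(H_q(q_n)+G(q_n)^T\lambda_n\big),\\ q_{n+1} &= q_n+h\,H_p(p_{n+1/2}),\\ 0 &= g(q_{n+1}),\\ p_{n+1} &= p_{n+1/2}-\tfrac{h}{2}\big(H_q(q_{n+1})+G(q_{n+1})^T\mu_n\big),\\ 0 &= G(q_{n+1})H_p(p_{n+1}). \end{aligned}$$ Then this numerical method has a unique solution, is conformal symplectic with parameter $e^{-\gamma h}$, and is convergent of order $1$ (as a discretization of the system $\dot q=H_p(p)$, $\dot p=-H_q(q)-G(q)^T\lambda-\gamma p$, 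$0=g(q)$).
   Context: Subscripts denote partial derivatives: $H_q=\nabla f(q)$ and $H_p=\nabla T(p)$ are column vectors, and $H_{pp}=\nabla^2T(p)$. In the continuous system, $\lambda\in\mathbb{R}^m$ is the Lagrange multiplier enforcing the constraint $g(q)=0$; because $GH_{pp}G^T$ is invertible, it can be expressed in terms of $(q,p)$ by differentiating the constraint twice, which gives a differential equation for $(q,p)$ on $\mathcal{M}$. Conformal symplectic with parameter $\kappa$: the map $\varphi:(q_n,p_n)\mapsto(q_{n+1},p_{n+1})$ on $\mathcal{M}$ satisfies, for every $x=(q,p)\in\mathcal{M}$ and all $\xi_1,\xi_2\in T_x\mathcal{M}$, $$\xi_1^T\varphi'(x)^TJ\,\varphi'(x)\xi_2=\kappa\,\xi_1^TJ\xi_2,\qquad J=\begin{pmatrix}0&I\\-I&0\end{pmatrix},$$ where $\varphi'(x)\xi=\frac{d}{d\tau}\big|_{\tau=0}\varphi(\beta(\tau))$ for a path $\beta$ in $\mathcal{M}$ with $\beta(0)=x$, $\dot\beta(0)=\xi$. Convergent of order $r$: on a bounded time interval, the global error between the numerical solution with constant stepsize $h$ and the exact solution with the same initial value in $\mathcal{M}$ is $O(h^r)$ as $h\to0$.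
   Formalization: Unique solution is meant locally: for stepsizes h below a positive bound depending continuously on the point of the phase manifold, and among steps near that point; conformal symplecticity is claimed there. On the unit sphere with T=|p|^2/2, global uniqueness and existence for every h fail. *)

theory Defs
  imports "HOL-Analysis.Analysis"
begin

section \<open>Smoothness, gradients, tangent vectors, geodesics\<close>

definition C1 :: "('a::real_normed_vector \<Rightarrow> 'b::real_normed_vector) \<Rightarrow> bool" where
  "C1 F \<longleftrightarrow> (\<exists>F'. (\<forall>x. (F has_derivative blinfun_apply (F' x)) (at x)) \<and> continuous_on UNIV F')"

definition C2 :: "('a::real_normed_vector \<Rightarrow> 'b::real_normed_vector) \<Rightarrow> bool" where
  "C2 F \<longleftrightarrow> (\<exists>F'. (\<forall>x. (F has_derivative blinfun_apply (F' x)) (at x)) \<and> C1 F')"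

definition grad :: "('a::real_inner \<Rightarrow> real) \<Rightarrow> 'a \<Rightarrow> 'a" where
  "grad f x = (THE D. GDERIV f x :> D)"

definition hess :: "(real^'n \<Rightarrow> real) \<Rightarrow> real^'n \<Rightarrow> real^'n^'n" where
  "hess f x = jacobian (grad f) (at x)"

definition path_through :: "'a::real_normed_vector set \<Rightarrow> 'a \<Rightarrow> 'a \<Rightarrow> (real \<Rightarrow> 'a) \<Rightarrow> bool" where
  "path_through S x \<xi> \<beta> \<longleftrightarrow>
     (\<forall>\<^sub>F \<tau> in nhds 0. \<beta> \<tau> \<in> S) \<and> \<beta> 0 = x \<and> (\<beta> has_vector_derivative \<xi>) (at 0)"

definition tangent_space :: "'a::real_normed_vector set \<Rightarrow> 'a \<Rightarrow> 'a set" where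
  "tangent_space S x = {\<xi>. \<exists>\<beta>. path_through S x \<xi> \<beta>}"

text \<open>Geodesics of the metric induced by the ambient inner product: curves whose acceleration
  is normal to the submanifold.\<close>

definition geodesic_in :: "'a::real_inner set \<Rightarrow> (real \<Rightarrow> 'a) \<Rightarrow> bool" where
  "geodesic_in S c \<longleftrightarrow> (\<exists>c' c''. \<forall>t\<in>{0..1}. c t \<in> S
      \<and> (c has_vector_derivative c' t) (at t within {0..1})
      \<and> (c' has_vector_derivative c'' t) (at t within {0..1})
      \<and> (\<forall>v\<in>tangent_space S (c t). orthogonal (c'' t) v))"

definition geodesically_convex_on :: "'a::real_inner set \<Rightarrow> ('a \<Rightarrow> real) \<Rightarrow> bool" where
  "geodesically_convex_on S f \<longleftrightarrow> (\<forall>c. geodesic_in S c \<longrightarrow> convex_on {0..1} (f \<circ> c))"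


section \<open>The constrained damped system and its discretization\<close>

definition config_manifold :: "(real^'n \<Rightarrow> real^'m) \<Rightarrow> (real^'n) set" where
  "config_manifold g = {q. g q = 0}"

definition phase_manifold ::
    "(real^'n \<Rightarrow> real) \<Rightarrow> (real^'n \<Rightarrow> real^'m) \<Rightarrow> ((real^'n) \<times> (real^'n)) set" where
  "phase_manifold T g = {(q, p). g q = 0 \<and> jacobian g (at q) *v grad T p = 0}"

text \<open>At the end points of the time interval the derivatives are one-sided.\<close>

definition exact_solution ::
    "(real^'n \<Rightarrow> real) \<Rightarrow> (real^'n \<Rightarrow> real) \<Rightarrow> (real^'n \<Rightarrow> real^'m) \<Rightarrow> real
     \<Rightarrow> real \<Rightarrow> (real \<Rightarrow> (real^'n) \<times> (real^'n)) \<Rightarrow> bool" where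
  "exact_solution T f g \<gamma> t\<^sub>1 x \<longleftrightarrow> (\<exists>q p l. (\<forall>t. x t = (q t, p t)) \<and> (\<forall>t\<in>{0..t\<^sub>1}.
      (q has_vector_derivative grad T (p t)) (at t within {0..t\<^sub>1})
    \<and> (p has_vector_derivative
         (- grad f (q t) - transpose (jacobian g (at (q t))) *v l t - \<gamma> *\<^sub>R p t))
         (at t within {0..t\<^sub>1})
    \<and> g (q t) = 0))"

text \<open>All unknowns of one step: \<open>(ph, l, q1, \<mu>, p1)\<close>, with \<open>ph\<close> the momentum at the half step
  and multipliers \<open>l\<close>, \<open>\<mu>\<close>.\<close>

type_synonym ('n, 'm) step = "(real^'n) \<times> (real^'m) \<times> (real^'n) \<times> (real^'m) \<times> (real^'n)"

definition scheme ::
    "(real^'n \<Rightarrow> real) \<Rightarrow> (real^'n \<Rightarrow> real) \<Rightarrow> (real^'n \<Rightarrow> real^'m) \<Rightarrow> real \<Rightarrow> real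
     \<Rightarrow> (real^'n) \<times> (real^'n) \<Rightarrow> ('n, 'm) step \<Rightarrow> bool" where
  "scheme T f g \<gamma> h = (\<lambda>(q, p) (ph, l, q1, \<mu>, p1).
      ph = exp (- \<gamma> * h) *\<^sub>R p - (h / 2) *\<^sub>R (grad f q + transpose (jacobian g (at q)) *v l)
    \<and> q1 = q + h *\<^sub>R grad T ph
    \<and> 0 = g q1
    \<and> p1 = ph - (h / 2) *\<^sub>R (grad f q1 + transpose (jacobian g (at q1)) *v \<mu>)
    \<and> 0 = jacobian g (at q1) *v grad T p1)"

text \<open>The equations of the scheme are nonlinear, and besides the solution that continues
  \<open>(q, p)\<close> they generally have spurious ones that do not tend to \<open>(q, p)\<close> as \<open>h \<rightarrow> 0\<close>: for
  \<open>g q = q \<bullet> q - 1\<close> and \<open>T p = p \<bullet> p / 2\<close> a point off the sphere is sent back to it along a line,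
  which meets the sphere twice. As usual for such methods, a solution means one in a
  neighbourhood (here of radius \<open>\<rho>\<close>) of the current point; the multipliers are not restricted.\<close>

definition near_step ::
    "real \<Rightarrow> (real^'n) \<times> (real^'n) \<Rightarrow> ('n, 'm) step \<Rightarrow> bool" where
  "near_step \<rho> = (\<lambda>(q, p) (ph, l, q1, \<mu>, p1). dist ph p < \<rho> \<and> dist q1 q < \<rho> \<and> dist p1 p < \<rho>)"

definition scheme_map ::
    "(real^'n \<Rightarrow> real) \<Rightarrow> (real^'n \<Rightarrow> real) \<Rightarrow> (real^'n \<Rightarrow> real^'m) \<Rightarrow> real
     \<Rightarrow> ((real^'n) \<times> (real^'n) \<Rightarrow> real) \<Rightarrow> real
     \<Rightarrow> (real^'n) \<times> (real^'n) \<Rightarrow> (real^'n) \<times> (real^'n)" where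
  "scheme_map T f g \<gamma> \<rho> h x =
     (case (THE s. scheme T f g \<gamma> h x s \<and> near_step (\<rho> x) x s) of (ph, l, q1, \<mu>, p1) \<Rightarrow> (q1, p1))"


section \<open>Conformal symplecticity and order of convergence\<close>

definition symp_J :: "'a::real_inner \<times> 'a \<Rightarrow> 'a \<times> 'a" where
  "symp_J = (\<lambda>(a, b). (b, - a))"

text \<open>\<open>D\<close> is the set of points of the manifold \<open>S\<close> at which the property is required;
  \<open>A \<xi>\<close> is \<open>\<phi>'(x) \<xi>\<close>, and its independence of the chosen path is part of the claim.\<close>

definition conformal_symplectic ::
    "real \<Rightarrow> ('a::real_inner \<times> 'a) set \<Rightarrow> ('a \<times> 'a) set \<Rightarrow> ('a \<times> 'a \<Rightarrow> 'a \<times> 'a) \<Rightarrow> bool" where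
  "conformal_symplectic \<kappa> S D \<phi> \<longleftrightarrow> (\<forall>x\<in>D. \<phi> x \<in> S \<and> (\<exists>A.
      (\<forall>\<xi> \<beta>. path_through S x \<xi> \<beta> \<longrightarrow> ((\<phi> \<circ> \<beta>) has_vector_derivative A \<xi>) (at 0))
    \<and> (\<forall>\<xi>\<^sub>1\<in>tangent_space S x. \<forall>\<xi>\<^sub>2\<in>tangent_space S x.
         A \<xi>\<^sub>1 \<bullet> symp_J (A \<xi>\<^sub>2) = \<kappa> * (\<xi>\<^sub>1 \<bullet> symp_J \<xi>\<^sub>2))))"

text \<open>\<open>\<Phi> h\<close> is the one-step map with stepsize \<open>h\<close>, defined on \<open>D h\<close>; \<open>sol t\<^sub>1 x\<close> says that \<open>x\<close> is
  an exact solution on \<open>[0, t\<^sub>1]\<close>. That the iteration does not leave the domain before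
  time \<open>t\<^sub>1\<close> is part of the claim.\<close>

definition convergent_of_order ::
    "nat \<Rightarrow> 'a::real_normed_vector set \<Rightarrow> (real \<Rightarrow> (real \<Rightarrow> 'a) \<Rightarrow> bool)
     \<Rightarrow> (real \<Rightarrow> 'a set) \<Rightarrow> (real \<Rightarrow> 'a \<Rightarrow> 'a) \<Rightarrow> bool" where
  "convergent_of_order r S sol D \<Phi> \<longleftrightarrow> (\<forall>t\<^sub>1\<ge>0. \<forall>x. x 0 \<in> S \<and> sol t\<^sub>1 x \<longrightarrow>
     (\<exists>C. \<exists>h\<^sub>1>0. \<forall>h. 0 < h \<and> h < h\<^sub>1 \<longrightarrow> (\<forall>k::nat. real k * h \<le> t\<^sub>1 \<longrightarrow>
        (\<Phi> h ^^ k) (x 0) \<in> D h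
      \<and> norm ((\<Phi> h ^^ k) (x 0) - x (real k * h)) \<le> C * h ^ r)))"

end

theory Submission
  imports Defs
begin

text \<open>
  The scheme determines its multipliers implicitly. Scaled by the step size, they solve an equation
  that extends to \<open>h = 0\<close> once the constraint \<open>g(q\<^sub>1) = 0\<close> is divided by \<open>h\<close>; there the
  solution is zero and the linearization is block triangular with diagonal blocks \<open>- G H\<^sub>p\<^sub>p G\<^sup>T\<close>.
  The implicit function theorem therefore gives, near each point of the phase manifold and for small
  \<open>h\<close>, one step that depends differentiably on the point and moves it by \<open>O(h)\<close>
  (\<open>local_step\<close>). As \<open>G\<^sup>T\<close> is injective, the multipliers of any step that stays close to the current
  point are small, so this step is the only one nearby. The radii of these local statements are
  glued to continuous functions \<open>\<rho>\<close> and \<open>h\<^sub>0\<close> on the phase manifold by \<open>continuous_selection\<close>.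

  The step is a kick with damping, a drift and a kick. Its variational equations involve symmetric
  matrices (second derivatives of \<open>f + l \<bullet> g\<close> and of \<open>T\<close>) and multiplier terms in the range of \<open>G\<^sup>T\<close>,
  to which the tangent vectors are orthogonal. Hence the symplectic form is preserved
  except for the factor \<open>exp (- \<gamma> h)\<close> of the damping (\<open>step_conformal_symplectic\<close>).

  Convergence cannot be deduced from a Lipschitz estimate for the reduced vector field:
  with \<open>g\<close> of class \<open>C\<^sup>2\<close> the multiplier is only a continuous function of the state. The
  remedy is to measure the momentum error modulo the range of \<open>G\<^sup>T\<close>. Constraint forces are invisible
  to this measure up to differences of \<open>G\<close> at nearby points, which are Lipschitz, so the local errors are
  \<open>O(h\<^sup>2)\<close> and errors propagate as for a Lipschitz field (\<open>error_propagation\<close>). Conversely the hidden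
  constraint \<open>G(q) H\<^sub>p(p) = 0\<close>, which both solutions satisfy, bounds the discarded component
  by the measured errors (\<open>multiplier_bound_local\<close>), because \<open>G H\<^sub>p\<^sub>p G\<^sup>T\<close> is invertible. A discrete
  Gronwall argument completes the proof (\<open>scheme_map_convergent\<close>).
\<close>

section \<open>Continuously differentiable maps\<close>

lemma C1_I:
  assumes "\<And>x. (F has_derivative blinfun_apply (F' x)) (at x)" "continuous_on UNIV F'"
  shows "C1 F"
  using assms unfolding C1_def by blast

lemma C1_imp_continuous: "C1 F \<Longrightarrow> continuous_on A F"
  by (metis C1_def continuous_at_imp_continuous_on has_derivative_continuous)

lemma C1_bounded_linear:
  assumes "bounded_linear F"
  shows "C1 F"
proof (rule C1_I)
  show "(F has_derivative blinfun_apply (Blinfun F)) (at x)" for x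
    using assms by (simp add: bounded_linear_Blinfun_apply bounded_linear_imp_has_derivative)
qed (rule continuous_on_const)

lemma C1_const: "C1 (\<lambda>x. c)"
  by (rule C1_I[where F' = "\<lambda>x. 0"]) (auto simp: zero_blinfun.rep_eq)

lemma C1_compose:
  assumes "C1 F" "C1 G"
  shows "C1 (\<lambda>x. F (G x))"
proof -
  obtain F' where F: "\<And>x. (F has_derivative blinfun_apply (F' x)) (at x)" "continuous_on UNIV F'"
    using assms(1) unfolding C1_def by blast
  obtain G' where G: "\<And>x. (G has_derivative blinfun_apply (G' x)) (at x)" "continuous_on UNIV G'"
    using assms(2) unfolding C1_def by blast
  show ?thesis
  proof (rule C1_I)
    fix x
    have "((\<lambda>x. F (G x)) has_derivative (\<lambda>h. F' (G x) (G' x h))) (at x)"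
      using has_derivative_compose[OF G(1) F(1)] .
    moreover have "(\<lambda>h. F' (G x) (G' x h)) = blinfun_apply (F' (G x) o\<^sub>L G' x)"
      by auto
    ultimately show "((\<lambda>x. F (G x)) has_derivative blinfun_apply (F' (G x) o\<^sub>L G' x)) (at x)"
      by simp
  next
    have "continuous_on UNIV (\<lambda>x. F' (G x))"
      by (rule continuous_on_compose2[OF F(2) C1_imp_continuous[OF assms(2)]]) auto
    then show "continuous_on UNIV (\<lambda>x. F' (G x) o\<^sub>L G' x)"
      using G(2) by (intro continuous_intros)
  qed
qed

lemma C1_linear_compose:
  assumes "bounded_linear L" "C1 F"
  shows "C1 (\<lambda>x. L (F x))"
  by (rule C1_compose[OF C1_bounded_linear[OF assms(1)] assms(2)])

lemma C1_add:
  assumes "C1 F" "C1 G"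
  shows "C1 (\<lambda>x. F x + G x)"
proof -
  obtain F' where F: "\<And>x. (F has_derivative blinfun_apply (F' x)) (at x)" "continuous_on UNIV F'"
    using assms(1) unfolding C1_def by blast
  obtain G' where G: "\<And>x. (G has_derivative blinfun_apply (G' x)) (at x)" "continuous_on UNIV G'"
    using assms(2) unfolding C1_def by blast
  show ?thesis
    by (rule C1_I[where F' = "\<lambda>x. F' x + G' x"])
      (use F G in \<open>auto simp: plus_blinfun.rep_eq intro!: derivative_eq_intros continuous_intros\<close>)
qed

lemma C1_Pair:
  assumes "C1 F" "C1 G"
  shows "C1 (\<lambda>x. (F x, G x))"
proof -
  have "C1 (\<lambda>x. (F x, 0) + (0, G x))"
    by (intro C1_add C1_linear_compose[OF _ assms(1)] C1_linear_compose[OF _ assms(2)]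
        bounded_linear_Pair bounded_linear_ident bounded_linear_zero)
  then show ?thesis by simp
qed

lemma C1_bounded_bilinear:
  fixes B :: "'a::real_normed_vector \<Rightarrow> 'b::real_normed_vector \<Rightarrow> 'c::real_normed_vector"
  assumes B: "bounded_bilinear B" and "C1 F" "C1 G"
  shows "C1 (\<lambda>x. B (F x) (G x))"
proof -
  interpret B: bounded_bilinear B by (rule B)
  let ?d = "\<lambda>(p :: 'a \<times> 'b) (u :: 'a \<times> 'b). B (fst p) (snd u) + B (fst u) (snd p)"
  obtain K where K: "K > 0" "\<And>a b. norm (B a b) \<le> norm a * norm b * K"
    using B.pos_bounded by blast
  have bl: "bounded_linear (?d p)" for p
    by (intro bounded_linear_add B.bounded_linear_right[THEN bounded_linear_compose]
        B.bounded_linear_left[THEN bounded_linear_compose] bounded_linear_fst bounded_linear_snd)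
  have ap: "blinfun_apply (Blinfun (?d p)) = ?d p" for p
    using bl by (rule bounded_linear_Blinfun_apply)
  have "C1 (\<lambda>p. B (fst p) (snd p))"
  proof (rule C1_I[where F' = "\<lambda>p. Blinfun (?d p)"])
    show "((\<lambda>p. B (fst p) (snd p)) has_derivative blinfun_apply (Blinfun (?d p))) (at p)" for p
      unfolding ap by (auto intro!: derivative_eq_intros B.FDERIV)
    have "dist (Blinfun (?d p)) (Blinfun (?d p')) \<le> (2 * K) * dist p p'" for p p'
      unfolding dist_norm
    proof (rule norm_blinfun_bound)
      fix u :: "'a \<times> 'b"
      have 1: "norm (fst p - fst p') \<le> norm (p - p')" "norm (snd p - snd p') \<le> norm (p - p')"
          "norm (fst u) \<le> norm u" "norm (snd u) \<le> norm u"
        by (metis fst_diff norm_fst_le prod.collapse, metis snd_diff norm_snd_le prod.collapse,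
            metis norm_fst_le prod.collapse, metis norm_snd_le prod.collapse)
      have "blinfun_apply (Blinfun (?d p) - Blinfun (?d p')) u
          = B (fst p - fst p') (snd u) + B (fst u) (snd p - snd p')"
        by (simp add: ap minus_blinfun.rep_eq B.diff_left B.diff_right)
      also have "norm \<dots> \<le> norm (fst p - fst p') * norm (snd u) * K
          + norm (fst u) * norm (snd p - snd p') * K"
        by (rule norm_triangle_le) (intro add_mono K)
      also have "\<dots> \<le> norm (p - p') * norm u * K + norm u * norm (p - p') * K"
        using 1 K(1) by (intro add_mono mult_right_mono mult_mono) auto
      finally show "norm (blinfun_apply (Blinfun (?d p) - Blinfun (?d p')) u)
          \<le> 2 * K * norm (p - p') * norm u"
        by (simp add: algebra_simps)
    qed (use K(1) in simp)
    then have "(2 * K)-lipschitz_on UNIV (\<lambda>p. Blinfun (?d p))"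
      using K(1) by (auto intro!: lipschitz_onI)
    then show "continuous_on UNIV (\<lambda>p. Blinfun (?d p))"
      by (rule lipschitz_on_continuous_on)
  qed
  from C1_compose[OF this C1_Pair[OF assms(2,3)]] show ?thesis by simp
qed

lemma C1_ident: "C1 (\<lambda>x. x)"
  by (rule C1_bounded_linear[OF bounded_linear_ident])

lemma C1_fst: "C1 F \<Longrightarrow> C1 (\<lambda>x. fst (F x))"
  by (rule C1_linear_compose[OF bounded_linear_fst])

lemma C1_snd: "C1 F \<Longrightarrow> C1 (\<lambda>x. snd (F x))"
  by (rule C1_linear_compose[OF bounded_linear_snd])

lemma C1_minus: "C1 F \<Longrightarrow> C1 (\<lambda>x. - F x)"
  by (rule C1_linear_compose[OF bounded_linear_minus[OF bounded_linear_ident]])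

lemma C1_diff: "C1 F \<Longrightarrow> C1 G \<Longrightarrow> C1 (\<lambda>x. F x - G x)"
  using C1_add[OF _ C1_minus, of F G] by simp

lemma C1_scaleR: "C1 F \<Longrightarrow> C1 G \<Longrightarrow> C1 (\<lambda>x. F x *\<^sub>R G x)"
  by (rule C1_bounded_bilinear[OF bounded_bilinear_scaleR])

lemma C1_mult: "C1 F \<Longrightarrow> C1 G \<Longrightarrow> C1 (\<lambda>x. F x * (G x :: real))"
  by (rule C1_bounded_bilinear[OF bounded_bilinear_mult])

lemma C1_divide_const: "C1 F \<Longrightarrow> C1 (\<lambda>x. F x / (c :: real))"
  by (rule C1_linear_compose[OF bounded_linear_divide])

lemma C1_exp:
  assumes "C1 F"
  shows "C1 (\<lambda>x. exp (F x :: real))"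
proof -
  have "C1 (exp :: real \<Rightarrow> real)"
  proof (rule C1_I[where F' = "\<lambda>x. blinfun_mult_right (exp x)"])
    show "(exp has_derivative blinfun_apply (blinfun_mult_right (exp x))) (at x)" for x :: real
      by (auto intro!: derivative_eq_intros)
  qed (intro continuous_intros)
  from C1_compose[OF this assms] show ?thesis .
qed

lemma bounded_bilinear_matrix_vector_mult:
  "bounded_bilinear ((*v) :: real^'n^'m \<Rightarrow> real^'n \<Rightarrow> real^'m)"
proof -
  have "bilinear ((*v) :: real^'n^'m \<Rightarrow> real^'n \<Rightarrow> real^'m)"
    unfolding bilinear_def
    by (auto intro!: linearI simp: matrix_vector_right_distrib matrix_vector_mult_add_rdistrib
        matrix_vector_mult_scaleR scaleR_matrix_vector_assoc vec.scale)
  then show ?thesis by (simp add: bilinear_conv_bounded_bilinear)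
qed

lemma bounded_linear_transpose: "bounded_linear (transpose :: real^'n^'m \<Rightarrow> real^'m^'n)"
  by (intro linear_conv_bounded_linear[THEN iffD1] linearI)
    (auto simp: transpose_def vec_eq_iff)

lemmas C1_matrix_vector_mult = C1_bounded_bilinear[OF bounded_bilinear_matrix_vector_mult]

lemmas C1_transpose = C1_linear_compose[OF bounded_linear_transpose]

lemmas C1_intros = C1_const C1_ident C1_fst C1_snd C1_Pair C1_add C1_minus C1_diff C1_scaleR
  C1_mult C1_divide_const C1_exp C1_matrix_vector_mult C1_transpose

text \<open>Differentiation under the integral sign. It is used for the divided difference of the constraint
function, which has to be \<open>C\<^sup>1\<close> up to and including step size zero.\<close>
lemma C1_integral:
  fixes k :: "'a::banach \<Rightarrow> real \<Rightarrow> 'b::banach"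
  assumes "C1 (\<lambda>z. k (fst z) (snd z))"
  shows "C1 (\<lambda>x. integral {0..1} (k x))"
proof -
  obtain k' where k': "\<And>z. ((\<lambda>z. k (fst z) (snd z)) has_derivative blinfun_apply (k' z)) (at z)"
      "continuous_on UNIV k'"
    using assms unfolding C1_def by blast
  define i where "i = (Blinfun (\<lambda>x. (x, 0)) :: 'a \<Rightarrow>\<^sub>L ('a \<times> real))"
  have i: "blinfun_apply i u = (u, 0)" for u
    unfolding i_def by (intro bounded_linear_Blinfun_apply[THEN fun_cong] bounded_linear_Pair
        bounded_linear_ident bounded_linear_zero)
  define kx where "kx = (\<lambda>x s. k' (x, s) o\<^sub>L i)"
  have d: "((\<lambda>x. k x s) has_derivative blinfun_apply (kx x s)) (at x)" for x s
  proof -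
    have "((\<lambda>x. (x, s)) has_derivative (\<lambda>u. (u, 0))) (at x)"
      by (auto intro!: derivative_eq_intros)
    from has_derivative_compose[OF this k'(1)] show ?thesis
      unfolding kx_def by (simp add: i has_derivative_eq_rhs fun_eq_iff)
  qed
  have c: "continuous_on (UNIV \<times> cbox 0 1) (\<lambda>(x, s). kx x s)"
    unfolding kx_def split_beta
    by (intro continuous_intros continuous_on_compose2[OF k'(2)]) auto
  have "continuous_on (cbox 0 1) (k x)" for x
    by (rule continuous_on_compose2[OF C1_imp_continuous[OF assms, of UNIV], of "cbox 0 1" "\<lambda>s. (x, s)",
          unfolded fst_conv snd_conv])
      (intro continuous_intros, simp)
  then have int: "k x integrable_on cbox 0 1" for x
    by (rule integrable_continuous)
  show ?thesis
  proof (rule C1_I)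
    show "((\<lambda>x. integral {0..1} (k x)) has_derivative
        blinfun_apply (integral (cbox 0 1) (kx x))) (at x)" for x
      using leibniz_rule[OF has_derivative_at_withinI[OF d] int c UNIV_I convex_UNIV] by simp
    show "continuous_on UNIV (\<lambda>x. integral (cbox 0 1) (kx x))"
      using c by (rule integral_continuous_on_param)
  qed
qed

text \<open>The mean value inequality applied to \<open>F - L\<close>, whose derivative is small near \<open>x\<close> by continuity:
a \<open>C\<^sup>1\<close> map is approximated by its derivative at \<open>x\<close> uniformly over pairs of nearby points.\<close>
lemma C1_strict_derivative:
  assumes "C1 F" "(F has_derivative L) (at x)" "\<eta> > 0"
  obtains r where "r > 0"
    "\<And>u v. u \<in> ball x r \<Longrightarrow> v \<in> ball x r \<Longrightarrow> norm (F u - F v - L (u - v)) \<le> \<eta> * norm (u - v)"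
proof -
  obtain F' where F: "\<And>x. (F has_derivative blinfun_apply (F' x)) (at x)" "continuous_on UNIV F'"
    using assms(1) unfolding C1_def by blast
  have L: "L = blinfun_apply (F' x)"
    using has_derivative_unique[OF assms(2) F(1)] .
  have "isCont F' x" using F(2) by (simp add: continuous_on_eq_continuous_at)
  then obtain r where r: "r > 0" "\<And>y. dist y x < r \<Longrightarrow> dist (F' y) (F' x) < \<eta>"
    using assms(3) unfolding continuous_at_eps_delta by blast
  show thesis
  proof (rule that[OF r(1)])
    fix u v assume uv: "u \<in> ball x r" "v \<in> ball x r"
    have "norm ((\<lambda>y. F y - F' x y) u - (\<lambda>y. F y - F' x y) v) \<le> \<eta> * norm (u - v)"
    proof (rule differentiable_bound[OF convex_ball[of x r] _ _ uv])
      fix y assume y: "y \<in> ball x r"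
      show "((\<lambda>y. F y - F' x y) has_derivative blinfun_apply (F' y - F' x)) (at y within ball x r)"
        unfolding minus_blinfun.rep_eq
        by (intro has_derivative_diff has_derivative_at_withinI[OF F(1)]
            bounded_linear_imp_has_derivative blinfun.bounded_linear_right)
      show "onorm (blinfun_apply (F' y - F' x)) \<le> \<eta>"
        using r(2)[of y] y
        by (simp add: norm_blinfun.rep_eq[symmetric] dist_norm norm_minus_commute[of x y])
    qed
    then show "norm (F u - F v - L (u - v)) \<le> \<eta> * norm (u - v)"
      by (simp add: L blinfun.diff_right algebra_simps)
  qed
qed

lemma C1_lipschitz_on_cball:
  fixes F :: "'a::euclidean_space \<Rightarrow> 'b::real_normed_vector"
  assumes "C1 F"
  obtains K where "K > 0"
    "\<And>u v. u \<in> cball x r \<Longrightarrow> v \<in> cball x r \<Longrightarrow> norm (F u - F v) \<le> K * norm (u - v)"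
proof -
  obtain F' where F: "\<And>x. (F has_derivative blinfun_apply (F' x)) (at x)" "continuous_on UNIV F'"
    using assms(1) unfolding C1_def by blast
  have "compact (F' ` cball x r)"
    by (intro compact_continuous_image continuous_on_subset[OF F(2)]) auto
  then have "bounded (F' ` cball x r)" by (rule compact_imp_bounded)
  then obtain K where K: "K > 0" "\<And>y. y \<in> cball x r \<Longrightarrow> norm (F' y) \<le> K"
    unfolding bounded_pos by blast
  show thesis
  proof (rule that[OF K(1)])
    fix u v assume uv: "u \<in> cball x r" "v \<in> cball x r"
    show "norm (F u - F v) \<le> K * norm (u - v)"
    proof (rule differentiable_bound[OF convex_cball[of x r] _ _ uv])
      fix y assume "y \<in> cball x r"
      then show "onorm (blinfun_apply (F' y)) \<le> K"
        unfolding norm_blinfun.rep_eq[symmetric] by (rule K(2))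
    qed (rule has_derivative_at_withinI[OF F(1)])
  qed
qed

text \<open>The second difference of \<open>F\<close> over the parallelogram spanned by \<open>s u\<close> and \<open>s v\<close> does not change when
\<open>u\<close> and \<open>v\<close> are exchanged. Applying the mean value theorem twice writes it as \<open>s\<^sup>2\<close> times either
mixed derivative at a point that tends to \<open>x\<close> with \<open>s\<close>.\<close>
lemma gradient_derivative_symmetric:
  fixes F :: "'a::real_inner \<Rightarrow> real"
  assumes dF: "\<And>x. (F has_derivative (\<lambda>u. W x \<bullet> u)) (at x)"
    and W: "C1 W" "(W has_derivative A) (at x)"
  shows "A u \<bullet> v = A v \<bullet> u"
proof -
  obtain W' where W': "\<And>x. (W has_derivative blinfun_apply (W' x)) (at x)" "continuous_on UNIV W'"
    using W(1) unfolding C1_def by blast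
  have A: "A = blinfun_apply (W' x)" using has_derivative_unique[OF W(2) W'(1)] .
  let ?\<Delta> = "\<lambda>s u v. F (x + s *\<^sub>R u + s *\<^sub>R v) - F (x + s *\<^sub>R u) - F (x + s *\<^sub>R v) + F x"
  have mvt: "\<exists>z. norm (z - x) \<le> s * (norm u + norm v) \<and> ?\<Delta> s u v = s * (s * (W' z v \<bullet> u))"
    if s: "s > 0" for s :: real and u v
  proof -
    have "\<exists>\<sigma>>0. \<sigma> < s \<and> (F (x + s *\<^sub>R u + s *\<^sub>R v) - F (x + s *\<^sub>R u))
       - (F (x + 0 *\<^sub>R u + s *\<^sub>R v) - F (x + 0 *\<^sub>R u)) =
         (s - 0) * (W (x + \<sigma> *\<^sub>R u + s *\<^sub>R v) \<bullet> u - W (x + \<sigma> *\<^sub>R u) \<bullet> u)"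
    proof (rule MVT2[OF s])
      fix \<sigma>
      show "((\<lambda>\<sigma>. F (x + \<sigma> *\<^sub>R u + s *\<^sub>R v) - F (x + \<sigma> *\<^sub>R u)) has_real_derivative
          W (x + \<sigma> *\<^sub>R u + s *\<^sub>R v) \<bullet> u - W (x + \<sigma> *\<^sub>R u) \<bullet> u) (at \<sigma>)"
        unfolding has_field_derivative_def
        by (auto intro!: derivative_eq_intros has_derivative_compose[OF _ dF] simp: algebra_simps)
    qed
    then obtain \<sigma> where \<sigma>: "0 < \<sigma>" "\<sigma> < s"
      "?\<Delta> s u v = s * (W (x + \<sigma> *\<^sub>R u + s *\<^sub>R v) \<bullet> u - W (x + \<sigma> *\<^sub>R u) \<bullet> u)"
      by (auto simp: algebra_simps)
    have "\<exists>\<tau>>0. \<tau> < s \<and> W (x + \<sigma> *\<^sub>R u + s *\<^sub>R v) \<bullet> u - W (x + \<sigma> *\<^sub>R u + 0 *\<^sub>R v) \<bullet> u =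
        (s - 0) * (W' (x + \<sigma> *\<^sub>R u + \<tau> *\<^sub>R v) v \<bullet> u)"
    proof (rule MVT2[OF s])
      fix \<tau>
      show "((\<lambda>\<tau>. W (x + \<sigma> *\<^sub>R u + \<tau> *\<^sub>R v) \<bullet> u) has_real_derivative
          W' (x + \<sigma> *\<^sub>R u + \<tau> *\<^sub>R v) v \<bullet> u) (at \<tau>)"
        unfolding has_field_derivative_def
        by (auto intro!: derivative_eq_intros has_derivative_compose[OF _ W'(1)]
            simp: blinfun.scaleR_right)
    qed
    then obtain \<tau> where \<tau>: "0 < \<tau>" "\<tau> < s"
      "?\<Delta> s u v = s * (s * (W' (x + \<sigma> *\<^sub>R u + \<tau> *\<^sub>R v) v \<bullet> u))"
      using \<sigma>(3) by auto
    have "norm ((x + \<sigma> *\<^sub>R u + \<tau> *\<^sub>R v) - x) \<le> \<sigma> * norm u + \<tau> * norm v"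
      using \<sigma>(1) \<tau>(1) norm_triangle_ineq[of "\<sigma> *\<^sub>R u" "\<tau> *\<^sub>R v"] by simp
    also have "\<dots> \<le> s * norm u + s * norm v"
      using \<sigma> \<tau> by (intro add_mono mult_right_mono) auto
    finally have "norm ((x + \<sigma> *\<^sub>R u + \<tau> *\<^sub>R v) - x) \<le> s * (norm u + norm v)"
      by (simp add: distrib_left)
    with \<tau>(3) show ?thesis by blast
  qed
  define s where "s = (\<lambda>n. 1 / real (Suc n))"
  have s: "s n > 0" for n by (simp add: s_def)
  have s0: "s \<longlonglongrightarrow> 0" unfolding s_def using LIMSEQ_Suc[OF lim_1_over_n] by simp
  have lim: "\<exists>z. (\<forall>n. ?\<Delta> (s n) u v = s n * (s n * (W' (z n) v \<bullet> u))) \<and> (\<lambda>n. W' (z n) v \<bullet> u) \<longlonglongrightarrow> W' x v \<bullet> u"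
    for u v
  proof -
    have "\<forall>n. \<exists>z. norm (z - x) \<le> s n * (norm u + norm v) \<and> ?\<Delta> (s n) u v = s n * (s n * (W' z v \<bullet> u))"
      using s by (intro allI mvt)
    then have "\<exists>z. \<forall>n. norm (z n - x) \<le> s n * (norm u + norm v) \<and> ?\<Delta> (s n) u v = s n * (s n * (W' (z n) v \<bullet> u))"
      by (rule choice)
    then obtain z where z: "\<And>n. norm (z n - x) \<le> s n * (norm u + norm v)"
        "\<And>n. ?\<Delta> (s n) u v = s n * (s n * (W' (z n) v \<bullet> u))"
      by blast
    have "(\<lambda>n. z n - x) \<longlonglongrightarrow> 0"
      by (rule Lim_null_comparison[OF _ tendsto_mult_left_zero[OF s0, of "norm u + norm v"]])
        (use z(1) in simp)
    then have zx: "z \<longlonglongrightarrow> x" by (simp add: LIM_zero_iff)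
    have "(\<lambda>n. W' (z n)) \<longlonglongrightarrow> W' x"
      by (rule continuous_on_tendsto_compose[OF W'(2) zx]) auto
    then have "(\<lambda>n. W' (z n) v \<bullet> u) \<longlonglongrightarrow> W' x v \<bullet> u"
      by (intro tendsto_intros)
    with z(2) show ?thesis by blast
  qed
  obtain z where z: "\<forall>n. ?\<Delta> (s n) u v = s n * (s n * (W' (z n) v \<bullet> u))" "(\<lambda>n. W' (z n) v \<bullet> u) \<longlonglongrightarrow> W' x v \<bullet> u"
    using lim[of u v] by blast
  obtain y where y: "\<forall>n. ?\<Delta> (s n) v u = s n * (s n * (W' (y n) u \<bullet> v))" "(\<lambda>n. W' (y n) u \<bullet> v) \<longlonglongrightarrow> W' x u \<bullet> v"
    using lim[of v u] by blast
  have "W' (y n) u \<bullet> v = W' (z n) v \<bullet> u" for n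
  proof -
    have comm: "x + s n *\<^sub>R v + s n *\<^sub>R u = x + s n *\<^sub>R u + s n *\<^sub>R v"
      by (simp only: add.assoc add.commute add.left_commute)
    have "s n * (s n * (W' (y n) u \<bullet> v)) = ?\<Delta> (s n) v u"
      by (rule sym, rule spec[OF y(1)])
    also have "\<dots> = ?\<Delta> (s n) u v"
      unfolding comm by (simp only: diff_right_commute)
    also have "\<dots> = s n * (s n * (W' (z n) v \<bullet> u))"
      using z(1) by (rule spec)
    finally show ?thesis using s[of n] by simp
  qed
  then have "(\<lambda>n. W' (y n) u \<bullet> v) = (\<lambda>n. W' (z n) v \<bullet> u)"
    by (rule ext)
  from y(2)[unfolded this] have "(\<lambda>n. W' (z n) v \<bullet> u) \<longlonglongrightarrow> W' x u \<bullet> v" .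
  then have "W' x v \<bullet> u = W' x u \<bullet> v" by (rule LIMSEQ_unique[OF z(2)])
  then show ?thesis by (simp add: A)
qed

section \<open>Implicit functions\<close>

text \<open>The partial derivative \<open>L\<close> in the second argument is bounded below, and by strict differentiability
the increments of \<open>F\<close> differ from the linear ones by a fraction of that bound. The resulting
inequality contains the uniqueness and the Lipschitz dependence of implicitly defined functions, and
it also compares points at which \<open>F\<close> does not vanish.\<close>
lemma implicit_lower_bound:
  fixes F :: "'a::real_normed_vector \<times> 'b::euclidean_space \<Rightarrow> 'c::euclidean_space"
  assumes F: "C1 F" and d: "((\<lambda>b. F (a0, b)) has_derivative L) (at b0)"
    and inj: "\<And>b. L b = 0 \<Longrightarrow> b = 0"
  obtains r C where "r > 0" "C > 0"
    "\<And>a a' b b'. a \<in> ball a0 r \<Longrightarrow> a' \<in> ball a0 r \<Longrightarrow> b \<in> ball b0 r \<Longrightarrow> b' \<in> ball b0 r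
      \<Longrightarrow> norm (b - b') \<le> C * (norm (a - a') + norm (F (a, b) - F (a', b')))"
proof -
  obtain F' where F': "\<And>x. (F has_derivative blinfun_apply (F' x)) (at x)"
    using F unfolding C1_def by blast
  let ?D = "blinfun_apply (F' (a0, b0))"
  have "((\<lambda>b. (a0, b)) has_derivative (\<lambda>b. (0, b))) (at b0)"
    by (auto intro!: derivative_eq_intros)
  from has_derivative_compose[OF this F'] have "((\<lambda>b. F (a0, b)) has_derivative (\<lambda>b. ?D (0, b))) (at b0)" .
  then have L: "L = (\<lambda>b. ?D (0, b))" by (rule has_derivative_unique[OF d])
  have bL: "bounded_linear L" using d by (rule has_derivative_bounded_linear)
  obtain c where c: "c > 0" "\<And>b. norm b \<le> c * norm (L b)"
  proof -
    have "inj L" using inj bL by (simp add: linear_injective_0 bounded_linear.linear)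
    then obtain e where e: "e > 0" "\<And>b. e * norm b \<le> norm (L b)"
      using linear_inj_bounded_below_pos[OF bounded_linear.linear[OF bL]] by blast
    show thesis
      by (rule that[of "1 / e"]) (use e in \<open>auto simp: field_simps\<close>)
  qed
  let ?K = "norm (F' (a0, b0))"
  define \<eta> where "\<eta> = 1 / (2 * c)"
  have \<eta>: "\<eta> > 0" using c(1) by (simp add: \<eta>_def)
  obtain r where r: "r > 0" "\<And>u v. u \<in> ball (a0, b0) r \<Longrightarrow> v \<in> ball (a0, b0) r
      \<Longrightarrow> norm (F u - F v - ?D (u - v)) \<le> \<eta> * norm (u - v)"
    using C1_strict_derivative[OF F F' \<eta>] by blast
  have near: "(a, b) \<in> ball (a0, b0) r" if "a \<in> ball a0 (r / 2)" "b \<in> ball b0 (r / 2)" for a b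
  proof -
    have "dist (a0, b0) (a, b) \<le> dist a0 a + dist b0 b"
      by (simp add: dist_Pair_Pair sqrt_sum_squares_le_sum)
    then show ?thesis using that by simp
  qed
  define C where "C = 2 * c * (1 + ?K + \<eta>)"
  have tri: "norm (x - y - z) \<le> norm x + norm y + norm z" for x y z :: 'c
    using norm_triangle_ineq4[of "x - y" z] norm_triangle_ineq4[of x y] by linarith
  show thesis
  proof (rule that[of "r / 2" C])
    show "r / 2 > 0" using r(1) by simp
    show "C > 0" unfolding C_def using c(1) \<eta> by (intro mult_pos_pos add_pos_nonneg add_nonneg_pos) auto
    fix a a' b b'
    assume "a \<in> ball a0 (r / 2)" "a' \<in> ball a0 (r / 2)" "b \<in> ball b0 (r / 2)" "b' \<in> ball b0 (r / 2)"
    then have "norm (F (a, b) - F (a', b') - ?D ((a, b) - (a', b'))) \<le> \<eta> * norm ((a, b) - (a', b'))"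
      by (intro r(2) near)
    also have "\<dots> \<le> \<eta> * (norm (a - a') + norm (b - b'))"
      using \<eta> by (intro mult_left_mono) (simp_all add: norm_Pair sqrt_sum_squares_le_sum)
    finally have 1: "norm (F (a, b) - F (a', b') - ?D ((a, b) - (a', b'))) \<le> \<eta> * (norm (a - a') + norm (b - b'))" .
    have split: "?D ((a, b) - (a', b')) = ?D (a - a', 0) + L (b - b')"
      by (simp add: L blinfun.add_right[symmetric])
    have "norm (?D (a - a', 0)) \<le> ?K * norm (a - a')"
      using norm_blinfun[of "F' (a0, b0)" "(a - a', 0)"] by (simp add: norm_Pair)
    moreover have "L (b - b') = (F (a, b) - F (a', b')) - (F (a, b) - F (a', b') - ?D ((a, b) - (a', b')))
        - ?D (a - a', 0)"
      using split by simp
    then have "norm (L (b - b')) \<le> norm (F (a, b) - F (a', b'))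
        + norm (F (a, b) - F (a', b') - ?D ((a, b) - (a', b'))) + norm (?D (a - a', 0))"
      using tri by (simp only:)
    ultimately have "norm (L (b - b')) \<le> norm (F (a, b) - F (a', b'))
        + \<eta> * (norm (a - a') + norm (b - b')) + ?K * norm (a - a')"
      using 1 by linarith
    then have "c * norm (L (b - b')) \<le> c * (norm (F (a, b) - F (a', b'))
        + \<eta> * (norm (a - a') + norm (b - b')) + ?K * norm (a - a'))"
      using c(1) by (intro mult_left_mono) auto
    also have "\<dots> = c * norm (F (a, b) - F (a', b')) + (c * \<eta> + c * ?K) * norm (a - a') + norm (b - b') / 2"
      using c(1) by (simp add: \<eta>_def field_simps)
    finally have "norm (b - b') \<le> 2 * c * norm (F (a, b) - F (a', b')) + 2 * c * (\<eta> + ?K) * norm (a - a')"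
      using c(2)[of "b - b'"] by (simp add: algebra_simps)
    also have "\<dots> \<le> C * norm (F (a, b) - F (a', b')) + C * norm (a - a')"
      unfolding C_def using c(1) \<eta> by (intro add_mono mult_right_mono) (auto simp: algebra_simps)
    finally show "norm (b - b') \<le> C * (norm (a - a') + norm (F (a, b) - F (a', b')))"
      by (simp add: algebra_simps)
  qed
qed

text \<open>The inverse function theorem for \<open>\<lambda>(a, b). (a, F (a, b))\<close> yields existence and
differentiability of the solution; uniqueness and the Lipschitz bound come from
\<open>implicit_lower_bound\<close>.\<close>
lemma implicit_function:
  fixes F :: "'a::euclidean_space \<times> 'b::euclidean_space \<Rightarrow> 'b"
  assumes F: "C1 F" and F0: "F (a0, b0) = 0"
    and d: "((\<lambda>b. F (a0, b)) has_derivative L) (at b0)"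
    and inj: "\<And>b. L b = 0 \<Longrightarrow> b = 0"
  obtains r C \<psi> where "r > 0" "C > 0"
    "\<And>a. a \<in> ball a0 r \<Longrightarrow> F (a, \<psi> a) = 0"
    "\<And>a b. a \<in> ball a0 r \<Longrightarrow> b \<in> ball b0 r \<Longrightarrow> F (a, b) = 0 \<Longrightarrow> b = \<psi> a"
    "\<And>a a'. a \<in> ball a0 r \<Longrightarrow> a' \<in> ball a0 r \<Longrightarrow> norm (\<psi> a - \<psi> a') \<le> C * norm (a - a')"
    "\<And>a. a \<in> ball a0 r \<Longrightarrow> \<psi> differentiable (at a)"
proof -
  obtain r0 C where r0: "r0 > 0" "C > 0"
    and lb: "\<And>a a' b b'. a \<in> ball a0 r0 \<Longrightarrow> a' \<in> ball a0 r0 \<Longrightarrow> b \<in> ball b0 r0 \<Longrightarrow> b' \<in> ball b0 r0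
      \<Longrightarrow> norm (b - b') \<le> C * (norm (a - a') + norm (F (a, b) - F (a', b')))"
    using implicit_lower_bound[OF F d inj] by blast
  define \<Psi> where "\<Psi> = (\<lambda>z. (fst z, F z))"
  have "C1 \<Psi>" unfolding \<Psi>_def by (intro C1_intros F)
  then obtain \<Psi>' where \<Psi>': "\<And>x. (\<Psi> has_derivative blinfun_apply (\<Psi>' x)) (at x)" "continuous_on UNIV \<Psi>'"
    unfolding C1_def by blast
  obtain F' where F': "\<And>x. (F has_derivative blinfun_apply (F' x)) (at x)"
    using F unfolding C1_def by blast
  have \<Psi>'_eq: "blinfun_apply (\<Psi>' x) = (\<lambda>u. (fst u, F' x u))" for x
    by (rule has_derivative_unique[OF \<Psi>'(1)]) (auto simp: \<Psi>_def intro!: derivative_eq_intros F')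
  have "((\<lambda>b. (a0, b)) has_derivative (\<lambda>b. (0, b))) (at b0)"
    by (auto intro!: derivative_eq_intros)
  from has_derivative_compose[OF this F'] have "((\<lambda>b. F (a0, b)) has_derivative (\<lambda>b. F' (a0, b0) (0, b))) (at b0)" .
  then have L: "L = (\<lambda>b. F' (a0, b0) (0, b))" by (rule has_derivative_unique[OF d])
  have "inj (blinfun_apply (\<Psi>' (a0, b0)))"
  proof (subst linear_injective_0)
    show "linear (blinfun_apply (\<Psi>' (a0, b0)))"
      by (rule bounded_linear.linear[OF blinfun.bounded_linear_right])
    show "\<forall>x. blinfun_apply (\<Psi>' (a0, b0)) x = 0 \<longrightarrow> x = 0"
      using inj unfolding \<Psi>'_eq by (auto simp: L zero_prod_def)
  qed
  from linear_injective_left_inverse[OF bounded_linear.linear[OF blinfun.bounded_linear_right] this]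
  obtain i where i: "linear i" "i \<circ> blinfun_apply (\<Psi>' (a0, b0)) = id" by blast
  have "bounded_linear i" using i(1) by (simp add: linear_conv_bounded_linear)
  then have inv: "Blinfun i o\<^sub>L \<Psi>' (a0, b0) = id_blinfun"
    by (intro blinfun_eqI) (simp add: bounded_linear_Blinfun_apply fun_cong[OF i(2), unfolded o_def id_def])
  let ?U = "ball a0 r0 \<times> ball b0 r0"
  have cU: "continuous_on ?U \<Psi>'" by (rule continuous_on_subset[OF \<Psi>'(2)]) simp
  have z0: "(a0, b0) \<in> ?U" using r0 by simp
  obtain U V G G' where UV: "U \<subseteq> ?U" "open V" "\<Psi> (a0, b0) \<in> V" "homeomorphism U V \<Psi> G"
      "\<And>y. y \<in> V \<Longrightarrow> (G has_derivative (G' y)) (at y)"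
    using inverse_function_theorem[OF open_Times[OF open_ball open_ball] \<Psi>'(1) cU z0 inv] by metis
  have "(a0, 0) \<in> V" using UV(3) by (simp add: \<Psi>_def F0)
  then obtain r1 where r1: "r1 > 0" "ball (a0, 0) r1 \<subseteq> V" using UV(2) openE by blast
  define r where "r = min r0 r1"
  define \<psi> where "\<psi> = (\<lambda>a. snd (G (a, 0)))"
  have V: "(a, 0) \<in> V" if "a \<in> ball a0 r" for a
    using that r1(2) by (auto simp: r_def dist_Pair_Pair)
  have G: "\<Psi> (a, \<psi> a) = (a, 0) \<and> \<psi> a \<in> ball b0 r0" if "a \<in> ball a0 r" for a
  proof -
    have "\<Psi> (G (a, 0)) = (a, 0)" "G (a, 0) \<in> U"
      using UV(4) V[OF that] by (auto simp: homeomorphism_def)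
    moreover from this have "fst (G (a, 0)) = a" by (simp add: \<Psi>_def)
    ultimately have "\<Psi> (a, \<psi> a) = (a, 0)" "(a, \<psi> a) \<in> U"
      unfolding \<psi>_def by (metis prod.collapse)+
    with UV(1) show ?thesis by auto
  qed
  show thesis
  proof (rule that)
    show "r > 0" "C > 0" using r0 r1 by (auto simp: r_def)
    show zero: "F (a, \<psi> a) = 0" if "a \<in> ball a0 r" for a
      using G[OF that] by (simp add: \<Psi>_def)
    show "b = \<psi> a" if "a \<in> ball a0 r" "b \<in> ball b0 r" "F (a, b) = 0" for a b
    proof -
      have "norm (b - \<psi> a) \<le> C * (norm (a - a) + norm (F (a, b) - F (a, \<psi> a)))"
        using that G[OF that(1)] by (intro lb) (auto simp: r_def)
      then show ?thesis using that zero by simp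
    qed
    show "norm (\<psi> a - \<psi> a') \<le> C * norm (a - a')" if "a \<in> ball a0 r" "a' \<in> ball a0 r" for a a'
    proof -
      have "norm (\<psi> a - \<psi> a') \<le> C * (norm (a - a') + norm (F (a, \<psi> a) - F (a', \<psi> a')))"
        using that G[OF that(1)] G[OF that(2)] by (intro lb) (auto simp: r_def)
      then show ?thesis using that zero by simp
    qed
    show "\<psi> differentiable (at a)" if "a \<in> ball a0 r" for a
    proof -
      have "((\<lambda>a. (a, 0 :: 'b)) has_derivative (\<lambda>u. (u, 0))) (at a)"
        by (auto intro!: derivative_eq_intros)
      from has_derivative_compose[OF this UV(5)[OF V[OF that]]]
      have "((\<lambda>a. G (a, 0)) has_derivative (\<lambda>u. G' (a, 0) (u, 0))) (at a)" .
      from has_derivative_snd[OF this] show ?thesis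
        unfolding \<psi>_def differentiable_def by blast
    qed
  qed
qed

section \<open>From local radii to continuous and uniform ones\<close>

text \<open>The supremum of the radii \<open>r \<le> 1\<close> such that \<open>P y r\<close> holds on the whole ball of radius \<open>r\<close> around
\<open>x\<close> is \<open>1\<close>-Lipschitz in \<open>x\<close>: moving the centre by \<open>d\<close> costs at most \<open>d\<close> of the radius. Half of it
is still attained, hence is a continuous choice of admissible radii.\<close>
lemma continuous_selection:
  fixes S :: "'a::metric_space set"
  assumes anti: "\<And>x r r'. x \<in> S \<Longrightarrow> 0 < r \<Longrightarrow> r \<le> r' \<Longrightarrow> P x r' \<Longrightarrow> P x r"
    and local: "\<And>x. x \<in> S \<Longrightarrow> \<exists>r>0. \<forall>y\<in>S \<inter> ball x r. P y r"
  obtains \<phi> :: "'a \<Rightarrow> real" where "continuous_on S \<phi>" "\<And>x. x \<in> S \<Longrightarrow> \<phi> x > 0" "\<And>x. x \<in> S \<Longrightarrow> P x (\<phi> x)"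
proof -
  define A where "A = (\<lambda>x. {r. 0 < r \<and> r \<le> 1 \<and> (\<forall>y\<in>S \<inter> ball x r. P y r)})"
  have bdd: "bdd_above (A x)" for x
    unfolding A_def by (rule bdd_aboveI[of _ 1]) auto
  have ne: "A x \<noteq> {}" if x: "x \<in> S" for x
  proof -
    obtain r where r: "r > 0" "\<forall>y\<in>S \<inter> ball x r. P y r" using local[OF x] by blast
    have "P y (min r 1)" if "y \<in> S \<inter> ball x (min r 1)" for y
      by (rule anti[of y _ r]) (use that r in auto)
    then have "min r 1 \<in> A x"
      unfolding A_def using r(1) by simp
    then show ?thesis by blast
  qed
  define \<sigma> where "\<sigma> = (\<lambda>x. Sup (A x))"
  have pos: "\<sigma> x > 0" if x: "x \<in> S" for x
  proof -
    obtain r where "r \<in> A x" using ne[OF x] by blast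
    then have "0 < r" "r \<le> \<sigma> x"
      unfolding \<sigma>_def by (simp add: A_def, rule cSup_upper[OF _ bdd])
    then show ?thesis by simp
  qed
  have lip: "\<sigma> x \<le> \<sigma> x' + dist x x'" if x: "x \<in> S" "x' \<in> S" for x x'
    unfolding \<sigma>_def[THEN fun_cong, of x]
  proof (rule cSup_least[OF ne[OF x(1)]])
    fix r assume r: "r \<in> A x"
    show "r \<le> \<sigma> x' + dist x x'"
    proof (cases "r \<le> dist x x'")
      case True
      then show ?thesis using pos[OF x(2)] by simp
    next
      case False
      have "r - dist x x' \<in> A x'"
        unfolding A_def
      proof (intro CollectI conjI ballI)
        fix y assume y: "y \<in> S \<inter> ball x' (r - dist x x')"
        have "dist x y \<le> dist x x' + dist x' y" by (rule dist_triangle)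
        with y have "y \<in> S \<inter> ball x r" by auto
        then have "P y r" using r by (auto simp: A_def)
        then show "P y (r - dist x x')"
          by (rule anti[of y _ r, rotated -1]) (use y False in auto)
      next
        show "0 < r - dist x x'" using False by simp
        have "r \<le> 1" using r by (simp add: A_def)
        then show "r - dist x x' \<le> 1" using zero_le_dist[of x x'] by linarith
      qed
      then have "r - dist x x' \<le> \<sigma> x'"
        unfolding \<sigma>_def by (rule cSup_upper[OF _ bdd])
      then show ?thesis by simp
    qed
  qed
  have "1-lipschitz_on S \<sigma>"
  proof (rule lipschitz_onI)
    fix x y assume "x \<in> S" "y \<in> S"
    then show "dist (\<sigma> x) (\<sigma> y) \<le> 1 * dist x y"
      using lip[of x y] lip[of y x] by (simp add: dist_real_def dist_commute[of y x] abs_le_iff)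
  qed simp
  then have "continuous_on S \<sigma>" by (rule lipschitz_on_continuous_on)
  moreover have "P x (\<sigma> x / 2)" if x: "x \<in> S" for x
  proof -
    have "\<sigma> x / 2 < Sup (A x)" using pos[OF x] by (simp add: \<sigma>_def)
    then obtain r where r: "r \<in> A x" "\<sigma> x / 2 < r"
      using less_cSup_iff[OF ne[OF x] bdd] by blast
    then have "P x r" using x by (auto simp: A_def)
    then show ?thesis by (rule anti[of x _ r, rotated -1]) (use r pos[OF x] x in auto)
  qed
  ultimately show thesis
    using pos by (intro that[of "\<lambda>x. \<sigma> x / 2"]) (auto intro!: continuous_intros)
qed

text \<open>A continuous selection attains its minimum on a compact set.\<close>
lemma uniform_on_compact:
  fixes S :: "'a::metric_space set"
  assumes anti: "\<And>x r r'. x \<in> S \<Longrightarrow> 0 < r \<Longrightarrow> r \<le> r' \<Longrightarrow> P x r' \<Longrightarrow> P x r"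
    and local: "\<And>x. x \<in> S \<Longrightarrow> \<exists>r>0. \<forall>y\<in>S \<inter> ball x r. P y r"
    and K: "compact K" "K \<subseteq> S"
  obtains r :: real where "r > 0" "\<And>x. x \<in> K \<Longrightarrow> P x r"
proof (cases "K = {}")
  case False
  obtain \<phi> :: "'a \<Rightarrow> real" where \<phi>: "continuous_on S \<phi>" "\<And>x. x \<in> S \<Longrightarrow> \<phi> x > 0" "\<And>x. x \<in> S \<Longrightarrow> P x (\<phi> x)"
    by (rule continuous_selection[of S P, OF anti local]; blast)
  obtain z where z: "z \<in> K" "\<And>x. x \<in> K \<Longrightarrow> \<phi> z \<le> \<phi> x"
    using continuous_attains_inf[OF K(1) False continuous_on_subset[OF \<phi>(1) K(2)]] by blast
  show thesis
  proof (rule that[of "\<phi> z"])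
    show "\<phi> z > 0" using z K \<phi> by blast
    show "P x (\<phi> z)" if "x \<in> K" for x
    proof (rule anti[of x _ "\<phi> x"])
      show x: "x \<in> S" using that K(2) by blast
      show "P x (\<phi> x)" using \<phi>(3)[OF x] .
      show "0 < \<phi> z" using z(1) K(2) \<phi>(2) by blast
    qed (rule z(2)[OF that])
  qed
qed (use that[of 1] in simp)

section \<open>Gradients, Jacobians and the constrained system\<close>

text \<open>Products with \<open>G\<^sup>T\<close> stay in the form in which the scheme contains them.\<close>
declare transpose_matrix_vector [simp del]

lemma bounded_linear_matrix_of_blinfun:
  "bounded_linear (\<lambda>L :: (real^'n) \<Rightarrow>\<^sub>L (real^'m). matrix (blinfun_apply L))"
proof (subst bounded_linear_componentwise_iff, intro ballI)
  fix e :: "real^'n^'m" assume "e \<in> Basis"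
  then obtain i j where e: "e = axis i (axis j 1)"
    by (auto simp: Basis_vec_def)
  have "(\<lambda>L :: (real^'n) \<Rightarrow>\<^sub>L (real^'m). matrix (blinfun_apply L) \<bullet> e) = (\<lambda>L. blinfun_apply L (axis j 1) $ i)"
    by (simp add: e inner_axis matrix_def)
  then show "bounded_linear (\<lambda>L :: (real^'n) \<Rightarrow>\<^sub>L (real^'m). matrix (blinfun_apply L) \<bullet> e)"
    by (simp add: bounded_linear_compose[OF bounded_linear_vec_nth blinfun.bounded_linear_left])
qed

lemma has_derivative_jacobian:
  fixes g :: "real^'n \<Rightarrow> real^'m"
  assumes "(g has_derivative D) (at x)"
  shows "(g has_derivative (*v) (jacobian g (at x))) (at x)"
  using jacobian_works[of g "at x"] assms unfolding differentiable_def by blast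

lemma C2_jacobian:
  fixes g :: "real^'n \<Rightarrow> real^'m"
  assumes "C2 g"
  shows "(g has_derivative (*v) (jacobian g (at x))) (at x)" "C1 (\<lambda>x. jacobian g (at x))"
proof -
  obtain g' where g': "\<And>x. (g has_derivative blinfun_apply (g' x)) (at x)" "C1 g'"
    using assms unfolding C2_def by blast
  show "(g has_derivative (*v) (jacobian g (at x))) (at x)"
    by (rule has_derivative_jacobian[OF g'(1)])
  have "jacobian g (at x) = matrix (blinfun_apply (g' x))" for x
    unfolding jacobian_def using frechet_derivative_at[OF g'(1)] by simp
  then show "C1 (\<lambda>x. jacobian g (at x))"
    using C1_linear_compose[OF bounded_linear_matrix_of_blinfun g'(2)] by simp
qed

lemma C2_gradient:
  fixes f :: "'a::euclidean_space \<Rightarrow> real"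
  assumes "C2 f"
  shows "(f has_derivative (\<lambda>u. grad f x \<bullet> u)) (at x)" "C1 (grad f)"
proof -
  obtain f' where f': "\<And>x. (f has_derivative blinfun_apply (f' x)) (at x)" "C1 f'"
    using assms unfolding C2_def by blast
  define W where "W = (\<lambda>x. \<Sum>b\<in>Basis. blinfun_apply (f' x) b *\<^sub>R b)"
  have W: "blinfun_apply (f' x) u = W x \<bullet> u" for x u
  proof -
    have "blinfun_apply (f' x) u = blinfun_apply (f' x) (\<Sum>b\<in>Basis. (u \<bullet> b) *\<^sub>R b)"
      by (simp add: euclidean_representation)
    also have "\<dots> = W x \<bullet> u"
      unfolding W_def blinfun.sum_right inner_sum_left
      by (simp add: blinfun.scaleR_right inner_commute[of u] mult.commute)
    finally show ?thesis .
  qed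
  have d: "(f has_derivative (\<lambda>u. W x \<bullet> u)) (at x)" for x
    using f'(1)[of x] by (simp add: W[abs_def])
  have eq: "grad f x = W x" for x
    unfolding grad_def gderiv_def
  proof (rule the_equality)
    show "(f has_derivative (\<lambda>u. u \<bullet> W x)) (at x)"
      using d[of x] by (simp add: inner_commute)
    fix D assume "(f has_derivative (\<lambda>u. u \<bullet> D)) (at x)"
    from has_derivative_unique[OF this d] have "u \<bullet> D = u \<bullet> W x" for u
      by (metis inner_commute)
    then show "D = W x" by (metis vector_eq_ldot)
  qed
  show "(f has_derivative (\<lambda>u. grad f x \<bullet> u)) (at x)" using d by (simp add: eq)
  have "bounded_linear (\<lambda>L :: 'a \<Rightarrow>\<^sub>L real. \<Sum>b\<in>Basis. blinfun_apply L b *\<^sub>R b)"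
    by (intro bounded_linear_sum bounded_linear_compose[OF bounded_linear_scaleR_left blinfun.bounded_linear_left])
  from C1_linear_compose[OF this f'(2)] have "C1 W" unfolding W_def .
  then show "C1 (grad f)" using eq[abs_def] by (metis ext)
qed

lemma C2_separable_kinetic:
  fixes T f :: "'a::euclidean_space \<Rightarrow> real"
  assumes "C2 (\<lambda>(q, p). T p + f q)"
  shows "C2 T"
proof -
  obtain H' where H': "\<And>x. ((\<lambda>(q, p). T p + f q) has_derivative blinfun_apply (H' x)) (at x)" "C1 H'"
    using assms unfolding C2_def by blast
  define i where "i = (Blinfun (\<lambda>p. (0, p)) :: 'a \<Rightarrow>\<^sub>L ('a \<times> 'a))"
  have i: "blinfun_apply i u = (0, u)" for u
    unfolding i_def by (intro bounded_linear_Blinfun_apply[THEN fun_cong] bounded_linear_Pair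
        bounded_linear_ident bounded_linear_zero)
  have "(T has_derivative blinfun_apply (H' (0, p) o\<^sub>L i)) (at p)" for p
  proof -
    have "((\<lambda>p. (0, p)) has_derivative (\<lambda>u. (0, u))) (at p)"
      by (auto intro!: derivative_eq_intros)
    from has_derivative_compose[OF this H'(1)]
    have "((\<lambda>p. (T p + f 0) - f 0) has_derivative (\<lambda>u. H' (0, p) (0, u) - 0)) (at p)"
      by (intro has_derivative_diff has_derivative_const) simp
    then show ?thesis by (simp add: i has_derivative_eq_rhs fun_eq_iff)
  qed
  moreover have "C1 (\<lambda>p. H' (0, p) o\<^sub>L i)"
    by (intro C1_bounded_bilinear[OF bounded_bilinear_blinfun_compose] C1_compose[OF H'(2)] C1_intros)
  ultimately show ?thesis unfolding C2_def by (intro exI[of _ "\<lambda>p. H' (0, p) o\<^sub>L i"]) simp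
qed

text \<open>The kinetic energy is assumed to be \<open>C\<^sup>2\<close> by itself; \<open>C2_separable_kinetic\<close> derives this from the
regularity of the Hamiltonian.\<close>
locale constrained_system =
  fixes g :: "real^'n \<Rightarrow> real^'m" and f T :: "real^'n \<Rightarrow> real" and \<gamma> :: real
  assumes C2_g: "C2 g" and C2_f: "C2 f" and C2_T: "C2 T" and \<gamma>: "\<gamma> > 0"
    and invertible_schur: "\<And>q p. (q, p) \<in> phase_manifold T g \<Longrightarrow>
      invertible (jacobian g (at q) ** hess T p ** transpose (jacobian g (at q)))"
begin

abbreviation "S \<equiv> phase_manifold T g"
abbreviation "J q \<equiv> jacobian g (at q)"
abbreviation "N q \<equiv> transpose (jacobian g (at q))"

lemma S_iff: "(q, p) \<in> S \<longleftrightarrow> g q = 0 \<and> J q *v grad T p = 0"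
  by (simp add: phase_manifold_def)

lemmas C1_J = C2_jacobian(2)[OF C2_g]
lemmas g_derivative = C2_jacobian(1)[OF C2_g]
lemmas C1_grad_f = C2_gradient(2)[OF C2_f]
lemmas C1_grad_T = C2_gradient(2)[OF C2_T]

lemmas C1_data = C1_compose[OF C1_J] C1_compose[OF C1_grad_f] C1_compose[OF C1_grad_T]

lemma grad_T_derivative: "(grad T has_derivative (*v) (hess T p)) (at p)"
proof -
  obtain D where "(grad T has_derivative D) (at p)"
    using C1_grad_T unfolding C1_def by blast
  then show ?thesis unfolding hess_def by (rule has_derivative_jacobian)
qed

lemma schur_injective:
  assumes "(q, p) \<in> S" "J q *v (hess T p *v (N q *v v)) = 0"
  shows "v = 0"
proof -
  obtain B where "B ** (J q ** hess T p ** N q) = mat 1"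
    using invertible_schur[OF assms(1)] unfolding invertible_def by blast
  moreover have "(J q ** hess T p ** N q) *v v = 0"
    using assms(2) by (metis matrix_vector_mul_assoc)
  ultimately show ?thesis
    by (metis matrix_vector_mul_assoc matrix_vector_mul_lid matrix_vector_mult_0_right)
qed

lemma transpose_injective:
  assumes "(q, p) \<in> S" "N q *v v = 0"
  shows "v = 0"
  using schur_injective[OF assms(1), of v] assms(2) by simp

section \<open>The equations of one step\<close>

text \<open>The unknowns are the multipliers scaled by the step size, \<open>\<Lambda> = (h / 2) l\<close> and \<open>M = (h / 2) \<mu>\<close>. They
tend to zero with \<open>h\<close>, whereas \<open>l\<close> and \<open>\<mu>\<close> drop out of the equations at \<open>h = 0\<close>. All other quantities
of a step are explicit \<open>C\<^sup>1\<close> functions of the argument \<open>(((q, p), h), (\<Lambda>, M))\<close>.\<close>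
definition half_momentum ::
    "(((real^'n) \<times> (real^'n)) \<times> real) \<times> ((real^'m) \<times> (real^'m)) \<Rightarrow> real^'n" where
  "half_momentum u = (case u of (((q, p), h), (\<Lambda>, M)) \<Rightarrow>
     exp (- \<gamma> * h) *\<^sub>R p - (h / 2) *\<^sub>R grad f q - N q *v \<Lambda>)"

definition next_position ::
    "(((real^'n) \<times> (real^'n)) \<times> real) \<times> ((real^'m) \<times> (real^'m)) \<Rightarrow> real^'n" where
  "next_position u = (case u of (((q, p), h), (\<Lambda>, M)) \<Rightarrow> q + h *\<^sub>R grad T (half_momentum u))"

definition next_momentum ::
    "(((real^'n) \<times> (real^'n)) \<times> real) \<times> ((real^'m) \<times> (real^'m)) \<Rightarrow> real^'n" where
  "next_momentum u = (case u of (((q, p), h), (\<Lambda>, M)) \<Rightarrow>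
     half_momentum u - (h / 2) *\<^sub>R grad f (next_position u) - N (next_position u) *v M)"

text \<open>This is \<open>(g q\<^sub>1 - g q) / h\<close> for the next position \<open>q\<^sub>1\<close> (see \<open>mean_constraint_scaled\<close>), written as an
integral so that it makes sense and is \<open>C\<^sup>1\<close> at \<open>h = 0\<close>. Dividing by \<open>h\<close> is essential: the equation
\<open>g q\<^sub>1 = 0\<close> itself degenerates as \<open>h \<rightarrow> 0\<close>.\<close>
definition mean_constraint ::
    "(((real^'n) \<times> (real^'n)) \<times> real) \<times> ((real^'m) \<times> (real^'m)) \<Rightarrow> real^'m" where
  "mean_constraint u = (case u of (((q, p), h), (\<Lambda>, M)) \<Rightarrow>
     integral {0..1} (\<lambda>s. J (q + (s * h) *\<^sub>R grad T (half_momentum u)) *v grad T (half_momentum u)))"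

definition residual where
  "residual u = (mean_constraint u, J (next_position u) *v grad T (next_momentum u))"

lemma C1_half_momentum: "C1 half_momentum"
  unfolding half_momentum_def split_beta by (intro C1_intros C1_data)

lemma C1_next_position: "C1 next_position"
  unfolding next_position_def split_beta by (intro C1_intros C1_data C1_compose[OF C1_half_momentum])

lemma C1_next_momentum: "C1 next_momentum"
  unfolding next_momentum_def split_beta
  by (intro C1_intros C1_data C1_compose[OF C1_half_momentum] C1_compose[OF C1_next_position])

lemma C1_mean_constraint: "C1 mean_constraint"
proof -
  define k where "k = (\<lambda>u s. J (fst (fst (fst u)) + (s * snd (fst u)) *\<^sub>R grad T (half_momentum u))
      *v grad T (half_momentum u))"
  have "C1 (\<lambda>z. k (fst z) (snd z))"
    unfolding k_def by (intro C1_intros C1_data C1_compose[OF C1_half_momentum])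
  then have "C1 (\<lambda>u. integral {0..1} (k u))" by (rule C1_integral)
  moreover have "mean_constraint = (\<lambda>u. integral {0..1} (k u))"
    unfolding mean_constraint_def k_def split_beta ..
  ultimately show ?thesis by simp
qed

lemma C1_residual: "C1 residual"
  unfolding residual_def
  by (intro C1_intros C1_data C1_next_position C1_next_momentum C1_mean_constraint)

lemma mean_constraint_scaled:
  "h *\<^sub>R mean_constraint (((q, p), h), b) = g (next_position (((q, p), h), b)) - g q"
proof -
  let ?v = "grad T (half_momentum (((q, p), h), b))"
  have "((\<lambda>s. h *\<^sub>R (J (q + (s * h) *\<^sub>R ?v) *v ?v)) has_integral
      g (q + (1 * h) *\<^sub>R ?v) - g (q + (0 * h) *\<^sub>R ?v)) {0..1}"
  proof (rule fundamental_theorem_of_calculus)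
    fix s :: real
    have "((\<lambda>s. q + (s * h) *\<^sub>R ?v) has_derivative (\<lambda>u. (u * h) *\<^sub>R ?v)) (at s within {0..1})"
      by (auto intro!: derivative_eq_intros)
    from has_derivative_compose[OF this g_derivative]
    have "((\<lambda>s. g (q + (s * h) *\<^sub>R ?v)) has_derivative
       (\<lambda>u. J (q + (s * h) *\<^sub>R ?v) *v ((u * h) *\<^sub>R ?v))) (at s within {0..1})" .
    then show "((\<lambda>s. g (q + (s * h) *\<^sub>R ?v)) has_vector_derivative
        h *\<^sub>R (J (q + (s * h) *\<^sub>R ?v) *v ?v)) (at s within {0..1})"
      unfolding has_vector_derivative_def by (simp add: matrix_vector_mult_scaleR)
  qed simp
  then show ?thesis
    by (cases b) (simp add: mean_constraint_def next_position_def integral_unique flip: integral_cmul)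
qed

lemma scheme_iff_residual:
  assumes "h > 0" "g q = 0"
  shows "scheme T f g \<gamma> h (q, p) (a, l, q', \<mu>, p') \<longleftrightarrow>
    (let u = (((q, p), h), ((h / 2) *\<^sub>R l, (h / 2) *\<^sub>R \<mu>)) in
      a = half_momentum u \<and> q' = next_position u \<and> p' = next_momentum u \<and> residual u = 0)"
proof -
  let ?u = "(((q, p), h), ((h / 2) *\<^sub>R l, (h / 2) *\<^sub>R \<mu>))"
  have eq: "half_momentum ?u = exp (- \<gamma> * h) *\<^sub>R p - (h / 2) *\<^sub>R (grad f q + N q *v l)"
    "next_position ?u = q + h *\<^sub>R grad T (half_momentum ?u)"
    "next_momentum ?u = half_momentum ?u
       - (h / 2) *\<^sub>R (grad f (next_position ?u) + N (next_position ?u) *v \<mu>)"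
    by (simp_all add: half_momentum_def next_position_def next_momentum_def
        matrix_vector_mult_scaleR scaleR_right_distrib diff_diff_eq)
  have "mean_constraint ?u = 0 \<longleftrightarrow> 0 = g (next_position ?u)"
    using mean_constraint_scaled[of h q p "((h / 2) *\<^sub>R l, (h / 2) *\<^sub>R \<mu>)"] assms by auto
  then show ?thesis
    unfolding scheme_def Let_def residual_def zero_prod_def prod.case prod.inject eq(1)[symmetric]
    by (metis eq(2,3))
qed

lemma residual_at_zero_step:
  "residual (((q, p), 0), (\<Lambda>, M)) = (J q *v grad T (p - N q *v \<Lambda>), J q *v grad T (p - N q *v \<Lambda> - N q *v M))"
  "half_momentum (((q, p), 0), 0) = p" "next_position (((q, p), 0), 0) = q"
  "next_momentum (((q, p), 0), 0) = p"
  by (auto simp: residual_def mean_constraint_def half_momentum_def next_position_def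
      next_momentum_def zero_prod_def)

text \<open>At \<open>h = 0\<close> the linearization in the multipliers is block triangular, and both diagonal blocks are
the negative of the matrix \<open>G H\<^sub>p\<^sub>p G\<^sup>T\<close>, which is invertible on the phase manifold.\<close>
lemma residual_zero_step_derivative:
  "((\<lambda>b. residual (((q, p), 0), b)) has_derivative
     (\<lambda>b. - (J q *v (hess T p *v (N q *v fst b)), J q *v (hess T p *v (N q *v (fst b + snd b)))))) (at 0)"
proof -
  have d: "((\<lambda>b. J q *v grad T (A b)) has_derivative (\<lambda>b. J q *v (hess T p *v A' b))) (at 0)"
    if A: "(A has_derivative A') (at (0 :: (real^'m) \<times> (real^'m)))" and "A 0 = p" for A A'
  proof -
    have "((\<lambda>b. grad T (A b)) has_derivative (\<lambda>b. hess T p *v A' b)) (at 0)"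
      using has_derivative_compose[OF A grad_T_derivative] that(2) by simp
    from bounded_linear.has_derivative[OF matrix_vector_mul_bounded_linear this] show ?thesis .
  qed
  have N: "((\<lambda>b. N q *v B b) has_derivative (\<lambda>b. N q *v B' b)) F"
    if "(B has_derivative B') F" for B B' and F :: "((real^'m) \<times> (real^'m)) filter"
    using bounded_linear.has_derivative[OF matrix_vector_mul_bounded_linear that] .
  have 1: "((\<lambda>b :: (real^'m) \<times> (real^'m). p - N q *v fst b) has_derivative (\<lambda>b. - (N q *v fst b))) (at 0)"
    using has_derivative_diff[OF has_derivative_const[of p "at 0"] N[OF has_derivative_fst[OF has_derivative_ident]]] by simp
  have 2: "((\<lambda>b :: (real^'m) \<times> (real^'m). p - N q *v fst b - N q *v snd b) has_derivative (\<lambda>b. - (N q *v (fst b + snd b)))) (at 0)"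
    using has_derivative_diff[OF 1 N[OF has_derivative_snd[OF has_derivative_ident]]]
    by (simp add: matrix_vector_right_distrib)
  have "((\<lambda>b. (J q *v grad T (p - N q *v fst b), J q *v grad T (p - N q *v fst b - N q *v snd b)))
      has_derivative (\<lambda>b. (J q *v (hess T p *v - (N q *v fst b)), J q *v (hess T p *v - (N q *v (fst b + snd b)))))) (at 0)"
    by (intro has_derivative_Pair d 1 2) auto
  then show ?thesis
    by (simp add: residual_at_zero_step(1)[of q p "fst b" "snd b" for b, simplified] linear_neg[OF matrix_vector_mul_linear])
qed

text \<open>For small \<open>v\<close> this is \<open>implicit_lower_bound\<close>; the claim is homogeneous in \<open>v\<close>. It turns closeness of
the momenta of a step into smallness of its multipliers, which the notion of a nearby step leaves
unrestricted.\<close>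
lemma transpose_bounded_below:
  assumes "(q0, p0) \<in> S"
  obtains r c where "r > 0" "c > 0" "\<And>q v. dist q q0 < r \<Longrightarrow> norm v \<le> c * norm (N q *v v)"
proof -
  define F where "F = (\<lambda>z. N (fst z) *v snd z)"
  have F: "C1 F"
    unfolding F_def by (intro C1_intros C1_data)
  have d: "((\<lambda>v. F (q0, v)) has_derivative (\<lambda>v. N q0 *v v)) (at 0)"
    by (simp add: F_def bounded_linear_imp_has_derivative matrix_vector_mul_bounded_linear)
  obtain r C where r: "r > 0" "C > 0" and
    lb: "\<And>q q' v v'. q \<in> ball q0 r \<Longrightarrow> q' \<in> ball q0 r \<Longrightarrow> v \<in> ball 0 r \<Longrightarrow> v' \<in> ball 0 r \<Longrightarrow>
        norm (v - v') \<le> C * (norm (q - q') + norm (F (q, v) - F (q', v')))"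
    using implicit_lower_bound[OF F d transpose_injective[OF assms]] by blast
  show thesis
  proof (rule that[OF r])
    fix q v assume q: "dist q q0 < r"
    show "norm v \<le> C * norm (N q *v v)"
    proof (cases "v = 0")
      case False
      define c where "c = r / (2 * norm v)"
      have c: "c > 0" "norm (c *\<^sub>R v) < r" using False r by (auto simp: c_def)
      have "norm (c *\<^sub>R v - 0) \<le> C * (norm (q - q) + norm (F (q, c *\<^sub>R v) - F (q, 0)))"
        using q c r by (intro lb) (auto simp: dist_commute)
      then have "c * norm v \<le> c * (C * norm (N q *v v))"
        using c(1) by (simp add: F_def matrix_vector_mult_scaleR mult.left_commute)
      then show ?thesis using c(1) by simp
    qed simp
  qed
qed

end

section \<open>Local solution of the step equations\<close>

lemma dist_Pair_le: "dist (a, b) (a', b') \<le> dist a a' + dist b b'"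
  by (simp add: dist_Pair_Pair sqrt_sum_squares_le_sum)

context constrained_system
begin

text \<open>The inverse of the scaling of the multipliers.\<close>
definition step_of ::
    "(((real^'n) \<times> (real^'n)) \<times> real) \<times> ((real^'m) \<times> (real^'m)) \<Rightarrow> ('n, 'm) step" where
  "step_of u = (half_momentum u, (2 / snd (fst u)) *\<^sub>R fst (snd u), next_position u,
     (2 / snd (fst u)) *\<^sub>R snd (snd u), next_momentum u)"

definition step_bound ::
    "real \<Rightarrow> real \<Rightarrow> (real^'n) \<times> (real^'n) \<Rightarrow> ('n, 'm) step \<Rightarrow> bool" where
  "step_bound C h = (\<lambda>(q, p) (ph, l, q1, \<mu>, p1). dist ph p \<le> C * h \<and> dist q1 q \<le> C * h
     \<and> dist p1 p \<le> C * h \<and> norm l \<le> C \<and> norm \<mu> \<le> C)"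

text \<open>The implicit function theorem at \<open>(x0, 0)\<close> solves the equations for the scaled multipliers as a
function \<open>\<psi>\<close> of the current point and the step size. On the phase manifold \<open>\<psi>\<close> vanishes at step size
zero, so it is \<open>O(h)\<close>: positions and momenta move by \<open>O(h)\<close> and the unscaled multipliers stay
bounded. Conversely, a step whose momenta and position are close to the current point has small scaled
multipliers by \<open>transpose_bounded_below\<close>, and therefore is the one given by \<open>\<psi>\<close>.\<close>
lemma local_step:
  assumes x0: "x0 \<in> S"
  obtains r C \<sigma> where "r > 0" "C > 0"
    "\<And>y h. y \<in> S \<Longrightarrow> dist y x0 < r \<Longrightarrow> 0 < h \<Longrightarrow> h < r \<Longrightarrow>
       scheme T f g \<gamma> h y (\<sigma> h y) \<and> step_bound C h y (\<sigma> h y)"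
    "\<And>y h s. y \<in> S \<Longrightarrow> dist y x0 < r \<Longrightarrow> 0 < h \<Longrightarrow> h < r \<Longrightarrow>
       scheme T f g \<gamma> h y s \<Longrightarrow> near_step r y s \<Longrightarrow> s = \<sigma> h y"
    "\<And>y h. dist y x0 < r \<Longrightarrow> 0 < h \<Longrightarrow> h < r \<Longrightarrow> \<sigma> h differentiable (at y)"
proof -
  obtain q0 p0 where x0_eq: "x0 = (q0, p0)" by (cases x0)
  have S0: "(q0, p0) \<in> S" using x0 by (simp add: x0_eq)
  then have g0: "g q0 = 0" "J q0 *v grad T p0 = 0" by (simp_all add: S_iff)
  have on_S: "residual (((q, p), 0), 0) = 0" if "(q, p) \<in> S" for q p
    using that residual_at_zero_step(1)[of q p 0 0] by (simp add: S_iff zero_prod_def)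
  have inj: "b = 0" if "- (J q0 *v (hess T p0 *v (N q0 *v fst b)), J q0 *v (hess T p0 *v (N q0 *v (fst b + snd b)))) = 0"
    for b :: "(real^'m) \<times> (real^'m)"
  proof -
    have "fst b = 0" by (rule schur_injective[OF S0]) (use that in \<open>simp add: zero_prod_def\<close>)
    moreover have "fst b + snd b = 0" by (rule schur_injective[OF S0]) (use that in \<open>simp add: zero_prod_def\<close>)
    ultimately show ?thesis by (simp add: prod_eq_iff)
  qed
  obtain r1 c1 \<psi> where r1: "r1 > 0" "c1 > 0"
    and zero: "\<And>a. a \<in> ball (x0, 0) r1 \<Longrightarrow> residual (a, \<psi> a) = 0"
    and uniq: "\<And>a b. a \<in> ball (x0, 0) r1 \<Longrightarrow> b \<in> ball 0 r1 \<Longrightarrow> residual (a, b) = 0 \<Longrightarrow> b = \<psi> a"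
    and lip: "\<And>a a'. a \<in> ball (x0, 0) r1 \<Longrightarrow> a' \<in> ball (x0, 0) r1 \<Longrightarrow> norm (\<psi> a - \<psi> a') \<le> c1 * norm (a - a')"
    and diff: "\<And>a. a \<in> ball (x0, 0) r1 \<Longrightarrow> \<psi> differentiable (at a)"
    using implicit_function[OF C1_residual on_S[OF S0] residual_zero_step_derivative inj]
    unfolding x0_eq by blast
  obtain r2 c where r2: "r2 > 0" "c > 0" "\<And>q v. dist q q0 < r2 \<Longrightarrow> norm v \<le> c * norm (N q *v v)"
    using transpose_bounded_below[OF S0] by blast
  have "bounded (grad f ` cball q0 1)"
    by (intro compact_imp_bounded compact_continuous_image C1_imp_continuous[OF C1_grad_f]) simp
  then obtain B0 where B0: "\<And>q. q \<in> cball q0 1 \<Longrightarrow> norm (grad f q) \<le> B0"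
    unfolding bounded_iff by blast
  define B where "B = max B0 (norm p0 + 1)"
  have B: "B > 0" "norm p0 + 1 \<le> B" "\<And>q. dist q q0 \<le> 1 \<Longrightarrow> norm (grad f q) \<le> B"
  proof -
    show "B > 0" unfolding B_def by (rule less_le_trans[of _ "norm p0 + 1"]) (simp_all add: add_nonneg_pos)
    show "norm (grad f q) \<le> B" if "dist q q0 \<le> 1" for q
      using B0[of q] that unfolding B_def by (simp add: dist_commute le_max_iff_disj)
  qed (simp add: B_def)
  \<comment> \<open>The ball \<open>?W\<close> contains all arguments \<open>((y, h), \<psi> (y, h))\<close> and \<open>((y, 0), 0)\<close> that are compared below.\<close>
  define R where "R = 3 + c1"
  let ?W = "cball ((x0, 0), 0) R :: ((((real^'n) \<times> (real^'n)) \<times> real) \<times> ((real^'m) \<times> (real^'m))) set"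
  have "C1 (\<lambda>u. (half_momentum u, next_position u, next_momentum u))"
    by (intro C1_intros C1_half_momentum C1_next_position C1_next_momentum)
  then obtain K where K: "K > 0" "\<And>u v. u \<in> ?W \<Longrightarrow> v \<in> ?W \<Longrightarrow>
      norm ((half_momentum u, next_position u, next_momentum u)
       - (half_momentum v, next_position v, next_momentum v)) \<le> K * norm (u - v)"
    by (rule C1_lipschitz_on_cball[of _ "((x0, 0), 0)" R]) blast
  define k where "k = c * (2 + \<gamma> * B + B)"
  have k: "k > 0" unfolding k_def using r2 \<gamma> B(1) by (intro mult_pos_pos add_pos_pos) auto
  \<comment> \<open>\<open>k r\<close> will bound each scaled multiplier of a step in the \<open>r\<close>-neighbourhood; a third of
    \<open>r1\<close> for each keeps the pair strictly inside the ball of uniqueness.\<close>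
  define r where "r = min (min (r1 / 2) (r2 / 2)) (min (1 / 2) (r1 / (3 * k)))"
  have r: "r > 0" "r \<le> r1 / 2" "r \<le> r2 / 2" "r \<le> 1 / 2" "k * r \<le> r1 / 3"
  proof -
    show "r > 0" unfolding r_def using r1 r2 k by simp
    have "r \<le> r1 / (3 * k)" unfolding r_def by simp
    then show "k * r \<le> r1 / 3" using k by (simp add: field_simps)
  qed (auto simp: r_def)
  define C where "C = max (K * (1 + c1)) (2 * c1)"
  have C: "C > 0" "K * (1 + c1) \<le> C" "2 * c1 \<le> C"
    unfolding C_def using r1 by (auto simp: less_max_iff_disj)
  define \<sigma> where "\<sigma> = (\<lambda>h y. step_of ((y, h), \<psi> (y, h)))"
  have ball: "(y, h) \<in> ball (x0, 0) r1" if "dist y x0 < r" "0 \<le> h" "h < r" for y h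
  proof -
    have "dist (x0, 0) (y, h) \<le> dist x0 y + dist 0 h" by (rule dist_Pair_le)
    then show ?thesis using that r by (simp add: dist_commute)
  qed
  show thesis
  proof (rule that[OF r(1) C(1)])
    fix y h assume y: "y \<in> S" "dist y x0 < r" and h: "0 < h" "h < r"
    obtain q p where y_eq: "y = (q, p)" by (cases y)
    have yS: "(q, p) \<in> S" using y by (simp add: y_eq)
    let ?u = "((y, h), \<psi> (y, h))"
    have \<psi>0: "\<psi> (y, 0) = 0"
      using uniq[of "(y, 0)" 0] ball[of y 0] y h r on_S[OF yS] r1 by (simp add: y_eq)
    have "norm (\<psi> (y, h) - \<psi> (y, 0)) \<le> c1 * norm ((y, h) - (y, 0))"
      using y h r by (intro lip ball) auto
    then have \<psi>h: "norm (\<psi> (y, h)) \<le> c1 * h" using h by (simp add: \<psi>0 norm_Pair)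
    have "dist ((x0, 0), 0) ?u \<le> dist (x0, 0) (y, h) + dist 0 (\<psi> (y, h))" by (rule dist_Pair_le)
    also have "\<dots> \<le> (dist x0 y + dist 0 h) + dist 0 (\<psi> (y, h))"
      by (intro add_right_mono dist_Pair_le)
    also have "\<dots> \<le> R"
    proof -
      have "c1 * h \<le> c1 * 1" using h r r1 by (intro mult_left_mono) auto
      then show ?thesis using \<psi>h y h r unfolding R_def by (simp add: dist_commute)
    qed
    finally have uW: "?u \<in> ?W" by simp
    have "dist ((x0, 0), 0) ((y, 0), 0) \<le> R"
      using y r r1 unfolding R_def by (simp add: dist_Pair_Pair dist_commute)
    then have vW: "((y, 0), 0) \<in> ?W" by simp
    have uv: "norm (?u - ((y, 0), 0)) \<le> (1 + c1) * h"
    proof -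
      have "norm (?u - ((y, 0), 0)) \<le> norm ((y, h) - (y, 0)) + norm (\<psi> (y, h))"
        using norm_Pair_le[of "(y, h) - (y, 0)" "\<psi> (y, h)"] by simp
      then show ?thesis using \<psi>h h by (simp add: norm_Pair algebra_simps)
    qed
    have "norm ((half_momentum ?u, next_position ?u, next_momentum ?u) - (p, q, p)) \<le> K * norm (?u - ((y, 0), 0))"
      using K(2)[OF uW vW] by (simp add: y_eq residual_at_zero_step)
    also have "\<dots> \<le> K * ((1 + c1) * h)" using uv K(1) by (intro mult_left_mono) auto
    also have "\<dots> \<le> C * h" using C(2) h mult_right_mono[OF C(2), of h] by (simp add: mult.assoc)
    finally have bd: "norm ((half_momentum ?u - p, next_position ?u - q, next_momentum ?u - p)) \<le> C * h" by simp
    have "norm (half_momentum ?u - p) \<le> C * h"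
      by (rule order_trans[OF norm_fst_le bd])
    moreover have bd2: "norm ((next_position ?u - q, next_momentum ?u - p)) \<le> C * h"
      by (rule order_trans[OF norm_snd_le bd])
    have "norm (next_position ?u - q) \<le> C * h" "norm (next_momentum ?u - p) \<le> C * h"
      by (rule order_trans[OF norm_fst_le bd2], rule order_trans[OF norm_snd_le bd2])
    moreover have "norm (fst (\<psi> (y, h))) \<le> c1 * h" "norm (snd (\<psi> (y, h))) \<le> c1 * h"
      using \<psi>h norm_fst_le[of "fst (\<psi> (y, h))" "snd (\<psi> (y, h))"] norm_snd_le[of "snd (\<psi> (y, h))" "fst (\<psi> (y, h))"] by simp_all
    moreover have "norm ((2 / h) *\<^sub>R v) \<le> C" if "norm v \<le> c1 * h" for v :: "real^'m"
    proof -
      have "norm ((2 / h) *\<^sub>R v) = (2 / h) * norm v" using h by simp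
      also have "\<dots> \<le> (2 / h) * (c1 * h)" using that h by (intro mult_left_mono) auto
      also have "\<dots> = 2 * c1" using h by simp
      finally show ?thesis using C(3) by linarith
    qed
    ultimately have "step_bound C h y (\<sigma> h y)"
      unfolding \<sigma>_def step_bound_def step_of_def by (simp add: y_eq dist_norm)
    moreover have "scheme T f g \<gamma> h y (\<sigma> h y)"
      unfolding \<sigma>_def step_of_def y_eq fst_conv snd_conv
      using scheme_iff_residual[OF h(1), of q p] yS h zero[of "(y, h)"] ball[of y h] y
      by (simp add: S_iff Let_def y_eq)
    ultimately show "scheme T f g \<gamma> h y (\<sigma> h y) \<and> step_bound C h y (\<sigma> h y)" by blast
  next
    fix y h s assume y: "y \<in> S" "dist y x0 < r" and h: "0 < h" "h < r"
      and s: "scheme T f g \<gamma> h y s" "near_step r y s"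
    obtain q p where y_eq: "y = (q, p)" by (cases y)
    obtain a l q' \<mu> p' where s_eq: "s = (a, l, q', \<mu>, p')" by (cases s)
    have yS: "(q, p) \<in> S" using y by (simp add: y_eq)
    define b where "b = ((h / 2) *\<^sub>R l, (h / 2) *\<^sub>R \<mu>)"
    let ?u = "((y, h), b)"
    have st: "a = half_momentum ?u" "q' = next_position ?u" "p' = next_momentum ?u" "residual ?u = 0"
      using s(1) scheme_iff_residual[OF h(1), of q p a l q' \<mu> p'] yS
      by (simp_all add: S_iff Let_def y_eq s_eq b_def)
    have nr: "norm (a - p) < r" "norm (q' - q) < r" "norm (p' - p) < r"
      using s(2) by (simp_all add: near_step_def y_eq s_eq dist_norm)
    have "dist q q0 \<le> dist y x0" "dist p p0 \<le> dist y x0"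
      unfolding y_eq x0_eq by (simp_all add: dist_Pair_Pair)
    then have dq: "norm (q - q0) < r" "norm (p - p0) < r" using y by (simp_all add: dist_norm)
    have dq': "norm (q' - q0) < 2 * r"
      using dq nr norm_triangle_ineq[of "q' - q" "q - q0"] by simp
    have fB: "norm (grad f q) \<le> B" "norm (grad f q') \<le> B"
      using dq dq' r by (auto intro!: B(3) simp: dist_norm)
    have pB: "norm p \<le> B"
      using B(2) dq r norm_triangle_ineq[of p0 "p - p0"] by simp
    have h2: "norm ((h / 2) *\<^sub>R grad f q) \<le> r * B" "norm ((h / 2) *\<^sub>R grad f q') \<le> r * B"
    proof -
      have "norm ((h / 2) *\<^sub>R v) \<le> r * B" if "norm v \<le> B" for v :: "real^'n"
        unfolding norm_scaleR using that h B(1) by (intro mult_mono) auto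
      then show "norm ((h / 2) *\<^sub>R grad f q) \<le> r * B" "norm ((h / 2) *\<^sub>R grad f q') \<le> r * B"
        using fB by blast+
    qed
    have e: "norm (exp (- \<gamma> * h) *\<^sub>R p - p) \<le> \<gamma> * r * B"
    proof -
      have "exp (- \<gamma> * h) *\<^sub>R p - p = (exp (- \<gamma> * h) - 1) *\<^sub>R p" by (simp add: scaleR_diff_left)
      moreover have "\<bar>exp (- \<gamma> * h) - 1\<bar> \<le> \<gamma> * r"
      proof -
        have "exp (- \<gamma> * h) \<le> 1" using \<gamma> h by simp
        moreover have "1 + (- \<gamma> * h) \<le> exp (- \<gamma> * h)" by (rule exp_ge_add_one_self)
        moreover have "\<gamma> * h \<le> \<gamma> * r" using h \<gamma> by (intro mult_left_mono) auto
        ultimately show ?thesis by simp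
      qed
      ultimately show ?thesis using pB \<gamma> r(1) B(1) by (simp add: mult_mono)
    qed
    have 1: "N q *v fst b = (exp (- \<gamma> * h) *\<^sub>R p - p) - (h / 2) *\<^sub>R grad f q - (a - p)"
      by (simp add: st(1) half_momentum_def y_eq b_def)
    have 2: "N q' *v snd b = (a - p) - (h / 2) *\<^sub>R grad f q' - (p' - p)"
      unfolding st(3) next_momentum_def by (simp add: y_eq b_def flip: st(2) st(1)) (simp add: st y_eq b_def)
    have tri: "norm (x - y - z) \<le> norm x + norm y + norm z" for x y z :: "real^'n"
      using norm_triangle_ineq4[of "x - y" z] norm_triangle_ineq4[of x y] by linarith
    have "norm (N q *v fst b) \<le> (2 + \<gamma> * B + B) * r"
    proof -
      have "norm (N q *v fst b) \<le> \<gamma> * r * B + r * B + r"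
        unfolding 1 using tri[of "exp (- \<gamma> * h) *\<^sub>R p - p" "(h / 2) *\<^sub>R grad f q" "a - p"] e h2 nr by linarith
      then show ?thesis using r(1) by (simp add: algebra_simps)
    qed
    then have "c * norm (N q *v fst b) \<le> c * ((2 + \<gamma> * B + B) * r)" using r2(2) by (intro mult_left_mono) auto
    then have b1: "norm (fst b) \<le> r1 / 3"
      using r2(3)[of q "fst b"] r dq r2(1) unfolding k_def by (simp add: dist_norm mult.assoc)
    have "norm (N q' *v snd b) \<le> (2 + \<gamma> * B + B) * r"
    proof -
      have "norm (N q' *v snd b) \<le> r + r * B + r"
        unfolding 2 using tri[of "a - p" "(h / 2) *\<^sub>R grad f q'" "p' - p"] h2 nr by linarith
      moreover have "0 \<le> \<gamma> * B * r" using r(1) \<gamma> B(1) by simp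
      ultimately show ?thesis by (simp add: algebra_simps)
    qed
    then have "c * norm (N q' *v snd b) \<le> c * ((2 + \<gamma> * B + B) * r)" using r2(2) by (intro mult_left_mono) auto
    then have b2: "norm (snd b) \<le> r1 / 3"
      using r2(3)[of q' "snd b"] r dq' r2(1) unfolding k_def by (simp add: dist_norm mult.assoc)
    have "norm b \<le> norm (fst b) + norm (snd b)"
      by (metis norm_Pair_le prod.collapse)
    then have "b \<in> ball 0 r1" using b1 b2 r1(1) by simp
    from uniq[OF ball this st(4)] have "b = \<psi> (y, h)" using y h by simp
    then have "\<sigma> h y = step_of ?u" by (simp add: \<sigma>_def)
    also have "\<dots> = s" using h(1) by (simp add: step_of_def s_eq st b_def)
    finally show "s = \<sigma> h y" by simp
  next
    fix y h assume y: "dist y x0 < r" and h: "0 < h" "h < r"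
    have "(\<lambda>y. (y, h)) differentiable (at y)"
      by (intro differentiable_Pair differentiable_ident differentiable_const)
    moreover from differentiable_chain_at[OF this diff[OF ball]] have "(\<lambda>y. \<psi> (y, h)) differentiable (at y)"
      using y h by (simp add: o_def)
    ultimately have u: "(\<lambda>y. ((y, h), \<psi> (y, h))) differentiable (at y)"
      by (rule differentiable_Pair)
    have c: "(\<lambda>y. F ((y, h), \<psi> (y, h))) differentiable (at y)" if "C1 F"
      for F :: "_ \<Rightarrow> 'z::real_normed_vector"
    proof -
      have "F differentiable (at ((y, h), \<psi> (y, h)))"
        using that unfolding C1_def differentiable_def by blast
      from differentiable_chain_at[OF u this] show ?thesis by (simp add: o_def)
    qed
    show "\<sigma> h differentiable (at y)"
      unfolding \<sigma>_def step_of_def fst_conv snd_conv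
      by (intro differentiable_Pair c[of "\<lambda>u. (2 / h) *\<^sub>R fst (snd u)", unfolded snd_conv]
          c[of "\<lambda>u. (2 / h) *\<^sub>R snd (snd u)", unfolded snd_conv]
          c C1_half_momentum C1_next_position C1_next_momentum C1_intros)
  qed
qed

end

section \<open>Conformal symplecticity\<close>

lemma vector_derivative_eventually_unique:
  fixes F G :: "real \<Rightarrow> 'a::real_normed_vector"
  assumes F: "(F has_vector_derivative D) (at t)" and G: "(G has_vector_derivative D') (at t)"
    and eq: "\<forall>\<^sub>F \<tau> in nhds t. F \<tau> = G \<tau>"
  shows "D = D'"
proof -
  obtain U where "open U" "t \<in> U" "\<And>\<tau>. \<tau> \<in> U \<Longrightarrow> F \<tau> = G \<tau>"
    using eq unfolding eventually_nhds by blast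
  from has_vector_derivative_transform_within_open[OF F this] show ?thesis
    using G by (rule vector_derivative_unique_at)
qed

lemma transpose_inner: "(transpose A *v v) \<bullet> u = v \<bullet> ((A :: real^'n^'m) *v u)"
  by (simp only: transpose_matrix_vector dot_lmul_matrix)

lemma has_vector_derivative_compose:
  assumes "(F has_derivative F') (at (c t))" "(c has_vector_derivative v) (at t)"
  shows "((\<lambda>\<tau>. F (c \<tau>)) has_vector_derivative F' v) (at t)"
  using vector_derivative_diff_chain_within[OF assms(2) has_derivative_at_withinI[OF assms(1)]]
  by (simp add: o_def)

context constrained_system
begin

text \<open>\<open>A\<close> is the derivative in \<open>q\<close> of the total force \<open>\<nabla>f(q) + G(q)\<^sup>T l\<close> with \<open>l\<close> held fixed, expressed through
curves because the step is differentiated along curves.\<close>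
definition force_linearization ::
    "real^'n \<Rightarrow> real^'m \<Rightarrow> (real^'n \<Rightarrow> real^'n) \<Rightarrow> bool" where
  "force_linearization q l A \<longleftrightarrow> (\<forall>(Q :: real \<Rightarrow> real^'n) (L :: real \<Rightarrow> real^'m) dq dl.
      (Q has_vector_derivative dq) (at 0) \<and> (L has_vector_derivative dl) (at 0) \<and> Q 0 = q \<and> L 0 = l \<longrightarrow>
      ((\<lambda>\<tau>. grad f (Q \<tau>) + N (Q \<tau>) *v L \<tau>) has_vector_derivative (A dq + N q *v dl)) (at 0))"

lemma force_linearizationD:
  assumes "force_linearization q l A" "(Q has_vector_derivative dq) (at 0)"
    "(L has_vector_derivative dl) (at 0)" "Q 0 = q" "L 0 = l"
  shows "((\<lambda>\<tau>. grad f (Q \<tau>) + N (Q \<tau>) *v L \<tau>) has_vector_derivative (A dq + N q *v dl)) (at 0)"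
  using assms unfolding force_linearization_def by blast

text \<open>For fixed \<open>l\<close> the force is the gradient of \<open>\<lambda>x. f x + l \<bullet> g x\<close>, so its derivative is symmetric.\<close>
lemma force_linearization_symmetric:
  obtains A where "\<And>u v. A u \<bullet> v = A v \<bullet> u" "force_linearization q l A"
proof -
  define F where "F = (\<lambda>z. grad f (fst z) + N (fst z) *v snd z)"
  have "C1 F" unfolding F_def by (intro C1_intros C1_data)
  then obtain F' where F': "\<And>z. (F has_derivative blinfun_apply (F' z)) (at z)"
    unfolding C1_def by blast
  define A where "A = (\<lambda>u. F' (q, l) (u, 0))"
  have W: "((\<lambda>x. F (x, l)) has_derivative A) (at q)"
  proof -
    have "((\<lambda>x. (x, l)) has_derivative (\<lambda>u. (u, 0))) (at q)"
      by (auto intro!: derivative_eq_intros)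
    from has_derivative_compose[OF this F'] show ?thesis unfolding A_def .
  qed
  have cF: "C1 (\<lambda>x. F (x, l))" unfolding F_def by (intro C1_intros C1_data)
  have dF: "((\<lambda>x. f x + l \<bullet> g x) has_derivative (\<lambda>u. F (x, l) \<bullet> u)) (at x)" for x
  proof -
    have "((\<lambda>x. f x + l \<bullet> g x) has_derivative (\<lambda>u. grad f x \<bullet> u + l \<bullet> (J x *v u))) (at x)"
      by (intro has_derivative_add C2_gradient(1)[OF C2_f] has_derivative_inner_right g_derivative)
    then show ?thesis by (simp add: F_def inner_add_left transpose_inner)
  qed
  have sym: "A u \<bullet> v = A v \<bullet> u" for u v
    by (rule gradient_derivative_symmetric[OF dF cF W])
  have d1: "((\<lambda>y. F (q, y)) has_derivative (\<lambda>u. F' (q, l) (0, u))) (at l)"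
  proof -
    have "((\<lambda>y. (q, y)) has_derivative (\<lambda>u. (0, u))) (at l)"
      by (auto intro!: derivative_eq_intros)
    from has_derivative_compose[OF this F'] show ?thesis .
  qed
  have d2: "((\<lambda>y. F (q, y)) has_derivative (\<lambda>u. 0 + N q *v u)) (at l)"
    unfolding F_def fst_conv snd_conv
    by (intro has_derivative_add has_derivative_const bounded_linear_imp_has_derivative
        matrix_vector_mul_bounded_linear)
  have N: "F' (q, l) (0, u) = N q *v u" for u
    using fun_cong[OF has_derivative_unique[OF d1 d2], of u] by simp
  show thesis
  proof (rule that[of A, OF sym], unfold force_linearization_def, intro allI impI, elim conjE)
    fix Q L dq dl assume Q: "(Q has_vector_derivative dq) (at (0 :: real))"
      and L: "(L has_vector_derivative dl) (at 0)" and 0: "Q 0 = q" "L 0 = l"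
    have "((\<lambda>\<tau>. (Q \<tau>, L \<tau>)) has_vector_derivative (dq, dl)) (at 0)"
      by (rule has_vector_derivative_Pair[OF Q L])
    from has_vector_derivative_compose[OF F' this]
    have "((\<lambda>\<tau>. F (Q \<tau>, L \<tau>)) has_vector_derivative F' (q, l) (dq, dl)) (at 0)"
      by (simp add: 0)
    moreover have "blinfun_apply (F' (q, l)) (dq, dl) = A dq + N q *v dl"
      unfolding A_def N[symmetric] blinfun.add_right[symmetric] by simp
    ultimately show "((\<lambda>\<tau>. grad f (Q \<tau>) + N (Q \<tau>) *v L \<tau>) has_vector_derivative (A dq + N q *v dl)) (at 0)"
      by (simp add: F_def)
  qed
qed

lemma hess_T_symmetric: "(hess T p *v u) \<bullet> v = (hess T p *v v) \<bullet> u"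
  by (rule gradient_derivative_symmetric[OF C2_gradient(1)[OF C2_T] C1_grad_T grad_T_derivative])

text \<open>The variational equations, obtained by differentiating the scheme along a curve.\<close>
lemma linearized_step:
  assumes \<beta>: "(\<beta> has_vector_derivative (dq, dp)) (at 0)" "\<beta> 0 = (q, p)"
    and s: "(s has_vector_derivative (da, dl, dq', d\<mu>, dp')) (at 0)" "s 0 = (a, l, q', \<mu>, p')"
    and ev: "\<forall>\<^sub>F \<tau> in nhds 0. \<beta> \<tau> \<in> S \<and> scheme T f g \<gamma> h (\<beta> \<tau>) (s \<tau>)"
    and A: "force_linearization q l A" and A': "force_linearization q' \<mu> A'"
  shows "da = exp (- \<gamma> * h) *\<^sub>R dp - (h / 2) *\<^sub>R (A dq + N q *v dl)"
    and "dq' = dq + h *\<^sub>R (hess T a *v da)"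
    and "dp' = da - (h / 2) *\<^sub>R (A' dq' + N q' *v d\<mu>)"
    and "J q *v dq = 0" and "J q' *v dq' = 0"
proof -
  define Q where "Q = (\<lambda>\<tau>. fst (\<beta> \<tau>))"
  define P where "P = (\<lambda>\<tau>. snd (\<beta> \<tau>))"
  define a\<^sub>s where "a\<^sub>s = (\<lambda>\<tau>. fst (s \<tau>))"
  define l\<^sub>s where "l\<^sub>s = (\<lambda>\<tau>. fst (snd (s \<tau>)))"
  define q\<^sub>s where "q\<^sub>s = (\<lambda>\<tau>. fst (snd (snd (s \<tau>))))"
  define \<mu>\<^sub>s where "\<mu>\<^sub>s = (\<lambda>\<tau>. fst (snd (snd (snd (s \<tau>)))))"
  define p\<^sub>s where "p\<^sub>s = (\<lambda>\<tau>. snd (snd (snd (snd (s \<tau>)))))"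
  have [simp]: "Q 0 = q" "P 0 = p" "a\<^sub>s 0 = a" "l\<^sub>s 0 = l" "q\<^sub>s 0 = q'" "\<mu>\<^sub>s 0 = \<mu>" "p\<^sub>s 0 = p'"
    using \<beta>(2) s(2) by (simp_all add: Q_def P_def a\<^sub>s_def l\<^sub>s_def q\<^sub>s_def \<mu>\<^sub>s_def p\<^sub>s_def)
  have Q: "(Q has_vector_derivative dq) (at 0)"
    unfolding Q_def using bounded_linear.has_vector_derivative[OF bounded_linear_fst \<beta>(1)] by simp
  have P: "(P has_vector_derivative dp) (at 0)"
    unfolding P_def using bounded_linear.has_vector_derivative[OF bounded_linear_snd \<beta>(1)] by simp
  have a: "(a\<^sub>s has_vector_derivative da) (at 0)"
    unfolding a\<^sub>s_def using bounded_linear.has_vector_derivative[OF bounded_linear_fst s(1)] by simp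
  note s1 = bounded_linear.has_vector_derivative[OF bounded_linear_snd s(1), unfolded snd_conv]
  have l: "(l\<^sub>s has_vector_derivative dl) (at 0)"
    unfolding l\<^sub>s_def using bounded_linear.has_vector_derivative[OF bounded_linear_fst s1] by simp
  note s2 = bounded_linear.has_vector_derivative[OF bounded_linear_snd s1, unfolded snd_conv]
  have q: "(q\<^sub>s has_vector_derivative dq') (at 0)"
    unfolding q\<^sub>s_def using bounded_linear.has_vector_derivative[OF bounded_linear_fst s2] by simp
  note s3 = bounded_linear.has_vector_derivative[OF bounded_linear_snd s2, unfolded snd_conv]
  have m: "(\<mu>\<^sub>s has_vector_derivative d\<mu>) (at 0)"
    unfolding \<mu>\<^sub>s_def using bounded_linear.has_vector_derivative[OF bounded_linear_fst s3] by simp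
  have p: "(p\<^sub>s has_vector_derivative dp') (at 0)"
    unfolding p\<^sub>s_def using bounded_linear.has_vector_derivative[OF bounded_linear_snd s3] by simp
  have eqs: "\<forall>\<^sub>F \<tau> in nhds 0. g (Q \<tau>) = 0
      \<and> a\<^sub>s \<tau> = exp (- \<gamma> * h) *\<^sub>R P \<tau> - (h / 2) *\<^sub>R (grad f (Q \<tau>) + N (Q \<tau>) *v l\<^sub>s \<tau>)
      \<and> q\<^sub>s \<tau> = Q \<tau> + h *\<^sub>R grad T (a\<^sub>s \<tau>) \<and> g (q\<^sub>s \<tau>) = 0
      \<and> p\<^sub>s \<tau> = a\<^sub>s \<tau> - (h / 2) *\<^sub>R (grad f (q\<^sub>s \<tau>) + N (q\<^sub>s \<tau>) *v \<mu>\<^sub>s \<tau>)"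
    by (rule eventually_mono[OF ev])
      (auto simp: scheme_def S_iff Q_def P_def a\<^sub>s_def l\<^sub>s_def q\<^sub>s_def \<mu>\<^sub>s_def p\<^sub>s_def split: prod.splits)
  show "da = exp (- \<gamma> * h) *\<^sub>R dp - (h / 2) *\<^sub>R (A dq + N q *v dl)"
  proof (rule vector_derivative_eventually_unique[OF a])
    show "((\<lambda>\<tau>. exp (- \<gamma> * h) *\<^sub>R P \<tau> - (h / 2) *\<^sub>R (grad f (Q \<tau>) + N (Q \<tau>) *v l\<^sub>s \<tau>))
        has_vector_derivative exp (- \<gamma> * h) *\<^sub>R dp - (h / 2) *\<^sub>R (A dq + N q *v dl)) (at 0)"
      by (intro has_vector_derivative_diff bounded_linear.has_vector_derivative[OF bounded_linear_scaleR_right]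
          P force_linearizationD[OF A] Q l) simp_all
  qed (use eqs in \<open>auto elim: eventually_mono\<close>)
  show "dq' = dq + h *\<^sub>R (hess T a *v da)"
  proof (rule vector_derivative_eventually_unique[OF q])
    have "((\<lambda>\<tau>. grad T (a\<^sub>s \<tau>)) has_vector_derivative hess T a *v da) (at 0)"
      using has_vector_derivative_compose[OF grad_T_derivative a] by simp
    then show "((\<lambda>\<tau>. Q \<tau> + h *\<^sub>R grad T (a\<^sub>s \<tau>)) has_vector_derivative dq + h *\<^sub>R (hess T a *v da)) (at 0)"
      by (intro has_vector_derivative_add bounded_linear.has_vector_derivative[OF bounded_linear_scaleR_right] Q)
  qed (use eqs in \<open>auto elim: eventually_mono\<close>)
  show "dp' = da - (h / 2) *\<^sub>R (A' dq' + N q' *v d\<mu>)"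
  proof (rule vector_derivative_eventually_unique[OF p])
    show "((\<lambda>\<tau>. a\<^sub>s \<tau> - (h / 2) *\<^sub>R (grad f (q\<^sub>s \<tau>) + N (q\<^sub>s \<tau>) *v \<mu>\<^sub>s \<tau>))
        has_vector_derivative da - (h / 2) *\<^sub>R (A' dq' + N q' *v d\<mu>)) (at 0)"
      by (intro has_vector_derivative_diff bounded_linear.has_vector_derivative[OF bounded_linear_scaleR_right]
          a force_linearizationD[OF A'] q m) simp_all
  qed (use eqs in \<open>auto elim: eventually_mono\<close>)
  show "J q *v dq = 0"
  proof (rule vector_derivative_eventually_unique[OF _ has_vector_derivative_const])
    show "((\<lambda>\<tau>. g (Q \<tau>)) has_vector_derivative J q *v dq) (at 0)"
      using has_vector_derivative_compose[OF g_derivative Q] by simp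
  qed (use eqs in \<open>auto elim: eventually_mono\<close>)
  show "J q' *v dq' = 0"
  proof (rule vector_derivative_eventually_unique[OF _ has_vector_derivative_const])
    show "((\<lambda>\<tau>. g (q\<^sub>s \<tau>)) has_vector_derivative J q' *v dq') (at 0)"
      using has_vector_derivative_compose[OF g_derivative q] by simp
  qed (use eqs in \<open>auto elim: eventually_mono\<close>)
qed

text \<open>For two solutions of the variational equations the pairing \<open>dq \<bullet> dp\<^sub>2 - dp \<bullet> dq\<^sub>2\<close> is followed
backwards through the three substeps. The last kick and the drift preserve it, because the
linearized forces and the Hessian of \<open>T\<close> are symmetric and the multiplier terms
\<open>G\<^sup>T d\<mu>\<close> are orthogonal to the tangent vectors; the first kick contributes the factor
\<open>exp (- \<gamma> h)\<close> with which it scales the momenta.\<close>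
lemma step_conformal_symplectic:
  assumes x: "x \<in> S" and L: "(\<sigma> has_derivative L) (at x within S)"
    and sch: "\<forall>\<^sub>F y in nhds x. y \<in> S \<longrightarrow> scheme T f g \<gamma> h y (\<sigma> y)"
  defines "\<pi> \<equiv> \<lambda>s :: ('n, 'm) step. (fst (snd (snd s)), snd (snd (snd (snd s))))"
  shows "path_through S x \<xi> \<beta> \<Longrightarrow> ((\<lambda>\<tau>. \<pi> (\<sigma> (\<beta> \<tau>))) has_vector_derivative \<pi> (L \<xi>)) (at 0)"
    and "\<xi> \<in> tangent_space S x \<Longrightarrow> \<eta> \<in> tangent_space S x \<Longrightarrow>
      \<pi> (L \<xi>) \<bullet> symp_J (\<pi> (L \<eta>)) = exp (- \<gamma> * h) * (\<xi> \<bullet> symp_J \<eta>)"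
proof -
  have path: "((\<lambda>\<tau>. \<sigma> (\<beta> \<tau>)) has_vector_derivative L \<xi>) (at 0)
      \<and> (\<forall>\<^sub>F \<tau> in nhds 0. \<beta> \<tau> \<in> S \<and> scheme T f g \<gamma> h (\<beta> \<tau>) (\<sigma> (\<beta> \<tau>)))"
    if "path_through S x \<xi> \<beta>" for \<xi> \<beta>
  proof
    have \<beta>: "\<forall>\<^sub>F \<tau> in nhds 0. \<beta> \<tau> \<in> S" "\<beta> 0 = x" "(\<beta> has_vector_derivative \<xi>) (at 0)"
      using that by (auto simp: path_through_def)
    obtain U where U: "open U" "0 \<in> U" "\<And>\<tau>. \<tau> \<in> U \<Longrightarrow> \<beta> \<tau> \<in> S"
      using \<beta>(1) unfolding eventually_nhds by blast
    have "(\<sigma> has_derivative L) (at (\<beta> 0) within \<beta> ` U)"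
      unfolding \<beta>(2) by (rule has_derivative_subset[OF L]) (use U(3) in blast)
    from vector_derivative_diff_chain_within[OF has_vector_derivative_at_within[OF \<beta>(3)] this]
    have "(\<sigma> \<circ> \<beta> has_vector_derivative L \<xi>) (at 0 within U)" .
    then show "((\<lambda>\<tau>. \<sigma> (\<beta> \<tau>)) has_vector_derivative L \<xi>) (at 0)"
      unfolding at_within_open[OF U(2,1)] o_def .
    have "isCont \<beta> 0" by (rule has_vector_derivative_continuous[OF \<beta>(3)])
    then have "filterlim \<beta> (nhds (\<beta> 0)) (nhds 0)"
      unfolding continuous_at tendsto_at_iff_tendsto_nhds .
    then have "filterlim \<beta> (nhds x) (nhds 0)" unfolding \<beta>(2) .
    have "\<forall>\<^sub>F \<tau> in nhds 0. \<beta> \<tau> \<in> S \<longrightarrow> scheme T f g \<gamma> h (\<beta> \<tau>) (\<sigma> (\<beta> \<tau>))"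
      by (rule eventually_compose_filterlim[OF sch \<open>filterlim \<beta> (nhds x) (nhds 0)\<close>])
    with \<beta>(1)
    show "\<forall>\<^sub>F \<tau> in nhds 0. \<beta> \<tau> \<in> S \<and> scheme T f g \<gamma> h (\<beta> \<tau>) (\<sigma> (\<beta> \<tau>))"
      by (rule eventually_elim2) blast
  qed
  have bl: "bounded_linear \<pi>"
    unfolding \<pi>_def
    by (intro bounded_linear_Pair bounded_linear_compose[OF bounded_linear_fst]
        bounded_linear_compose[OF bounded_linear_snd] bounded_linear_snd)
  show "((\<lambda>\<tau>. \<pi> (\<sigma> (\<beta> \<tau>))) has_vector_derivative \<pi> (L \<xi>)) (at 0)" if "path_through S x \<xi> \<beta>"
    using path[OF that] by (intro bounded_linear.has_vector_derivative[OF bl]) blast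
  assume "\<xi> \<in> tangent_space S x" "\<eta> \<in> tangent_space S x"
  then obtain \<beta> \<beta>' where \<beta>: "path_through S x \<xi> \<beta>" "path_through S x \<eta> \<beta>'"
    unfolding tangent_space_def by blast
  obtain dq dp dq\<^sub>2 dp\<^sub>2 q p where xi: "\<xi> = (dq, dp)" "\<eta> = (dq\<^sub>2, dp\<^sub>2)" "x = (q, p)"
    by (cases \<xi>, cases \<eta>, cases x)
  obtain da dl dq' dm dp' where L1: "L \<xi> = (da, dl, dq', dm, dp')" by (cases "L \<xi>")
  obtain da\<^sub>2 dl\<^sub>2 dq'\<^sub>2 dm\<^sub>2 dp'\<^sub>2 where L2: "L \<eta> = (da\<^sub>2, dl\<^sub>2, dq'\<^sub>2, dm\<^sub>2, dp'\<^sub>2)" by (cases "L \<eta>")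
  obtain a l q' \<mu> p' where s: "\<sigma> x = (a, l, q', \<mu>, p')" by (cases "\<sigma> x")
  obtain A where A: "\<And>u v. A u \<bullet> v = A v \<bullet> u" "force_linearization q l A"
    using force_linearization_symmetric[of q l] by blast
  obtain A' where A': "\<And>u v. A' u \<bullet> v = A' v \<bullet> u" "force_linearization q' \<mu> A'"
    using force_linearization_symmetric[of q' \<mu>] by blast
  have b1: "(\<beta> has_vector_derivative (dq, dp)) (at 0)" "\<beta> 0 = (q, p)"
    using \<beta>(1) xi by (auto simp: path_through_def)
  have b2: "(\<beta>' has_vector_derivative (dq\<^sub>2, dp\<^sub>2)) (at 0)" "\<beta>' 0 = (q, p)"
    using \<beta>(2) xi by (auto simp: path_through_def)
  have p1: "((\<lambda>\<tau>. \<sigma> (\<beta> \<tau>)) has_vector_derivative (da, dl, dq', dm, dp')) (at 0)"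
    "\<sigma> (\<beta> 0) = (a, l, q', \<mu>, p')" "\<forall>\<^sub>F \<tau> in nhds 0. \<beta> \<tau> \<in> S \<and> scheme T f g \<gamma> h (\<beta> \<tau>) (\<sigma> (\<beta> \<tau>))"
    using path[OF \<beta>(1), unfolded L1] b1(2) xi(3) s by simp_all
  have p2: "((\<lambda>\<tau>. \<sigma> (\<beta>' \<tau>)) has_vector_derivative (da\<^sub>2, dl\<^sub>2, dq'\<^sub>2, dm\<^sub>2, dp'\<^sub>2)) (at 0)"
    "\<sigma> (\<beta>' 0) = (a, l, q', \<mu>, p')" "\<forall>\<^sub>F \<tau> in nhds 0. \<beta>' \<tau> \<in> S \<and> scheme T f g \<gamma> h (\<beta>' \<tau>) (\<sigma> (\<beta>' \<tau>))"
    using path[OF \<beta>(2), unfolded L2] b2(2) xi(3) s by simp_all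
  note e1 = linearized_step[OF b1 p1 A(2) A'(2)]
  note e2 = linearized_step[OF b2 p2 A(2) A'(2)]
  have N0: "(N r *v v) \<bullet> u = 0" "u \<bullet> (N r *v v) = 0" if "J r *v u = 0" for r u v
    using that by (simp_all add: transpose_inner inner_commute[of u])
  have "dq' \<bullet> dp'\<^sub>2 - dp' \<bullet> dq'\<^sub>2 = dq' \<bullet> da\<^sub>2 - da \<bullet> dq'\<^sub>2"
    using N0[OF e1(5)] N0[OF e2(5)] A'(1)[of dq' dq'\<^sub>2]
    by (subst e1(3), subst e2(3))
      (simp add: inner_diff_left inner_diff_right inner_add_left inner_add_right inner_commute[of dq'])
  also have "\<dots> = dq \<bullet> da\<^sub>2 - da \<bullet> dq\<^sub>2"
    using hess_T_symmetric[of a da da\<^sub>2]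
    by (subst e1(2), subst e2(2)) (simp add: inner_add_left inner_add_right inner_commute[of da])
  also have "\<dots> = exp (- \<gamma> * h) * (dq \<bullet> dp\<^sub>2 - dp \<bullet> dq\<^sub>2)"
    using N0[OF e1(4)] N0[OF e2(4)] A(1)[of dq dq\<^sub>2]
    by (subst e1(1), subst e2(1))
      (simp add: inner_diff_left inner_diff_right inner_add_left inner_add_right inner_commute[of dq] right_diff_distrib)
  finally show "\<pi> (L \<xi>) \<bullet> symp_J (\<pi> (L \<eta>)) = exp (- \<gamma> * h) * (\<xi> \<bullet> symp_J \<eta>)"
    unfolding L1 L2 unfolding xi \<pi>_def by (simp add: symp_J_def)
qed

end

section \<open>The domain of the numerical flow\<close>

lemma continuous_on_lower_half:
  fixes \<phi> :: "'a::metric_space \<Rightarrow> real"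
  assumes "continuous_on S \<phi>" "x \<in> S" "\<phi> x > 0"
  obtains d where "d > 0" "\<And>y. y \<in> S \<Longrightarrow> dist y x < d \<Longrightarrow> \<phi> x / 2 < \<phi> y"
proof -
  obtain d where d: "d > 0" "\<And>y. y \<in> S \<Longrightarrow> dist y x < d \<Longrightarrow> dist (\<phi> y) (\<phi> x) < \<phi> x / 2"
    using assms unfolding continuous_on_iff by (metis half_gt_zero)
  show thesis
  proof (rule that[OF d(1)])
    fix y assume "y \<in> S" "dist y x < d"
    from d(2)[OF this] have "\<bar>\<phi> y - \<phi> x\<bar> < \<phi> x / 2" by (simp add: dist_real_def)
    then show "\<phi> x / 2 < \<phi> y" by linarith
  qed
qed

context constrained_system
begin

definition the_step ::
    "((real^'n) \<times> (real^'n) \<Rightarrow> real) \<Rightarrow> real \<Rightarrow> (real^'n) \<times> (real^'n) \<Rightarrow> ('n, 'm) step" where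
  "the_step \<rho> h y = (THE s. scheme T f g \<gamma> h y s \<and> near_step (\<rho> y) y s)"

lemma near_step_mono: "near_step r y s \<Longrightarrow> r \<le> r' \<Longrightarrow> near_step r' y s"
  unfolding near_step_def by auto

lemma step_bound_imp_near: "step_bound C h y s \<Longrightarrow> C * h < r \<Longrightarrow> near_step r y s"
  unfolding near_step_def step_bound_def by auto

definition unique_within :: "((real^'n) \<times> (real^'n) \<Rightarrow> real) \<Rightarrow> bool" where
  "unique_within \<rho> \<longleftrightarrow> (\<forall>x\<in>S. \<forall>h s s'. 0 < h \<and> h < \<rho> x \<and> scheme T f g \<gamma> h x s \<and> near_step (\<rho> x) x s
     \<and> scheme T f g \<gamma> h x s' \<and> near_step (\<rho> x) x s' \<longrightarrow> s = s')"

lemma unique_withinD: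
  assumes "unique_within \<rho>" "x \<in> S" "0 < h" "h < \<rho> x" "scheme T f g \<gamma> h x s" "near_step (\<rho> x) x s"
    "scheme T f g \<gamma> h x s'" "near_step (\<rho> x) x s'"
  shows "s = s'"
  using assms unfolding unique_within_def by blast

text \<open>Uniqueness is inherited by smaller neighbourhoods, so it can be arranged by \<open>continuous_selection\<close>
before existence, which fails for a given \<open>h\<close> if the neighbourhood is too small.\<close>
lemma uniqueness_radius:
  obtains \<rho> where "continuous_on S \<rho>" "\<And>x. x \<in> S \<Longrightarrow> \<rho> x > 0" "unique_within \<rho>"
proof -
  define P where "P = (\<lambda>x r. \<forall>h s s'. 0 < h \<and> h < r \<and> scheme T f g \<gamma> h x s \<and> near_step r x s
      \<and> scheme T f g \<gamma> h x s' \<and> near_step r x s' \<longrightarrow> s = s')"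
  have anti: "P x r" if "x \<in> S" "0 < r" "r \<le> r'" "P x r'" for x r r'
    unfolding P_def
  proof (intro allI impI, elim conjE)
    fix h s s' assume "0 < h" "h < r" "scheme T f g \<gamma> h x s" "near_step r x s"
      "scheme T f g \<gamma> h x s'" "near_step r x s'"
    with that(3) have "h < r'" "near_step r' x s" "near_step r' x s'"
      by (simp, blast intro: near_step_mono, blast intro: near_step_mono)
    with that(4) \<open>0 < h\<close> \<open>scheme T f g \<gamma> h x s\<close> \<open>scheme T f g \<gamma> h x s'\<close> show "s = s'"
      unfolding P_def by blast
  qed
  have loc: "\<exists>r>0. \<forall>y\<in>S \<inter> ball x r. P y r" if x: "x \<in> S" for x
  proof -
    obtain r C \<sigma> where r: "r > 0" "C > 0"
      and "\<And>y h. y \<in> S \<Longrightarrow> dist y x < r \<Longrightarrow> 0 < h \<Longrightarrow> h < r \<Longrightarrow>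
         scheme T f g \<gamma> h y (\<sigma> h y) \<and> step_bound C h y (\<sigma> h y)"
      and u: "\<And>y h s. y \<in> S \<Longrightarrow> dist y x < r \<Longrightarrow> 0 < h \<Longrightarrow> h < r \<Longrightarrow>
         scheme T f g \<gamma> h y s \<Longrightarrow> near_step r y s \<Longrightarrow> s = \<sigma> h y"
      and "\<And>y h. dist y x < r \<Longrightarrow> 0 < h \<Longrightarrow> h < r \<Longrightarrow> \<sigma> h differentiable (at y)"
      by (rule local_step[OF x]) blast
    have "P y r" if "y \<in> S \<inter> ball x r" for y
    proof -
      have y: "y \<in> S" "dist y x < r" using that by (simp_all add: dist_commute)
      show ?thesis
        unfolding P_def
      proof (intro allI impI, elim conjE)
        fix h s s' assume h: "0 < h" "h < r" and "scheme T f g \<gamma> h y s" "near_step r y s"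
          "scheme T f g \<gamma> h y s'" "near_step r y s'"
        then have "s = \<sigma> h y" "s' = \<sigma> h y" using u[OF y h] by blast+
        then show "s = s'" by simp
      qed
    qed
    with r(1) show ?thesis by blast
  qed
  obtain \<rho> where \<rho>: "continuous_on S \<rho>" "\<And>x. x \<in> S \<Longrightarrow> \<rho> x > 0" "\<And>x. x \<in> S \<Longrightarrow> P x (\<rho> x)"
    by (rule continuous_selection[of S P, OF anti loc]; blast)
  show thesis
  proof (rule that[OF \<rho>(1,2)])
    show "unique_within \<rho>"
      unfolding unique_within_def using \<rho>(3) unfolding P_def by (intro ballI)
  qed
qed

text \<open>Where \<open>\<rho>\<close> is bounded below, the locally constructed step lies in the prescribed neighbourhood as soon
as \<open>C h\<close> is below that bound; by uniqueness it is then the step of the scheme, and it inherits the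
bounds and the differentiability.\<close>
lemma the_step_local:
  assumes \<rho>: "continuous_on S \<rho>" "\<And>x. x \<in> S \<Longrightarrow> \<rho> x > 0" "unique_within \<rho>"
    and x: "x \<in> S"
  obtains r C where "r > 0" "C > 0"
    "\<And>y h. y \<in> S \<Longrightarrow> dist y x < r \<Longrightarrow> 0 < h \<Longrightarrow> h < r \<Longrightarrow>
       (\<exists>!s. scheme T f g \<gamma> h y s \<and> near_step (\<rho> y) y s) \<and> step_bound C h y (the_step \<rho> h y)
       \<and> (\<exists>L. (the_step \<rho> h has_derivative L) (at y within S))"
proof -
  obtain r C \<sigma> where r: "r > 0" "C > 0"
    and ex: "\<And>y h. y \<in> S \<Longrightarrow> dist y x < r \<Longrightarrow> 0 < h \<Longrightarrow> h < r \<Longrightarrow>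
       scheme T f g \<gamma> h y (\<sigma> h y) \<and> step_bound C h y (\<sigma> h y)"
    and "\<And>y h s. y \<in> S \<Longrightarrow> dist y x < r \<Longrightarrow> 0 < h \<Longrightarrow> h < r \<Longrightarrow>
       scheme T f g \<gamma> h y s \<Longrightarrow> near_step r y s \<Longrightarrow> s = \<sigma> h y"
    and diff: "\<And>y h. dist y x < r \<Longrightarrow> 0 < h \<Longrightarrow> h < r \<Longrightarrow> \<sigma> h differentiable (at y)"
    by (rule local_step[OF x]) blast
  obtain d where d: "d > 0" "\<And>y. y \<in> S \<Longrightarrow> dist y x < d \<Longrightarrow> \<rho> x / 2 < \<rho> y"
    by (rule continuous_on_lower_half[OF \<rho>(1) x \<rho>(2)[OF x]]) blast
  define r' where "r' = min (min r d) (min (\<rho> x / 2) (\<rho> x / (2 * C)))"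
  have r': "r' > 0" "r' \<le> r" "r' \<le> d" "r' \<le> \<rho> x / 2" "C * r' \<le> \<rho> x / 2"
  proof -
    show "r' > 0" unfolding r'_def using r d \<rho>(2)[OF x] by simp
    have "r' \<le> \<rho> x / (2 * C)" unfolding r'_def by simp
    then show "C * r' \<le> \<rho> x / 2" using r(2) by (simp add: field_simps)
  qed (auto simp: r'_def)
  have ex1: "(\<exists>!s. scheme T f g \<gamma> h y s \<and> near_step (\<rho> y) y s) \<and> the_step \<rho> h y = \<sigma> h y"
    if y: "y \<in> S" "dist y x < r'" and h: "0 < h" "h < r'" for y h
  proof -
    have \<rho>y: "\<rho> x / 2 < \<rho> y" using d(2)[of y] y r' by simp
    have e: "scheme T f g \<gamma> h y (\<sigma> h y)" "step_bound C h y (\<sigma> h y)"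
      using ex[of y h] y h r' by simp_all
    have "C * h < C * r'" using h r(2) by simp
    then have n: "near_step (\<rho> y) y (\<sigma> h y)"
      using r' \<rho>y by (intro step_bound_imp_near[OF e(2)]) linarith
    have u: "s = \<sigma> h y" if "scheme T f g \<gamma> h y s \<and> near_step (\<rho> y) y s" for s
    proof -
      have "h < \<rho> y" using h r' \<rho>y by linarith
      from unique_withinD[OF \<rho>(3) y(1) h(1) this conjunct1[OF that] conjunct2[OF that] e(1) n] show ?thesis .
    qed
    have "the_step \<rho> h y = \<sigma> h y"
      unfolding the_step_def
    proof (rule the_equality)
      show "scheme T f g \<gamma> h y (\<sigma> h y) \<and> near_step (\<rho> y) y (\<sigma> h y)" using e(1) n by (rule conjI)
    qed (rule u)
    moreover have "\<exists>!s. scheme T f g \<gamma> h y s \<and> near_step (\<rho> y) y s"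
    proof (rule ex1I)
      show "scheme T f g \<gamma> h y (\<sigma> h y) \<and> near_step (\<rho> y) y (\<sigma> h y)" using e(1) n by (rule conjI)
    qed (rule u)
    ultimately show ?thesis by blast
  qed
  show thesis
  proof (rule that[OF r'(1) r(2)])
    fix y h assume y: "y \<in> S" "dist y x < r'" and h: "0 < h" "h < r'"
    have "\<sigma> h differentiable (at y)" using diff[of y h] y h r' by simp
    then obtain L where L: "(\<sigma> h has_derivative L) (at y)" unfolding differentiable_def by blast
    have "(the_step \<rho> h has_derivative L) (at y within S)"
    proof (rule has_derivative_transform_within[OF has_derivative_at_withinI[OF L], of "r' - dist y x"])
      fix z assume z: "z \<in> S" "dist z y < r' - dist y x"
      have "dist z x \<le> dist z y + dist y x" by (rule dist_triangle)
      then show "\<sigma> h z = the_step \<rho> h z" using ex1[OF z(1) _ h] z by simp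
    qed (use y in simp_all)
    then show "(\<exists>!s. scheme T f g \<gamma> h y s \<and> near_step (\<rho> y) y s) \<and> step_bound C h y (the_step \<rho> h y)
       \<and> (\<exists>L. (the_step \<rho> h has_derivative L) (at y within S))"
    proof (intro conjI)
      show "step_bound C h y (the_step \<rho> h y)"
        using ex1[OF y h] ex[of y h] y h r' by simp
    qed (use ex1[OF y h] in blast)+
  qed
qed

lemma step_domain:
  obtains \<rho> h\<^sub>0 where "continuous_on S h\<^sub>0" "continuous_on S \<rho>"
    "\<And>x. x \<in> S \<Longrightarrow> h\<^sub>0 x > 0" "\<And>x. x \<in> S \<Longrightarrow> \<rho> x > 0"
    "\<And>x h. x \<in> S \<Longrightarrow> 0 < h \<Longrightarrow> h < h\<^sub>0 x \<Longrightarrow> \<exists>!s. scheme T f g \<gamma> h x s \<and> near_step (\<rho> x) x s"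
    "\<And>x h. x \<in> S \<Longrightarrow> 0 < h \<Longrightarrow> h < h\<^sub>0 x \<Longrightarrow> \<exists>L. (the_step \<rho> h has_derivative L) (at x within S)"
    "\<And>x. x \<in> S \<Longrightarrow> \<exists>r>0. \<exists>C>0. \<forall>y\<in>S. dist y x < r \<longrightarrow> (\<forall>h. 0 < h \<and> h < r \<longrightarrow>
       h < h\<^sub>0 y \<and> step_bound C h y (the_step \<rho> h y))"
proof -
  obtain \<rho> where \<rho>: "continuous_on S \<rho>" "\<And>x. x \<in> S \<Longrightarrow> \<rho> x > 0" "unique_within \<rho>"
    by (rule uniqueness_radius) blast
  define P where "P = (\<lambda>x r. \<forall>h. 0 < h \<and> h < r \<longrightarrow>
      (\<exists>!s. scheme T f g \<gamma> h x s \<and> near_step (\<rho> x) x s) \<and> (\<exists>L. (the_step \<rho> h has_derivative L) (at x within S)))"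
  have anti: "P x r" if "x \<in> S" "0 < r" "r \<le> r'" "P x r'" for x r r'
    unfolding P_def
  proof (intro allI impI, elim conjE)
    fix h assume "0 < h" "h < r"
    with that(3) have "0 < h \<and> h < r'" by simp
    with that(4) show "(\<exists>!s. scheme T f g \<gamma> h x s \<and> near_step (\<rho> x) x s)
        \<and> (\<exists>L. (the_step \<rho> h has_derivative L) (at x within S))"
      unfolding P_def by (elim allE impE)
  qed
  have loc: "\<exists>r>0. \<exists>C>0. \<forall>y\<in>S. dist y x < r \<longrightarrow> P y r \<and> (\<forall>h. 0 < h \<and> h < r \<longrightarrow> step_bound C h y (the_step \<rho> h y))"
    if x: "x \<in> S" for x
  proof -
    obtain r C where r: "r > 0" "C > 0"
      "\<And>y h. y \<in> S \<Longrightarrow> dist y x < r \<Longrightarrow> 0 < h \<Longrightarrow> h < r \<Longrightarrow>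
       (\<exists>!s. scheme T f g \<gamma> h y s \<and> near_step (\<rho> y) y s) \<and> step_bound C h y (the_step \<rho> h y)
       \<and> (\<exists>L. (the_step \<rho> h has_derivative L) (at y within S))"
      by (rule the_step_local[OF \<rho> x]; blast)
    show ?thesis
    proof (rule exI[of _ r], rule conjI[OF r(1)], rule exI[of _ C], rule conjI[OF r(2)], intro ballI impI conjI)
      fix y assume y: "y \<in> S" "dist y x < r"
      show "P y r" unfolding P_def
      proof (intro allI impI, elim conjE)
        fix h assume "0 < h" "h < r"
        from r(3)[OF y this] show "(\<exists>!s. scheme T f g \<gamma> h y s \<and> near_step (\<rho> y) y s)
            \<and> (\<exists>L. (the_step \<rho> h has_derivative L) (at y within S))" by (elim conjE, intro conjI)
      qed
      show "\<forall>h. 0 < h \<and> h < r \<longrightarrow> step_bound C h y (the_step \<rho> h y)"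
      proof (intro allI impI, elim conjE)
        fix h assume "0 < h" "h < r"
        from r(3)[OF y this] show "step_bound C h y (the_step \<rho> h y)" by (elim conjE)
      qed
    qed
  qed
  have loc': "\<exists>r>0. \<forall>y\<in>S \<inter> ball x r. P y r" if x: "x \<in> S" for x
  proof -
    from loc[OF x] obtain r where "r > 0" "\<forall>y\<in>S. dist y x < r \<longrightarrow> P y r" by blast
    then show ?thesis by (intro exI[of _ r]) (simp add: dist_commute)
  qed
  obtain h\<^sub>0 where h\<^sub>0: "continuous_on S h\<^sub>0" "\<And>x. x \<in> S \<Longrightarrow> h\<^sub>0 x > 0" "\<And>x. x \<in> S \<Longrightarrow> P x (h\<^sub>0 x)"
    by (rule continuous_selection[of S P, OF anti loc']; blast)
  show thesis
  proof (rule that[OF h\<^sub>0(1) \<rho>(1) h\<^sub>0(2) \<rho>(2)])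
    fix x h assume x: "x \<in> S" and h: "0 < h" "h < h\<^sub>0 x"
    note P = mp[OF spec[OF h\<^sub>0(3)[OF x, unfolded P_def], of h] conjI[OF h]]
    show "\<exists>!s. scheme T f g \<gamma> h x s \<and> near_step (\<rho> x) x s" using P by (rule conjunct1)
    show "\<exists>L. (the_step \<rho> h has_derivative L) (at x within S)" using P by (rule conjunct2)
  next
    fix x assume x: "x \<in> S"
    from loc[OF x] obtain r C where r: "r > 0" "C > 0" "\<And>y h. y \<in> S \<Longrightarrow> dist y x < r \<Longrightarrow> 0 < h \<Longrightarrow> h < r
        \<Longrightarrow> step_bound C h y (the_step \<rho> h y)"
      by blast
    obtain d where d: "d > 0" "\<And>y. y \<in> S \<Longrightarrow> dist y x < d \<Longrightarrow> h\<^sub>0 x / 2 < h\<^sub>0 y"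
      by (rule continuous_on_lower_half[OF h\<^sub>0(1) x h\<^sub>0(2)[OF x]]) blast
    show "\<exists>r>0. \<exists>C>0. \<forall>y\<in>S. dist y x < r \<longrightarrow> (\<forall>h. 0 < h \<and> h < r \<longrightarrow>
       h < h\<^sub>0 y \<and> step_bound C h y (the_step \<rho> h y))"
    proof (rule exI[of _ "min (min r d) (h\<^sub>0 x / 2)"], rule conjI, goal_cases)
      case 1
      then show ?case using r d h\<^sub>0(2)[OF x] by simp
    next
      case 2
      show ?case
      proof (rule exI[of _ C], rule conjI[OF r(2)], intro ballI impI allI)
        fix y h assume "y \<in> S" "dist y x < min (min r d) (h\<^sub>0 x / 2)" "0 < h \<and> h < min (min r d) (h\<^sub>0 x / 2)"
        then show "h < h\<^sub>0 y \<and> step_bound C h y (the_step \<rho> h y)"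
          using r(3)[of y h] d(2)[of y] by simp
      qed
    qed
  qed
qed

lemma the_step_unique:
  assumes "\<exists>!s. scheme T f g \<gamma> h x s \<and> near_step (\<rho> x) x s"
  shows "scheme T f g \<gamma> h x (the_step \<rho> h x)"
  using theI'[of "\<lambda>s. scheme T f g \<gamma> h x s \<and> near_step (\<rho> x) x s", OF assms] unfolding the_step_def by blast

lemma scheme_map_eq:
  "scheme_map T f g \<gamma> \<rho> h x = (fst (snd (snd (the_step \<rho> h x))), snd (snd (snd (snd (the_step \<rho> h x)))))"
  unfolding scheme_map_def the_step_def by (simp add: split_beta)

lemma scheme_in_S:
  assumes "scheme T f g \<gamma> h x (a, l, q, \<mu>, p)"
  shows "(q, p) \<in> S"
proof (cases x)
  case (Pair q\<^sub>0 p\<^sub>0)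
  have "0 = g q" "0 = J q *v grad T p"
    using assms unfolding Pair scheme_def prod.case by blast+
  then show ?thesis by (simp add: S_iff)
qed

lemma scheme_map_in_S:
  assumes "\<exists>!s. scheme T f g \<gamma> h x s \<and> near_step (\<rho> x) x s"
  shows "scheme_map T f g \<gamma> \<rho> h x \<in> S"
  using the_step_unique[of h x \<rho>, OF assms] unfolding scheme_map_eq
  by (cases "the_step \<rho> h x") (auto dest: scheme_in_S)

lemma scheme_map_conformal_symplectic:
  assumes h0: "continuous_on S h\<^sub>0" "\<And>x. x \<in> S \<Longrightarrow> h\<^sub>0 x > 0"
    and uni: "\<And>x h. x \<in> S \<Longrightarrow> 0 < h \<Longrightarrow> h < h\<^sub>0 x \<Longrightarrow> \<exists>!s. scheme T f g \<gamma> h x s \<and> near_step (\<rho> x) x s"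
    and der: "\<And>x h. x \<in> S \<Longrightarrow> 0 < h \<Longrightarrow> h < h\<^sub>0 x \<Longrightarrow> \<exists>L. (the_step \<rho> h has_derivative L) (at x within S)"
    and h: "h > 0"
  shows "conformal_symplectic (exp (- \<gamma> * h)) S {x \<in> S. h < h\<^sub>0 x} (scheme_map T f g \<gamma> \<rho> h)"
  unfolding conformal_symplectic_def
proof (intro ballI conjI)
  fix x assume "x \<in> {x \<in> S. h < h\<^sub>0 x}"
  then have x: "x \<in> S" "h < h\<^sub>0 x" by simp_all
  show "scheme_map T f g \<gamma> \<rho> h x \<in> S"
    by (rule scheme_map_in_S[of h x \<rho>, OF uni[OF x(1) h x(2)]])
  obtain L where L: "(the_step \<rho> h has_derivative L) (at x within S)" using der[OF x(1) h x(2)] by blast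
  obtain d where d: "d > 0" "\<And>y. y \<in> S \<Longrightarrow> dist y x < d \<Longrightarrow> dist (h\<^sub>0 y) (h\<^sub>0 x) < h\<^sub>0 x - h"
    using h0(1) x unfolding continuous_on_iff by (metis diff_gt_0_iff_gt)
  have "\<forall>\<^sub>F y in nhds x. y \<in> ball x d"
    using d(1) by (intro eventually_nhds_in_open) auto
  then have sch: "\<forall>\<^sub>F y in nhds x. y \<in> S \<longrightarrow> scheme T f g \<gamma> h y (the_step \<rho> h y)"
  proof (rule eventually_mono, intro impI)
    fix y assume y: "y \<in> ball x d" "y \<in> S"
    then have "\<bar>h\<^sub>0 y - h\<^sub>0 x\<bar> < h\<^sub>0 x - h"
      using d(2)[of y] by (simp add: dist_commute dist_real_def)
    then have "h < h\<^sub>0 y" by linarith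
    from uni[OF y(2) h this] show "scheme T f g \<gamma> h y (the_step \<rho> h y)"
      by (rule the_step_unique[of h y \<rho>])
  qed
  let ?\<pi> = "\<lambda>s :: ('n, 'm) step. (fst (snd (snd s)), snd (snd (snd (snd s))))"
  note * = step_conformal_symplectic[OF x(1) L sch]
  show "\<exists>A. (\<forall>\<xi> \<beta>. path_through S x \<xi> \<beta> \<longrightarrow> (scheme_map T f g \<gamma> \<rho> h \<circ> \<beta> has_vector_derivative A \<xi>) (at 0))
      \<and> (\<forall>\<xi>\<^sub>1\<in>tangent_space S x. \<forall>\<xi>\<^sub>2\<in>tangent_space S x. A \<xi>\<^sub>1 \<bullet> symp_J (A \<xi>\<^sub>2) = exp (- \<gamma> * h) * (\<xi>\<^sub>1 \<bullet> symp_J \<xi>\<^sub>2))"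
  proof (rule exI[of _ "\<lambda>\<xi>. ?\<pi> (L \<xi>)"], intro conjI allI impI ballI)
    fix \<xi> \<beta> assume "path_through S x \<xi> \<beta>"
    from *(1)[OF this] show "(scheme_map T f g \<gamma> \<rho> h \<circ> \<beta> has_vector_derivative ?\<pi> (L \<xi>)) (at 0)"
      unfolding o_def scheme_map_eq .
  next
    fix \<xi> \<eta> assume "\<xi> \<in> tangent_space S x" "\<eta> \<in> tangent_space S x"
    from *(2)[OF this] show "?\<pi> (L \<xi>) \<bullet> symp_J (?\<pi> (L \<eta>)) = exp (- \<gamma> * h) * (\<xi> \<bullet> symp_J \<eta>)" .
  qed
qed

end

section \<open>Error propagation modulo constraint forces\<close>

lemma vector_derivative_increment_bound:
  fixes F :: "real \<Rightarrow> 'a::real_normed_vector"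
  assumes F: "\<And>s. s \<in> {a..b} \<Longrightarrow> (F has_vector_derivative F' s) (at s within {a..b})"
    and M: "\<And>s. s \<in> {a..b} \<Longrightarrow> norm (F' s - v) \<le> M" and ab: "a \<le> b"
  shows "norm (F b - F a - (b - a) *\<^sub>R v) \<le> M * (b - a)"
proof -
  have "norm ((F b - b *\<^sub>R v) - (F a - a *\<^sub>R v)) \<le> M * norm (b - a)"
  proof (rule differentiable_bound[of "{a..b}" "\<lambda>s. F s - s *\<^sub>R v" "\<lambda>s u. u *\<^sub>R (F' s - v)"])
    fix s assume s: "s \<in> {a..b}"
    have "((\<lambda>s. F s - s *\<^sub>R v) has_vector_derivative F' s - v) (at s within {a..b})"
      by (auto intro!: derivative_eq_intros F[OF s])
    then show "((\<lambda>s. F s - s *\<^sub>R v) has_derivative (\<lambda>u. u *\<^sub>R (F' s - v))) (at s within {a..b})"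
      unfolding has_vector_derivative_def .
    show "onorm (\<lambda>u. u *\<^sub>R (F' s - v)) \<le> M"
    proof (rule onorm_le)
      fix u :: real
      show "norm (u *\<^sub>R (F' s - v)) \<le> M * norm u"
        using mult_left_mono[OF M[OF s], of "norm u"] by (simp add: mult.commute)
    qed
  qed (use ab in auto)
  then show ?thesis using ab by (simp add: algebra_simps)
qed

lemma C1_continuous_jacobian:
  fixes F :: "real^'n \<Rightarrow> real^'m"
  assumes "C1 F"
  shows "continuous_on A (\<lambda>x. jacobian F (at x))"
proof -
  obtain F' where F: "\<And>x. (F has_derivative blinfun_apply (F' x)) (at x)" "continuous_on UNIV F'"
    using assms unfolding C1_def by blast
  have "jacobian F (at x) = matrix (blinfun_apply (F' x))" for x
    unfolding jacobian_def using frechet_derivative_at[OF F(1)] by simp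
  moreover have "continuous_on A (\<lambda>x. matrix (blinfun_apply (F' x)))"
    by (rule bounded_linear.continuous_on[OF bounded_linear_matrix_of_blinfun])
      (rule continuous_on_subset[OF F(2)], simp)
  ultimately show ?thesis by simp
qed

lemma continuous_on_matrix_mult:
  fixes A :: "'a::topological_space \<Rightarrow> real^'n^'m" and B :: "'a \<Rightarrow> real^'k^'n"
  assumes "continuous_on X A" "continuous_on X B"
  shows "continuous_on X (\<lambda>t. A t ** B t)"
  unfolding matrix_matrix_mult_def
  by (intro continuous_on_vec_lambda continuous_on_sum continuous_on_mult continuous_on_component assms)

lemma continuous_on_det:
  fixes A :: "'a::topological_space \<Rightarrow> real^'n^'n"
  assumes "\<And>i j. continuous_on X (\<lambda>t. A t $ i $ j)"
  shows "continuous_on X (\<lambda>t. det (A t))"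
  unfolding det_def
  by (intro continuous_on_sum continuous_on_mult continuous_on_prod continuous_on_const assms)

lemma continuous_on_linear_system_solution:
  fixes W :: "'a::topological_space \<Rightarrow> real^'n^'n"
  assumes W: "continuous_on X W" and c: "continuous_on X c"
    and inv: "\<And>t. t \<in> X \<Longrightarrow> invertible (W t)" and l: "\<And>t. t \<in> X \<Longrightarrow> W t *v l t = c t"
  shows "continuous_on X l"
proof -
  let ?s = "\<lambda>t. \<chi> k. det (\<chi> i j. if j = k then c t $ i else W t $ i $ j) / det (W t)"
  have det: "det (W t) \<noteq> 0" if "t \<in> X" for t
    using inv[OF that] by (simp add: invertible_det_nz)
  have "continuous_on X ?s"
  proof (intro continuous_on_vec_lambda continuous_on_divide continuous_on_det ballI det)
    fix k i j
    show "continuous_on X (\<lambda>t. (\<chi> i j. if j = k then c t $ i else W t $ i $ j) $ i $ j)"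
      by (cases "j = k") (auto intro!: continuous_on_component W c)
    show "continuous_on X (\<lambda>t. W t $ i $ j)"
      by (intro continuous_on_component W)
  qed
  moreover have "l t = ?s t" if "t \<in> X" for t
    using cramer[OF det[OF that], of "l t" "c t"] l[OF that] by blast
  ultimately show ?thesis
    by (simp cong: continuous_on_cong)
qed

lemma exp_minus_quadratic:
  fixes x :: real
  assumes "x \<ge> 0"
  shows "\<bar>exp (- x) - 1 + x\<bar> \<le> x^2"
proof -
  have 1: "1 - x \<le> exp (- x)" using exp_ge_add_one_self[of "- x"] by simp
  have "1 + x \<le> exp x" by (rule exp_ge_add_one_self)
  then have "exp (- x) * (1 + x) \<le> exp (- x) * exp x" by (intro mult_left_mono) auto
  then have "exp (- x) * (1 + x) \<le> 1" by (simp add: exp_minus)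
  also have "1 \<le> (1 - x + x^2) * (1 + x)"
    using assms by (simp add: algebra_simps power2_eq_square)
  finally have "exp (- x) \<le> 1 - x + x^2" using assms by (simp add: mult_le_cancel_right)
  with 1 show ?thesis by simp
qed

context constrained_system
begin

text \<open>Both the scheme and the exact solution satisfy these estimates. The momentum equation is required
only up to a constraint force \<open>G(q')\<^sup>T w\<close>: since \<open>g\<close> is merely \<open>C\<^sup>2\<close>, the multiplier is only a
continuous function of the state, and the individual constraint forces of the two
solutions need not agree up to \<open>O(h\<^sup>2)\<close>.\<close>
definition consistent ::
    "real \<Rightarrow> real \<Rightarrow> (real^'n) \<times> (real^'n) \<Rightarrow> (real^'n) \<times> (real^'n) \<Rightarrow> bool" where
  "consistent C h = (\<lambda>(q, p) (q', p'). norm (q' - q) \<le> C * h \<and> norm (p' - p) \<le> C * h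
     \<and> norm (q' - q - h *\<^sub>R grad T p) \<le> C * h^2
     \<and> (\<exists>w. norm w \<le> C * h \<and> norm (p' - p + h *\<^sub>R (grad f q + \<gamma> *\<^sub>R p) - N q' *v w) \<le> C * h^2))"

lemma consistent_mono:
  assumes "consistent C h x y" "C \<le> C'" "0 \<le> h"
  shows "consistent C' h x y"
proof -
  have "C * h \<le> C' * h" "C * h^2 \<le> C' * h^2"
    using assms by (auto intro: mult_right_mono)
  with assms(1) show ?thesis
    unfolding consistent_def split_beta by (meson order_trans)
qed

lemma data_lipschitz:
  obtains K where "K > 0"
    "\<And>u v. norm u \<le> R \<Longrightarrow> norm v \<le> R \<Longrightarrow> norm (grad f u - grad f v) \<le> K * norm (u - v)"
    "\<And>u v. norm u \<le> R \<Longrightarrow> norm v \<le> R \<Longrightarrow> norm (grad T u - grad T v) \<le> K * norm (u - v)"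
    "\<And>u v w. norm u \<le> R \<Longrightarrow> norm v \<le> R \<Longrightarrow> norm (N u *v w - N v *v w) \<le> K * norm (u - v) * norm w"
    "\<And>u w. norm u \<le> R \<Longrightarrow> norm (N u *v w) \<le> K * norm w"
proof -
  have c: "C1 (\<lambda>q. N q)" by (intro C1_intros C1_J)
  obtain k1 where k1: "k1 > 0" "\<And>u v. u \<in> cball 0 R \<Longrightarrow> v \<in> cball 0 R \<Longrightarrow> norm (grad f u - grad f v) \<le> k1 * norm (u - v)"
    by (rule C1_lipschitz_on_cball[OF C1_grad_f, of 0 R]) blast
  obtain k2 where k2: "k2 > 0" "\<And>u v. u \<in> cball 0 R \<Longrightarrow> v \<in> cball 0 R \<Longrightarrow> norm (grad T u - grad T v) \<le> k2 * norm (u - v)"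
    by (rule C1_lipschitz_on_cball[OF C1_grad_T, of 0 R]) blast
  obtain k3 where k3: "k3 > 0" "\<And>u v. u \<in> cball 0 R \<Longrightarrow> v \<in> cball 0 R \<Longrightarrow> norm (N u - N v) \<le> k3 * norm (u - v)"
    by (rule C1_lipschitz_on_cball[OF c, of 0 R]) blast
  obtain b where b: "b > 0" "\<And>(A :: real^'m^'n) w. norm (A *v w) \<le> norm A * norm w * b"
    using bounded_bilinear.pos_bounded[OF bounded_bilinear_matrix_vector_mult[where ?'n = 'm and ?'m = 'n]] by blast
  have "bounded ((\<lambda>q. N q) ` cball 0 R)"
    by (intro compact_imp_bounded compact_continuous_image C1_imp_continuous[OF c]) simp
  then obtain k4 where k4: "k4 > 0" "\<And>u. u \<in> cball 0 R \<Longrightarrow> norm (N u) \<le> k4"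
    unfolding bounded_pos by blast
  define K where "K = k1 + k2 + b * k3 + b * k4"
  have K: "K > 0" "k1 \<le> K" "k2 \<le> K" "b * k3 \<le> K" "b * k4 \<le> K"
    using k1(1) k2(1) k3(1) k4(1) b(1) mult_pos_pos[OF b(1) k3(1)] mult_pos_pos[OF b(1) k4(1)]
    unfolding K_def by linarith+
  show thesis
  proof (rule that[OF K(1)])
    fix u v :: "real^'n" assume uv: "norm u \<le> R" "norm v \<le> R"
    show "norm (grad f u - grad f v) \<le> K * norm (u - v)"
      using k1(2)[of u v] uv mult_right_mono[OF K(2), of "norm (u - v)"] by simp
    show "norm (grad T u - grad T v) \<le> K * norm (u - v)"
      using k2(2)[of u v] uv mult_right_mono[OF K(3), of "norm (u - v)"] by simp
    fix w :: "real^'m"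
    have "norm (N u *v w - N v *v w) = norm ((N u - N v) *v w)"
      by (simp add: matrix_vector_mult_diff_rdistrib)
    also have "\<dots> \<le> norm (N u - N v) * norm w * b" by (rule b(2))
    also have "\<dots> \<le> (k3 * norm (u - v)) * norm w * b"
      using k3(2)[of u v] uv b(1) by (intro mult_right_mono) auto
    also have "\<dots> = (b * k3) * (norm (u - v) * norm w)" by simp
    also have "\<dots> \<le> K * (norm (u - v) * norm w)"
      using K(4) by (intro mult_right_mono) auto
    finally show "norm (N u *v w - N v *v w) \<le> K * norm (u - v) * norm w" by (simp add: mult.assoc)
  next
    fix u :: "real^'n" and w :: "real^'m" assume u: "norm u \<le> R"
    have "norm (N u *v w) \<le> norm (N u) * norm w * b" by (rule b(2))
    also have "\<dots> \<le> k4 * norm w * b"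
      using k4(2)[of u] u b(1) by (intro mult_right_mono) auto
    also have "\<dots> = (b * k4) * norm w" by simp
    also have "\<dots> \<le> K * norm w" using K(5) by (intro mult_right_mono) auto
    finally show "norm (N u *v w) \<le> K * norm w" .
  qed
qed

text \<open>The constraint force is \<open>w = - (h / 2) (l + \<mu>)\<close>; replacing \<open>G(q)\<close> by \<open>G(q')\<close> in the first kick costs
\<open>O(h\<^sup>2)\<close>.\<close>
lemma step_consistent:
  assumes C: "C > 0"
  obtains D where "\<And>y h a l q' \<mu> p'. norm y \<le> R \<Longrightarrow> 0 < h \<Longrightarrow> h \<le> 1 \<Longrightarrow>
    scheme T f g \<gamma> h y (a, l, q', \<mu>, p') \<Longrightarrow> step_bound C h y (a, l, q', \<mu>, p') \<Longrightarrow> consistent D h y (q', p')"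
proof -
  obtain K where K: "K > 0"
    "\<And>u v. norm u \<le> R + C \<Longrightarrow> norm v \<le> R + C \<Longrightarrow> norm (grad f u - grad f v) \<le> K * norm (u - v)"
    "\<And>u v. norm u \<le> R + C \<Longrightarrow> norm v \<le> R + C \<Longrightarrow> norm (grad T u - grad T v) \<le> K * norm (u - v)"
    "\<And>u v w. norm u \<le> R + C \<Longrightarrow> norm v \<le> R + C \<Longrightarrow> norm (N u *v w - N v *v w) \<le> K * norm (u - v) * norm w"
    "\<And>u w. norm u \<le> R + C \<Longrightarrow> norm (N u *v w) \<le> K * norm w"
    by (rule data_lipschitz[of "R + C"]) blast
  define D where "D = C + K * C + \<gamma>^2 * \<bar>R\<bar> + K * C * C"
  have nn: "0 \<le> K * C" "0 \<le> \<gamma>^2 * \<bar>R\<bar>" "0 \<le> K * C * C" using K(1) C by simp_all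
  show thesis
  proof (rule that[of D])
    fix y h a l q' \<mu> p'
    assume y: "norm y \<le> R" and h: "0 < h" "h \<le> 1" and s: "scheme T f g \<gamma> h y (a, l, q', \<mu>, p')"
      "step_bound C h y (a, l, q', \<mu>, p')"
    obtain q p where y_eq: "y = (q, p)" by (cases y)
    have e: "a = exp (- \<gamma> * h) *\<^sub>R p - (h / 2) *\<^sub>R (grad f q + N q *v l)" "q' = q + h *\<^sub>R grad T a"
      "p' = a - (h / 2) *\<^sub>R (grad f q' + N q' *v \<mu>)"
      using s(1) unfolding y_eq scheme_def prod.case by blast+
    have b: "norm (a - p) \<le> C * h" "norm (q' - q) \<le> C * h" "norm (p' - p) \<le> C * h" "norm l \<le> C" "norm \<mu> \<le> C"
      using s(2) unfolding y_eq step_bound_def prod.case dist_norm by blast+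
    have Ch: "C * h \<le> C" using C h by simp
    have R: "norm q \<le> R" "norm p \<le> R"
      using y norm_fst_le[of q p] norm_snd_le[of p q] by (simp_all add: y_eq)
    have R': "norm q' \<le> R + C" "norm a \<le> R + C"
      using norm_triangle_ineq[of q "q' - q"] norm_triangle_ineq[of p "a - p"] R b Ch by simp_all
    have R'': "norm q \<le> R + C" "norm p \<le> R + C" using R C by simp_all
    have hh: "X * h \<le> D * h" if "X \<le> D" for X using that h by simp
    have hh2: "X * h^2 \<le> D * h^2" if "X \<le> D" for X using that by (intro mult_right_mono) auto
    have CD: "C \<le> D" unfolding D_def using nn by linarith
    have 1: "norm (q' - q - h *\<^sub>R grad T p) \<le> D * h^2"
    proof -
      have "q' - q - h *\<^sub>R grad T p = h *\<^sub>R (grad T a - grad T p)" by (simp add: e(2) scaleR_diff_right)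
      then have "norm (q' - q - h *\<^sub>R grad T p) = h * norm (grad T a - grad T p)" using h by simp
      also have "\<dots> \<le> h * (K * (C * h))"
        using h K(1) b(1) by (intro mult_left_mono order_trans[OF K(3)[OF R'(2) R''(2)]]) auto
      also have "\<dots> = (K * C) * h^2" by (simp add: power2_eq_square)
      also have "\<dots> \<le> D * h^2" by (rule hh2) (use nn C in \<open>simp add: D_def\<close>)
      finally show ?thesis .
    qed
    define w where "w = - ((h / 2) *\<^sub>R (l + \<mu>))"
    have w: "norm w \<le> C * h"
    proof -
      have "norm w = (h / 2) * norm (l + \<mu>)" unfolding w_def using h by simp
      also have "\<dots> \<le> (h / 2) * (C + C)"
        using h b by (intro mult_left_mono norm_triangle_le add_mono) auto
      finally show ?thesis by (simp add: mult.commute)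
    qed
    have "p' - p + h *\<^sub>R (grad f q + \<gamma> *\<^sub>R p) - N q' *v w
        = (exp (- \<gamma> * h) - 1 + \<gamma> * h) *\<^sub>R p - (h / 2) *\<^sub>R (grad f q' - grad f q)
          - (h / 2) *\<^sub>R (N q *v l - N q' *v l)"
    proof -
      have hf: "h *\<^sub>R grad f q = (h / 2) *\<^sub>R grad f q + (h / 2) *\<^sub>R grad f q"
        by (simp flip: scaleR_add_left)
      have Nw: "N q' *v w = - ((h / 2) *\<^sub>R (N q' *v l) + (h / 2) *\<^sub>R (N q' *v \<mu>))"
        unfolding w_def by (simp add: matrix_vector_mult_scaleR matrix_vector_right_distrib
            linear_neg[OF matrix_vector_mul_linear] linear_diff[OF matrix_vector_mul_linear] scaleR_add_right)
      show ?thesis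
        unfolding e(3) e(1) Nw scaleR_add_right scaleR_diff_right hf
        by (simp add: scaleR_add_left scaleR_diff_left mult.commute)
    qed
    then have "norm (p' - p + h *\<^sub>R (grad f q + \<gamma> *\<^sub>R p) - N q' *v w)
        \<le> norm ((exp (- \<gamma> * h) - 1 + \<gamma> * h) *\<^sub>R p) + norm ((h / 2) *\<^sub>R (grad f q' - grad f q))
          + norm ((h / 2) *\<^sub>R (N q *v l - N q' *v l))"
      using norm_triangle_ineq4 norm_triangle_mono by (smt (verit, best))
    also have "\<dots> \<le> (\<gamma> * h)^2 * \<bar>R\<bar> + h * (K * (C * h)) + h * (K * (C * h) * C)"
    proof (intro add_mono)
      have "\<bar>exp (- \<gamma> * h) - 1 + \<gamma> * h\<bar> \<le> (\<gamma> * h)^2"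
        using exp_minus_quadratic[of "\<gamma> * h"] \<gamma> h by simp
      then show "norm ((exp (- \<gamma> * h) - 1 + \<gamma> * h) *\<^sub>R p) \<le> (\<gamma> * h)^2 * \<bar>R\<bar>"
        unfolding norm_scaleR using R by (intro mult_mono) auto
      have "norm (grad f q' - grad f q) \<le> K * (C * h)"
        using K(1) b(2) by (intro order_trans[OF K(2)[OF R'(1) R''(1)]] mult_left_mono) auto
      then show "norm ((h / 2) *\<^sub>R (grad f q' - grad f q)) \<le> h * (K * (C * h))"
        unfolding norm_scaleR using h by (intro mult_mono) auto
      have "norm (N q *v l - N q' *v l) \<le> K * (C * h) * C"
        using K(1) b C h by (intro order_trans[OF K(4)[OF R''(1) R'(1)]] mult_mono) (auto simp: norm_minus_commute)
      then show "norm ((h / 2) *\<^sub>R (N q *v l - N q' *v l)) \<le> h * (K * (C * h) * C)"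
        unfolding norm_scaleR using h by (intro mult_mono) auto
    qed
    also have "\<dots> = (\<gamma>^2 * \<bar>R\<bar> + K * C + K * C * C) * h^2"
      by (simp add: algebra_simps power2_eq_square)
    also have "\<dots> \<le> D * h^2" by (rule hh2) (use C in \<open>simp add: D_def\<close>)
    finally have 2: "norm (p' - p + h *\<^sub>R (grad f q + \<gamma> *\<^sub>R p) - N q' *v w) \<le> D * h^2" .
    show "consistent D h y (q', p')"
      unfolding consistent_def y_eq prod.case
      using 1 2 w b(2,3) hh[OF CD] by (meson order_trans)
  qed
qed

text \<open>The momentum error is measured modulo the range of \<open>G(q)\<^sup>T\<close>: only what remains after a suitable
constraint force \<open>G(q)\<^sup>T \<nu>\<close> has been subtracted counts. The forces \<open>w\<close> and \<open>w'\<close> of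
the two solutions are absorbed into \<open>\<nu>\<close>, which costs only differences of \<open>G\<close> at nearby points times
\<open>O(h)\<close>. What remains is Lipschitz in the state, so the error grows as for a Lipschitz vector
field although the reduced vector field is only continuous.\<close>
lemma error_propagation:
  assumes C: "C > 0" and c: "c > 0"
  obtains D where "D > 0"
    "\<And>h e q p q' p' q\<^sub>1 p\<^sub>1 q\<^sub>1' p\<^sub>1' \<nu>. 0 < h \<Longrightarrow> h \<le> 1 \<Longrightarrow> norm (q, p) \<le> R \<Longrightarrow> norm (q', p') \<le> R \<Longrightarrow>
      consistent C h (q, p) (q\<^sub>1, p\<^sub>1) \<Longrightarrow> consistent C h (q', p') (q\<^sub>1', p\<^sub>1') \<Longrightarrow>
      norm (q' - q) \<le> e \<Longrightarrow> norm (p' - p - N q *v \<nu>) \<le> e \<Longrightarrow> norm (p' - p) \<le> c * e \<Longrightarrow> norm \<nu> \<le> c * e \<Longrightarrow>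
      \<exists>\<nu>'. norm (q\<^sub>1' - q\<^sub>1) \<le> e + D * h * (e + h) \<and> norm (p\<^sub>1' - p\<^sub>1 - N q\<^sub>1 *v \<nu>') \<le> e + D * h * (e + h)"
proof -
  obtain K where K: "K > 0"
    "\<And>u v. norm u \<le> R + C \<Longrightarrow> norm v \<le> R + C \<Longrightarrow> norm (grad f u - grad f v) \<le> K * norm (u - v)"
    "\<And>u v. norm u \<le> R + C \<Longrightarrow> norm v \<le> R + C \<Longrightarrow> norm (grad T u - grad T v) \<le> K * norm (u - v)"
    "\<And>u v w. norm u \<le> R + C \<Longrightarrow> norm v \<le> R + C \<Longrightarrow> norm (N u *v w - N v *v w) \<le> K * norm (u - v) * norm w"
    "\<And>u w. norm u \<le> R + C \<Longrightarrow> norm (N u *v w) \<le> K * norm w"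
    by (rule data_lipschitz[of "R + C"]) blast
  \<comment> \<open>The sum of the constants of all error terms, each of which is \<open>O(h e)\<close> or \<open>O(h\<^sup>2)\<close>.\<close>
  define D where "D = K * c + 2 * C + K * C * c + K + \<gamma> * c + K * C * (1 + 2 * C)"
  have D: "D > 0" unfolding D_def using K(1) C c \<gamma> by (intro add_pos_pos mult_pos_pos) auto
  have tri2: "norm (x + y) \<le> a + b" if "norm x \<le> a" "norm y \<le> b" for x y :: "real^'n" and a b
    using norm_triangle_mono[OF that] .
  have tri2': "norm (x - y) \<le> a + b" if "norm x \<le> a" "norm y \<le> b" for x y :: "real^'n" and a b
    using norm_triangle_ineq4[of x y] that by linarith
  show thesis
  proof (rule that[OF D])
    fix h e q p q' p' q\<^sub>1 p\<^sub>1 q\<^sub>1' p\<^sub>1' \<nu>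
    assume h: "0 < h" "h \<le> 1" and R: "norm (q, p) \<le> R" "norm (q', p') \<le> R"
      and con: "consistent C h (q, p) (q\<^sub>1, p\<^sub>1)" "consistent C h (q', p') (q\<^sub>1', p\<^sub>1')"
      and e: "norm (q' - q) \<le> e" "norm (p' - p - N q *v \<nu>) \<le> e" "norm (p' - p) \<le> c * e" "norm \<nu> \<le> c * e"
    have e0: "0 \<le> e" using e(1) norm_ge_zero[of "q' - q"] by linarith
    obtain w where w: "norm (q\<^sub>1 - q) \<le> C * h" "norm (q\<^sub>1 - q - h *\<^sub>R grad T p) \<le> C * h^2" "norm w \<le> C * h"
       "norm (p\<^sub>1 - p + h *\<^sub>R (grad f q + \<gamma> *\<^sub>R p) - N q\<^sub>1 *v w) \<le> C * h^2"
      using con(1) unfolding consistent_def prod.case by blast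
    obtain w' where w': "norm (q\<^sub>1' - q') \<le> C * h" "norm (q\<^sub>1' - q' - h *\<^sub>R grad T p') \<le> C * h^2" "norm w' \<le> C * h"
       "norm (p\<^sub>1' - p' + h *\<^sub>R (grad f q' + \<gamma> *\<^sub>R p') - N q\<^sub>1' *v w') \<le> C * h^2"
      using con(2) unfolding consistent_def prod.case by blast
    have Ch: "C * h \<le> C" using C h by simp
    have nR: "norm q \<le> R" "norm p \<le> R" "norm q' \<le> R" "norm p' \<le> R"
      using R norm_fst_le[of q p] norm_snd_le[of p q] norm_fst_le[of q' p'] norm_snd_le[of p' q'] by simp_all
    have RC: "norm q \<le> R + C" "norm p \<le> R + C" "norm q' \<le> R + C" "norm p' \<le> R + C"
      using nR C by simp_all
    have RC1: "norm q\<^sub>1 \<le> R + C" "norm q\<^sub>1' \<le> R + C"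
      using norm_triangle_ineq[of q "q\<^sub>1 - q"] norm_triangle_ineq[of q' "q\<^sub>1' - q'"] nR w(1) w'(1) Ch by simp_all
    have "norm (grad T p' - grad T p) \<le> K * (c * e)"
      using K(1) e(3) by (intro order_trans[OF K(3)[OF RC(4,2)]] mult_left_mono) auto
    then have T: "norm (h *\<^sub>R (grad T p' - grad T p)) \<le> h * (K * (c * e))"
      unfolding norm_scaleR using h by (intro mult_mono) auto
    have "norm (grad f q' - grad f q) \<le> K * e"
      using K(1) e(1) by (intro order_trans[OF K(2)[OF RC(3,1)]] mult_left_mono) auto
    then have F: "norm (h *\<^sub>R (grad f q' - grad f q)) \<le> h * (K * e)"
      unfolding norm_scaleR using h by (intro mult_mono) auto
    have P: "norm ((h * \<gamma>) *\<^sub>R (p' - p)) \<le> (h * \<gamma>) * (c * e)"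
      unfolding norm_scaleR using h \<gamma> e(3) by (intro mult_mono) auto
    have "q\<^sub>1' - q\<^sub>1 = (q' - q) + ((q\<^sub>1' - q') - (q\<^sub>1 - q))" by simp
    also have "norm \<dots> \<le> e + (C * h + C * h)" by (intro tri2 tri2' e(1) w(1) w'(1))
    finally have dq: "norm (q\<^sub>1' - q\<^sub>1) \<le> e + 2 * C * h" by simp
    have "q\<^sub>1' - q\<^sub>1 = (q' - q) + h *\<^sub>R (grad T p' - grad T p)
        + ((q\<^sub>1' - q' - h *\<^sub>R grad T p') - (q\<^sub>1 - q - h *\<^sub>R grad T p))"
      by (simp add: scaleR_diff_right)
    also have "norm \<dots> \<le> e + h * (K * (c * e)) + (C * h^2 + C * h^2)"
      by (intro tri2 tri2' e(1) T w(2) w'(2))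
    also have "\<dots> \<le> e + D * h * (e + h)"
    proof -
      have "K * c \<le> D" "2 * C \<le> D" unfolding D_def using K(1) C c \<gamma> by (auto intro!: add_nonneg_nonneg)
      then have "K * c * (h * e) \<le> D * (h * e)" "2 * C * h^2 \<le> D * h^2"
        using h e0 by (intro mult_right_mono; simp)+
      then show ?thesis by (simp add: algebra_simps power2_eq_square)
    qed
    finally have 1: "norm (q\<^sub>1' - q\<^sub>1) \<le> e + D * h * (e + h)" .
    have N1: "norm (N q *v \<nu> - N q\<^sub>1 *v \<nu>) \<le> K * (C * h) * (c * e)"
      using K(1) C h w(1) e(4) by (intro order_trans[OF K(4)[OF RC(1) RC1(1)]] mult_mono) (auto simp: norm_minus_commute)
    have N2: "norm (N q\<^sub>1' *v w' - N q\<^sub>1 *v w') \<le> K * (e + 2 * C * h) * (C * h)"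
      using K(1) C h e0 w'(3) dq by (intro order_trans[OF K(4)[OF RC1(2,1)]] mult_mono) auto
    have "p\<^sub>1' - p\<^sub>1 - N q\<^sub>1 *v (\<nu> + w' - w) = (p' - p - N q *v \<nu>) + (N q *v \<nu> - N q\<^sub>1 *v \<nu>)
        - h *\<^sub>R (grad f q' - grad f q) - (h * \<gamma>) *\<^sub>R (p' - p) + (N q\<^sub>1' *v w' - N q\<^sub>1 *v w')
        + ((p\<^sub>1' - p' + h *\<^sub>R (grad f q' + \<gamma> *\<^sub>R p') - N q\<^sub>1' *v w')
            - (p\<^sub>1 - p + h *\<^sub>R (grad f q + \<gamma> *\<^sub>R p) - N q\<^sub>1 *v w))"
      unfolding matrix_vector_right_distrib linear_diff[OF matrix_vector_mul_linear] scaleR_add_right scaleR_diff_right scaleR_scaleR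
      by simp
    also have "norm \<dots> \<le> e + K * (C * h) * (c * e) + h * (K * e) + (h * \<gamma>) * (c * e)
        + K * (e + 2 * C * h) * (C * h) + (C * h^2 + C * h^2)"
      by (intro tri2 tri2' e(2) N1 F P N2 w(4) w'(4))
    also have "\<dots> = e + (K * C * c + K + \<gamma> * c + K * C) * (h * e) + (K * C * (2 * C) + 2 * C) * h^2"
      by (simp add: algebra_simps power2_eq_square)
    also have "\<dots> \<le> e + D * (h * e) + D * h^2"
    proof (intro add_mono mult_right_mono order_refl)
      have "0 \<le> K * c" "0 \<le> K * C * c" "0 \<le> \<gamma> * c" "0 \<le> K * C" "0 \<le> K * C * (2 * C)"
        using K(1) C c \<gamma> by simp_all
      then show "K * C * c + K + \<gamma> * c + K * C \<le> D" "K * C * (2 * C) + 2 * C \<le> D"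
        unfolding D_def distrib_left using K(1) C by linarith+
    qed (use h e0 in auto)
    also have "\<dots> = e + D * h * (e + h)" by (simp add: algebra_simps power2_eq_square)
    finally have "norm (p\<^sub>1' - p\<^sub>1 - N q\<^sub>1 *v (\<nu> + w' - w)) \<le> e + D * h * (e + h)" .
    with 1 show "\<exists>\<nu>'. norm (q\<^sub>1' - q\<^sub>1) \<le> e + D * h * (e + h) \<and> norm (p\<^sub>1' - p\<^sub>1 - N q\<^sub>1 *v \<nu>') \<le> e + D * h * (e + h)"
      by blast
  qed
qed

end

section \<open>The exact solution\<close>

lemma bounded_continuous_image:
  fixes F :: "real \<Rightarrow> 'a::real_normed_vector"
  assumes "continuous_on {a..b} F"
  obtains M where "M > 0" "\<And>t. t \<in> {a..b} \<Longrightarrow> norm (F t) \<le> M"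
proof -
  have "bounded (F ` {a..b})"
    by (intro compact_imp_bounded compact_continuous_image assms compact_Icc)
  then show thesis unfolding bounded_pos using that by blast
qed

context constrained_system
begin

text \<open>Differentiating \<open>g(q(t)) = 0\<close> once gives the hidden constraint, and a second time a linear system for
\<open>l(t)\<close> with matrix \<open>G H\<^sub>p\<^sub>p G\<^sup>T\<close> and continuous data; Cramer's rule shows that \<open>l\<close> is continuous.\<close>
lemma exact_solution_regular:
  assumes t1: "t\<^sub>1 > 0"
    and q: "\<And>t. t \<in> {0..t\<^sub>1} \<Longrightarrow> (q has_vector_derivative grad T (p t)) (at t within {0..t\<^sub>1})"
    and p: "\<And>t. t \<in> {0..t\<^sub>1} \<Longrightarrow> (p has_vector_derivative (- grad f (q t) - N (q t) *v l t - \<gamma> *\<^sub>R p t)) (at t within {0..t\<^sub>1})"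
    and g0: "\<And>t. t \<in> {0..t\<^sub>1} \<Longrightarrow> g (q t) = 0"
  shows "t \<in> {0..t\<^sub>1} \<Longrightarrow> (q t, p t) \<in> S" and "continuous_on {0..t\<^sub>1} l"
proof -
  let ?I = "{0..t\<^sub>1}"
  have zero: "D = 0" if "t \<in> ?I" "(F has_vector_derivative D) (at t within ?I)" "\<And>t. t \<in> ?I \<Longrightarrow> F t = 0"
    for t and F :: "real \<Rightarrow> real^'m" and D
  proof -
    have "(F has_vector_derivative 0) (at t within ?I)"
      by (rule has_vector_derivative_transform[OF that(1) _ has_vector_derivative_const]) (use that(3) in simp)
    then show ?thesis
      using vector_derivative_unique_within_closed_interval[OF t1 that(1)[folded cbox_interval] that(2)[folded cbox_interval]]
      by (simp add: cbox_interval)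
  qed
  have chain: "((\<lambda>\<tau>. F (c \<tau>)) has_vector_derivative F' v) (at t within ?I)"
    if "(F has_derivative F') (at (c t))" "(c has_vector_derivative v) (at t within ?I)"
    for F :: "'x::real_normed_vector \<Rightarrow> real^'m" and F' and c :: "real \<Rightarrow> 'x" and v t
    using vector_derivative_diff_chain_within[OF that(2) has_derivative_at_withinI[OF that(1)]] by (simp add: o_def)
  have hidden: "J (q t) *v grad T (p t) = 0" if "t \<in> ?I" for t
    by (rule zero[OF that chain[OF g_derivative q[OF that]] g0])
  show S: "(q t, p t) \<in> S" if "t \<in> ?I" for t
    using hidden[OF that] g0[OF that] by (simp add: S_iff)
  have cq: "continuous_on ?I q" and cp: "continuous_on ?I p"
    by (rule continuous_on_vector_derivative, rule q, assumption)
      (rule continuous_on_vector_derivative, rule p)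
  define Z where "Z = (\<lambda>z. J (fst z) *v grad T (snd z))"
  have "C1 Z" unfolding Z_def by (intro C1_intros C1_data)
  then obtain Z' where Z': "\<And>z. (Z has_derivative blinfun_apply (Z' z)) (at z)" "continuous_on UNIV Z'"
    unfolding C1_def by blast
  have Z'p: "Z' (x, y) (0, u) = J x *v (hess T y *v u)" for x y u
  proof -
    have "((\<lambda>y. (x, y)) has_derivative (\<lambda>u. (0, u))) (at y)"
      by (auto intro!: derivative_eq_intros)
    from has_derivative_compose[OF this Z'(1)]
    have 1: "((\<lambda>y. Z (x, y)) has_derivative (\<lambda>u. Z' (x, y) (0, u))) (at y)" .
    have 2: "((\<lambda>y. Z (x, y)) has_derivative (\<lambda>u. J x *v (hess T y *v u))) (at y)"
      unfolding Z_def fst_conv snd_conv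
      by (rule bounded_linear.has_derivative[OF matrix_vector_mul_bounded_linear grad_T_derivative])
    show ?thesis using fun_cong[OF has_derivative_unique[OF 1 2], of u] by simp
  qed
  define W where "W = (\<lambda>t. J (q t) ** hess T (p t) ** N (q t))"
  define c where "c = (\<lambda>t. Z' (q t, p t) (grad T (p t), - grad f (q t) - \<gamma> *\<^sub>R p t))"
  have Wl: "W t *v l t = c t" if t: "t \<in> ?I" for t
  proof -
    have "blinfun_apply (Z' (q t, p t)) (grad T (p t), - grad f (q t) - N (q t) *v l t - \<gamma> *\<^sub>R p t) = 0"
      by (rule zero[OF t chain[OF Z'(1) has_vector_derivative_Pair[OF q[OF t] p[OF t]]]])
        (simp add: Z_def hidden)
    moreover have "(grad T (p t), - grad f (q t) - N (q t) *v l t - \<gamma> *\<^sub>R p t)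
       = (grad T (p t), - grad f (q t) - \<gamma> *\<^sub>R p t) - (0, N (q t) *v l t)" by simp
    ultimately have "c t = Z' (q t, p t) (0, N (q t) *v l t)"
      unfolding c_def by (simp only: blinfun.diff_right right_minus_eq)
    then show ?thesis
      unfolding Z'p W_def by (simp only: matrix_vector_mul_assoc matrix_mul_assoc)
  qed
  have cN: "continuous_on ?I (\<lambda>t. N (q t))"
    by (rule continuous_on_compose2[OF C1_imp_continuous[of "\<lambda>x. N x" UNIV] cq]) (intro C1_intros C1_J, simp)
  have cJ: "continuous_on ?I (\<lambda>t. J (q t))"
    by (rule continuous_on_compose2[OF C1_imp_continuous[of "\<lambda>x. J x" UNIV] cq]) (intro C1_J, simp)
  have cH: "continuous_on ?I (\<lambda>t. hess T (p t))"
    unfolding hess_def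
    by (rule continuous_on_compose2[OF C1_continuous_jacobian[OF C1_grad_T, of UNIV] cp]) simp
  have cZ: "continuous_on ?I (\<lambda>t. Z' (q t, p t))"
    by (rule continuous_on_compose2[OF Z'(2) continuous_on_Pair[OF cq cp]]) simp
  have cf: "continuous_on ?I (\<lambda>t. grad f (q t))"
    by (rule continuous_on_compose2[OF C1_imp_continuous[OF C1_grad_f, of UNIV] cq]) simp
  have cT: "continuous_on ?I (\<lambda>t. grad T (p t))"
    by (rule continuous_on_compose2[OF C1_imp_continuous[OF C1_grad_T, of UNIV] cp]) simp
  have "continuous_on ?I c"
    unfolding c_def
    by (intro bounded_bilinear.continuous_on[OF bounded_bilinear_blinfun_apply] cZ continuous_on_Pair
        cT continuous_on_diff continuous_on_minus cf continuous_on_scaleR continuous_on_const cp)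
  moreover have "continuous_on ?I W"
    unfolding W_def by (intro continuous_on_matrix_mult cJ cH cN)
  moreover have "invertible (W t)" if "t \<in> ?I" for t
    unfolding W_def by (rule invertible_schur[OF S[OF that]])
  ultimately show "continuous_on ?I l"
    using Wl continuous_on_linear_system_solution[of ?I W c l] by blast
qed

text \<open>With an antiderivative \<open>\<Lambda>\<close> of the multiplier, the constraint force of a step is \<open>w = - (\<Lambda>(t + h) - \<Lambda>(t))\<close>.
Adding \<open>G(q(t + h))\<^sup>T \<Lambda>\<close> to the momentum leaves a curve whose velocity varies by \<open>O(h)\<close> over a step.\<close>
lemma exact_solution_consistent:
  assumes t1: "t\<^sub>1 > 0" and sol: "exact_solution T f g \<gamma> t\<^sub>1 x"
  obtains C where "C > 0" "continuous_on {0..t\<^sub>1} x" "\<And>t. t \<in> {0..t\<^sub>1} \<Longrightarrow> x t \<in> S"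
    "\<And>t h. 0 \<le> t \<Longrightarrow> 0 < h \<Longrightarrow> t + h \<le> t\<^sub>1 \<Longrightarrow> consistent C h (x t) (x (t + h))"
proof -
  let ?I = "{0..t\<^sub>1}"
  obtain q p l where x: "\<And>t. x t = (q t, p t)"
    and q: "\<And>t. t \<in> ?I \<Longrightarrow> (q has_vector_derivative grad T (p t)) (at t within ?I)"
    and p: "\<And>t. t \<in> ?I \<Longrightarrow> (p has_vector_derivative (- grad f (q t) - N (q t) *v l t - \<gamma> *\<^sub>R p t)) (at t within ?I)"
    and g0: "\<And>t. t \<in> ?I \<Longrightarrow> g (q t) = 0"
    using sol unfolding exact_solution_def by blast
  note reg = exact_solution_regular[of t\<^sub>1 q p l, OF t1]
  have S: "(q t, p t) \<in> S" if "t \<in> ?I" for t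
    using reg(1)[OF _ _ _ that] q p g0 by blast
  have cl: "continuous_on ?I l"
    using reg(2) q p g0 by blast
  have cq: "continuous_on ?I q" and cp: "continuous_on ?I p"
    by (rule continuous_on_vector_derivative, rule q, assumption)
      (rule continuous_on_vector_derivative, rule p)
  have cx: "continuous_on ?I x"
    using continuous_on_Pair[OF cq cp] by (simp add: x[abs_def])
  obtain Mq where Mq: "Mq > 0" "\<And>t. t \<in> ?I \<Longrightarrow> norm (q t) \<le> Mq" by (rule bounded_continuous_image[OF cq]) blast
  obtain Mp where Mp: "Mp > 0" "\<And>t. t \<in> ?I \<Longrightarrow> norm (p t) \<le> Mp" by (rule bounded_continuous_image[OF cp]) blast
  obtain Ml where Ml: "Ml > 0" "\<And>t. t \<in> ?I \<Longrightarrow> norm (l t) \<le> Ml" by (rule bounded_continuous_image[OF cl]) blast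
  define R where "R = Mq + Mp"
  have Rq: "norm (q t) \<le> R" and Rp: "norm (p t) \<le> R" if "t \<in> ?I" for t
    using Mq(2)[OF that] Mp(2)[OF that] Mq(1) Mp(1) unfolding R_def by linarith+
  obtain K where K: "K > 0"
    "\<And>u v. norm u \<le> R \<Longrightarrow> norm v \<le> R \<Longrightarrow> norm (grad f u - grad f v) \<le> K * norm (u - v)"
    "\<And>u v. norm u \<le> R \<Longrightarrow> norm v \<le> R \<Longrightarrow> norm (grad T u - grad T v) \<le> K * norm (u - v)"
    "\<And>u v w. norm u \<le> R \<Longrightarrow> norm v \<le> R \<Longrightarrow> norm (N u *v w - N v *v w) \<le> K * norm (u - v) * norm w"
    "\<And>u w. norm u \<le> R \<Longrightarrow> norm (N u *v w) \<le> K * norm w"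
    by (rule data_lipschitz[of R]) blast
  have "continuous_on ?I (\<lambda>t. grad T (p t))"
    by (rule continuous_on_compose2[OF C1_imp_continuous[OF C1_grad_T, of UNIV] cp]) simp
  then obtain M1 where M1: "M1 > 0" "\<And>t. t \<in> ?I \<Longrightarrow> norm (grad T (p t)) \<le> M1"
    by (rule bounded_continuous_image) blast
  have "continuous_on ?I (\<lambda>t. grad f (q t))"
    by (rule continuous_on_compose2[OF C1_imp_continuous[OF C1_grad_f, of UNIV] cq]) simp
  then obtain M2 where M2: "M2 > 0" "\<And>t. t \<in> ?I \<Longrightarrow> norm (grad f (q t)) \<le> M2"
    by (rule bounded_continuous_image) blast
  define M where "M = M1 + M2 + K * Ml + \<gamma> * Mp + Ml"
  have M: "M > 0" "M1 \<le> M" "M2 + K * Ml + \<gamma> * Mp \<le> M" "Ml \<le> M"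
    using M1(1) M2(1) Ml(1) mult_pos_pos[OF K(1) Ml(1)] mult_pos_pos[OF \<gamma> Mp(1)] unfolding M_def by linarith+
  define C where "C = M + K * M + (K * M + K * M * M + \<gamma> * M)"
  have C: "M \<le> C" "K * M \<le> C" "K * M + K * M * M + \<gamma> * M \<le> C" "C > 0"
    using M(1) mult_pos_pos[OF K(1) M(1)] mult_pos_pos[OF mult_pos_pos[OF K(1) M(1)] M(1)] mult_pos_pos[OF \<gamma> M(1)]
    unfolding C_def by linarith+
  have dp: "norm (- grad f (q t) - N (q t) *v l t - \<gamma> *\<^sub>R p t) \<le> M" if t: "t \<in> ?I" for t
  proof -
    have "norm (N (q t) *v l t) \<le> K * Ml"
      using K(1) Ml(2)[OF t] by (intro order_trans[OF K(5)[OF Rq[OF t]]] mult_left_mono) auto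
    moreover have "norm (\<gamma> *\<^sub>R p t) \<le> \<gamma> * Mp"
      using \<gamma> Mp(2)[OF t] by simp
    moreover have "norm (- grad f (q t) - N (q t) *v l t - \<gamma> *\<^sub>R p t)
        \<le> norm (grad f (q t)) + norm (N (q t) *v l t) + norm (\<gamma> *\<^sub>R p t)"
      using norm_triangle_ineq4[of "- grad f (q t) - N (q t) *v l t" "\<gamma> *\<^sub>R p t"]
        norm_triangle_ineq4[of "- grad f (q t)" "N (q t) *v l t"] by simp
    ultimately show ?thesis using M2(2)[OF t] M(3) by linarith
  qed
  define \<Lambda> where "\<Lambda> = (\<lambda>t. integral {0..t} l)"
  have \<Lambda>: "(\<Lambda> has_vector_derivative l t) (at t within ?I)" if "t \<in> ?I" for t
    unfolding \<Lambda>_def by (rule integral_has_vector_derivative[OF cl that])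
  have sub: "(F has_vector_derivative D) (at s within {a..b})"
    if "(F has_vector_derivative D) (at s within ?I)" "{a..b} \<subseteq> ?I" for F :: "real \<Rightarrow> 'z::real_normed_vector" and D s a b
    using that by (rule has_vector_derivative_within_subset)
  show thesis
  proof (rule that[OF C(4) cx])
    show "x t \<in> S" if "t \<in> ?I" for t using S[OF that] by (simp add: x)
    fix t h assume t: "0 \<le> t" and h: "0 < h" and th: "t + h \<le> t\<^sub>1"
    have tI: "{t..t + h} \<subseteq> ?I" using t th by auto
    have tt: "t \<in> ?I" "t + h \<in> ?I" using t h th by auto
    have incr: "norm (F s - F r) \<le> M * h"
      if F: "\<And>t. t \<in> ?I \<Longrightarrow> (F has_vector_derivative F' t) (at t within ?I)" "\<And>t. t \<in> ?I \<Longrightarrow> norm (F' t) \<le> M"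
        and rs: "t \<le> r" "r \<le> s" "s \<le> t + h" for F :: "real \<Rightarrow> 'z::real_normed_vector" and F' r s
    proof -
      have rsI: "{r..s} \<subseteq> ?I" using rs tI by auto
      have "norm (F s - F r - (s - r) *\<^sub>R 0) \<le> M * (s - r)"
      proof (rule vector_derivative_increment_bound)
        fix u assume "u \<in> {r..s}"
        then have "u \<in> ?I" using rsI by blast
        then show "(F has_vector_derivative F' u) (at u within {r..s})" "norm (F' u - 0) \<le> M"
          using sub[OF F(1) rsI] F(2) by simp_all
      qed (use rs in simp)
      also have "\<dots> \<le> M * h" using rs M(1) by (intro mult_left_mono) auto
      finally show ?thesis by simp
    qed
    have iq: "norm (q s - q r) \<le> M * h" if "t \<le> r" "r \<le> s" "s \<le> t + h" for r s
      by (rule incr[of q "\<lambda>t. grad T (p t)", OF q _ that]) (auto intro: order_trans[OF M1(2) M(2)])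
    have ip: "norm (p s - p r) \<le> M * h" if "t \<le> r" "r \<le> s" "s \<le> t + h" for r s
      by (rule incr[of p "\<lambda>t. - grad f (q t) - N (q t) *v l t - \<gamma> *\<^sub>R p t", OF p dp that])
    have il: "norm (\<Lambda> (t + h) - \<Lambda> t) \<le> M * h"
      by (rule incr[of \<Lambda> l, OF \<Lambda>]) (use h in \<open>auto intro: order_trans[OF Ml(2) M(4)]\<close>)
    have MC: "M * h \<le> C * h" using C(1) h by simp
    have q2: "norm (q (t + h) - q t - h *\<^sub>R grad T (p t)) \<le> C * h^2"
    proof -
      have "norm (q (t + h) - q t - (t + h - t) *\<^sub>R grad T (p t)) \<le> (K * (M * h)) * (t + h - t)"
      proof (rule vector_derivative_increment_bound)
        fix s assume s: "s \<in> {t..t + h}"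
        then have sI: "s \<in> ?I" using tI by blast
        show "(q has_vector_derivative grad T (p s)) (at s within {t..t + h})" by (rule sub[OF q[OF sI] tI])
        show "norm (grad T (p s) - grad T (p t)) \<le> K * (M * h)"
          using K(1) s by (intro order_trans[OF K(3)[OF Rp[OF sI] Rp[OF tt(1)]]] mult_left_mono ip) auto
      qed (use h in simp)
      also have "\<dots> = (K * M) * h^2" by (simp add: power2_eq_square)
      also have "\<dots> \<le> C * h^2" using C(2) by (intro mult_right_mono) auto
      finally show ?thesis by simp
    qed
    define w where "w = - (\<Lambda> (t + h) - \<Lambda> t)"
    have w: "norm w \<le> C * h" unfolding w_def norm_minus_cancel using il MC by linarith
    have p2: "norm (p (t + h) - p t + h *\<^sub>R (grad f (q t) + \<gamma> *\<^sub>R p t) - N (q (t + h)) *v w) \<le> C * h^2"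
    proof -
      let ?A = "N (q (t + h))" and ?v = "- grad f (q t) - \<gamma> *\<^sub>R p t"
      have "norm ((p (t + h) + ?A *v \<Lambda> (t + h)) - (p t + ?A *v \<Lambda> t) - (t + h - t) *\<^sub>R ?v)
          \<le> (K * (M * h) + K * (M * h) * M + \<gamma> * (M * h)) * (t + h - t)"
      proof (rule vector_derivative_increment_bound)
        fix s assume s: "s \<in> {t..t + h}"
        then have sI: "s \<in> ?I" using tI by blast
        let ?d = "- grad f (q s) - N (q s) *v l s - \<gamma> *\<^sub>R p s + ?A *v l s"
        show "((\<lambda>s. p s + ?A *v \<Lambda> s) has_vector_derivative ?d) (at s within {t..t + h})"
          by (intro has_vector_derivative_add sub[OF p[OF sI] tI]
              bounded_linear.has_vector_derivative[OF matrix_vector_mul_bounded_linear] sub[OF \<Lambda>[OF sI] tI])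
        have tri: "norm (- x - y - z) \<le> norm x + norm y + norm z" for x y z :: "real^'n"
          using norm_triangle_ineq4[of "- x - y" z] norm_triangle_ineq4[of "- x" y] by simp
        have d: "?d - ?v = - (grad f (q s) - grad f (q t)) - (N (q s) *v l s - ?A *v l s) - \<gamma> *\<^sub>R (p s - p t)"
          by (simp add: scaleR_diff_right)
        have "norm (?d - ?v) \<le> norm (grad f (q s) - grad f (q t)) + norm (N (q s) *v l s - ?A *v l s)
            + norm (\<gamma> *\<^sub>R (p s - p t))"
          unfolding d by (rule tri)
        also have "\<dots> \<le> K * (M * h) + K * (M * h) * M + \<gamma> * (M * h)"
        proof (intro add_mono)
          show "norm (grad f (q s) - grad f (q t)) \<le> K * (M * h)"
            using K(1) s by (intro order_trans[OF K(2)[OF Rq[OF sI] Rq[OF tt(1)]]] mult_left_mono iq) auto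
          have "norm (q s - q (t + h)) \<le> M * h" using iq[of s "t + h"] s by (simp add: norm_minus_commute)
          then show "norm (N (q s) *v l s - ?A *v l s) \<le> K * (M * h) * M"
            using K(1) M h Ml(2)[OF sI]
            by (intro order_trans[OF K(4)[OF Rq[OF sI] Rq[OF tt(2)]]] mult_mono mult_left_mono) auto
          show "norm (\<gamma> *\<^sub>R (p s - p t)) \<le> \<gamma> * (M * h)"
            using \<gamma> ip[of t s] s by simp
        qed
        finally show "norm (?d - ?v) \<le> K * (M * h) + K * (M * h) * M + \<gamma> * (M * h)" .
      qed (use h in simp)
      also have "\<dots> = (K * M + K * M * M + \<gamma> * M) * h^2"
        by (simp add: algebra_simps power2_eq_square)
      also have "\<dots> \<le> C * h^2" using C(3) by (intro mult_right_mono) auto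
      also have "(p (t + h) + ?A *v \<Lambda> (t + h)) - (p t + ?A *v \<Lambda> t) - (t + h - t) *\<^sub>R ?v
          = p (t + h) - p t + h *\<^sub>R (grad f (q t) + \<gamma> *\<^sub>R p t) - ?A *v w"
        unfolding w_def by (simp add: linear_neg[OF matrix_vector_mul_linear] linear_diff[OF matrix_vector_mul_linear]
            scaleR_add_right scaleR_diff_right)
      finally show ?thesis .
    qed
    have le: "t \<le> t + h" using h by simp
    have "norm (q (t + h) - q t) \<le> C * h" "norm (p (t + h) - p t) \<le> C * h"
      by (rule order_trans[OF iq[OF order_refl le order_refl] MC],
          rule order_trans[OF ip[OF order_refl le order_refl] MC])
    with q2 p2 w show "consistent C h (x t) (x (t + h))"
      unfolding consistent_def x prod.case by blast
  qed
qed

section \<open>Convergence\<close>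

text \<open>Measuring momentum errors modulo the range of \<open>G(q)\<^sup>T\<close> leaves \<open>\<nu>\<close> undetermined. The hidden constraint at
both states restores control over it.\<close>
definition multiplier_bound ::
    "(real^'n) \<times> (real^'n) \<Rightarrow> real \<Rightarrow> bool" where
  "multiplier_bound = (\<lambda>(q, p) r. \<forall>q' p' \<nu>. (q', p') \<in> S \<longrightarrow> dist (q', p') (q, p) < r
     \<longrightarrow> norm (p' - p - N q *v \<nu>) < r
     \<longrightarrow> norm \<nu> \<le> (norm (q' - q) + norm (p' - p - N q *v \<nu>)) / r)"

text \<open>\<open>G(q') \<nabla>T(p + e + G(q)\<^sup>T \<nu>)\<close> vanishes for both states by the hidden constraint, with
\<open>(q', e, \<nu>)\<close> and with \<open>(q, 0, 0)\<close>, and its derivative in \<open>\<nu>\<close> is \<open>G H\<^sub>p\<^sub>p G\<^sup>T\<close>. So \<open>implicit_lower_bound\<close>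
applies, once \<open>\<nu>\<close> is known to be small.\<close>
lemma multiplier_bound_local:
  assumes x0: "x0 \<in> S"
  shows "\<exists>r>0. \<forall>x\<in>S \<inter> ball x0 r. multiplier_bound x r"
proof -
  obtain q0 p0 where x0_eq: "x0 = (q0, p0)" by (cases x0)
  have S0: "(q0, p0) \<in> S" using x0 by (simp add: x0_eq)
  define F :: "((((real^'n) \<times> (real^'n)) \<times> (real^'n) \<times> (real^'n)) \<times> (real^'m)) \<Rightarrow> real^'m" where
    "F = (\<lambda>z. J (fst (snd (fst z))) *v grad T (snd (fst (fst z)) + snd (snd (fst z)) + N (fst (fst (fst z))) *v snd z))"
  have F: "C1 F" unfolding F_def by (intro C1_intros C1_data)
  have Fv: "F (((q, p), (q', e)), v) = J q' *v grad T (p + e + N q *v v)" for q p q' e v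
    by (simp add: F_def)
  let ?a0 = "((q0, p0), (q0, 0))"
  have d: "((\<lambda>v. F (?a0, v)) has_derivative (\<lambda>v. J q0 *v (hess T p0 *v (N q0 *v v)))) (at 0)"
  proof -
    have "((\<lambda>v. p0 + 0 + N q0 *v v) has_derivative (\<lambda>v. 0 + N q0 *v v)) (at 0)"
      by (intro has_derivative_add has_derivative_const bounded_linear_imp_has_derivative matrix_vector_mul_bounded_linear)
    then have "((\<lambda>v. p0 + 0 + N q0 *v v) has_derivative (\<lambda>v. N q0 *v v)) (at 0)" by simp
    from has_derivative_compose[OF this grad_T_derivative]
    have "((\<lambda>v. grad T (p0 + 0 + N q0 *v v)) has_derivative (\<lambda>v. hess T p0 *v (N q0 *v v))) (at 0)" by simp
    from bounded_linear.has_derivative[OF matrix_vector_mul_bounded_linear this]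
    show ?thesis unfolding Fv .
  qed
  obtain r1 C where r1: "r1 > 0" "C > 0" and lb: "\<And>a a' b b'. a \<in> ball ?a0 r1 \<Longrightarrow> a' \<in> ball ?a0 r1 \<Longrightarrow>
      b \<in> ball 0 r1 \<Longrightarrow> b' \<in> ball 0 r1 \<Longrightarrow> norm (b - b') \<le> C * (norm (a - a') + norm (F (a, b) - F (a', b')))"
    by (rule implicit_lower_bound[OF F d schur_injective[OF S0]]; blast)
  obtain r2 c where r2: "r2 > 0" "c > 0" "\<And>q v. dist q q0 < r2 \<Longrightarrow> norm v \<le> c * norm (N q *v v)"
    by (rule transpose_bounded_below[OF S0]) blast
  define r where "r = min (min (r1 / 5) r2) (min (r1 / (3 * c)) (1 / C))"
  have r: "r > 0" "5 * r \<le> r1" "r \<le> r2" "c * (2 * r) < r1" "C \<le> 1 / r"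
  proof -
    show r0: "r > 0" unfolding r_def using r1 r2 by simp
    have "r \<le> r1 / 5" "r \<le> r1 / (3 * c)" "r \<le> 1 / C" unfolding r_def by auto
    then show "5 * r \<le> r1" "C \<le> 1 / r" using r0 r1 by (simp_all add: field_simps)
    have "3 * (c * r) \<le> r1" using \<open>r \<le> r1 / (3 * c)\<close> r2 by (simp add: field_simps)
    then show "c * (2 * r) < r1" using mult_pos_pos[OF r2(2) r0] by linarith
  qed (simp add: r_def)
  show ?thesis
  proof (rule exI[of _ r], rule conjI[OF r(1)], rule ballI)
    fix x assume x: "x \<in> S \<inter> ball x0 r"
    obtain q p where x_eq: "x = (q, p)" by (cases x)
    have dx: "dist (q, p) (q0, p0) < r" and xS: "(q, p) \<in> S"
      using x by (simp_all add: x_eq x0_eq dist_commute)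
    show "multiplier_bound x r"
      unfolding multiplier_bound_def x_eq prod.case
    proof (intro allI impI)
      fix q' p' \<nu> assume y: "(q', p') \<in> S" "dist (q', p') (q, p) < r" and e: "norm (p' - p - N q *v \<nu>) < r"
      let ?e = "p' - p - N q *v \<nu>"
      have dq: "dist q q0 < r" using dx dist_fst_le[of "(q, p)" "(q0, p0)"] by simp
      have dqq: "dist q' q < r" "norm (p' - p) < r"
        using y(2) dist_fst_le[of "(q', p')" "(q, p)"] dist_snd_le[of "(q', p')" "(q, p)"] by (simp_all add: dist_norm)
      have "norm (N q *v \<nu>) = norm ((p' - p) - ?e)" by simp
      also have "\<dots> \<le> norm (p' - p) + norm ?e" by (rule norm_triangle_ineq4)
      also have "\<dots> \<le> 2 * r" using e dqq by simp
      finally have "c * norm (N q *v \<nu>) \<le> c * (2 * r)" using r2(2) by (intro mult_left_mono) auto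
      then have \<nu>: "\<nu> \<in> ball 0 r1" using r2(3)[of q \<nu>] dq r by simp
      have dq'0: "dist q' q0 < 2 * r" using dqq dq dist_triangle[of q' q0 q] by simp
      have near: "((q, p), (y, z)) \<in> ball ?a0 r1" if "dist y q0 < 2 * r" "norm z < r" for y z
      proof -
        have "dist ?a0 ((q, p), (y, z)) \<le> dist (q0, p0) (q, p) + dist (q0, 0) (y, z)" by (rule dist_Pair_le)
        also have "\<dots> \<le> dist (q0, p0) (q, p) + (dist q0 y + dist 0 z)" by (intro add_left_mono dist_Pair_le)
        also have "\<dots> < r1" using that dx r by (simp add: dist_commute)
        finally show ?thesis by simp
      qed
      have "norm (\<nu> - 0) \<le> C * (norm (((q, p), (q', ?e)) - ((q, p), (q, 0)))
          + norm (F (((q, p), (q', ?e)), \<nu>) - F (((q, p), (q, 0)), 0)))"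
        using r r1 dq by (intro lb near \<nu> dq'0 e) auto
      also have "F (((q, p), (q', ?e)), \<nu>) = 0" using y(1) unfolding Fv by (simp add: S_iff)
      also have "F (((q, p), (q, 0)), 0) = 0" using xS unfolding Fv by (simp add: S_iff)
      finally have "norm \<nu> \<le> C * norm (q' - q, ?e)" by (simp add: norm_Pair)
      also have "\<dots> \<le> C * (norm (q' - q) + norm ?e)"
        using r1 norm_Pair_le by (intro mult_left_mono) auto
      also have "\<dots> \<le> (1 / r) * (norm (q' - q) + norm ?e)"
        using r(5) by (intro mult_right_mono) auto
      finally show "norm \<nu> \<le> (norm (q' - q) + norm ?e) / r" by simp
    qed
  qed
qed

lemma multiplier_bound_antimono:
  assumes r: "0 < r" "r \<le> r'" and "multiplier_bound x r'"
  shows "multiplier_bound x r"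
proof -
  obtain q p where x: "x = (q, p)" by (cases x)
  show ?thesis
    unfolding multiplier_bound_def x prod.case
  proof (intro allI impI)
    fix q' p' \<nu> assume a: "(q', p') \<in> S" "dist (q', p') (q, p) < r" "norm (p' - p - N q *v \<nu>) < r"
    have "norm \<nu> \<le> (norm (q' - q) + norm (p' - p - N q *v \<nu>)) / r'"
      using assms(3) a r(2) unfolding multiplier_bound_def x prod.case by (meson less_le_trans)
    also have "\<dots> \<le> (norm (q' - q) + norm (p' - p - N q *v \<nu>)) / r"
      using r by (intro divide_left_mono) auto
    finally show "norm \<nu> \<le> (norm (q' - q) + norm (p' - p - N q *v \<nu>)) / r" .
  qed
qed

text \<open>One parameter serves as radius, step size bound and reciprocal constant, so that the property
is monotone in it and \<open>uniform_on_compact\<close> applies.\<close>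
definition uniform_step ::
    "((real^'n) \<times> (real^'n) \<Rightarrow> real) \<Rightarrow> ((real^'n) \<times> (real^'n) \<Rightarrow> real) \<Rightarrow> (real^'n) \<times> (real^'n) \<Rightarrow> real \<Rightarrow> bool" where
  "uniform_step \<rho> h\<^sub>0 x r \<longleftrightarrow> (\<forall>y\<in>S. dist y x < r \<longrightarrow> (\<forall>h. 0 < h \<and> h < r \<longrightarrow>
     h < h\<^sub>0 y \<and> consistent (1 / r) h y (scheme_map T f g \<gamma> \<rho> h y)))"

lemma uniform_stepD:
  assumes "uniform_step \<rho> h\<^sub>0 x r" "y \<in> S" "dist y x < r" "0 < h" "h < r"
  shows "h < h\<^sub>0 y" "consistent (1 / r) h y (scheme_map T f g \<gamma> \<rho> h y)"
  using assms unfolding uniform_step_def by blast+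

lemma uniform_step_antimono:
  assumes "0 < r" "r \<le> r'" "uniform_step \<rho> h\<^sub>0 x r'"
  shows "uniform_step \<rho> h\<^sub>0 x r"
  unfolding uniform_step_def
proof (intro ballI impI allI, elim conjE)
  fix y h assume y: "y \<in> S" "dist y x < r" "0 < h" "h < r"
  then have y': "dist y x < r'" "h < r'" using assms(2) by linarith+
  note u = uniform_stepD[OF assms(3) y(1) y'(1) y(3) y'(2)]
  have "1 / r' \<le> 1 / r" using assms by (simp add: frac_le)
  then show "h < h\<^sub>0 y \<and> consistent (1 / r) h y (scheme_map T f g \<gamma> \<rho> h y)"
    using u(1) consistent_mono[OF u(2), of "1 / r"] y(3) by simp
qed

lemma uniform_step_local:
  assumes uni: "\<And>x h. x \<in> S \<Longrightarrow> 0 < h \<Longrightarrow> h < h\<^sub>0 x \<Longrightarrow> \<exists>!s. scheme T f g \<gamma> h x s \<and> near_step (\<rho> x) x s"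
    and loc: "\<exists>r>0. \<exists>C>0. \<forall>y\<in>S. dist y x < r \<longrightarrow> (\<forall>h. 0 < h \<and> h < r \<longrightarrow>
       h < h\<^sub>0 y \<and> step_bound C h y (the_step \<rho> h y))"
  shows "\<exists>r>0. \<forall>z\<in>S \<inter> ball x r. uniform_step \<rho> h\<^sub>0 z r"
proof -
  obtain r C where r: "r > 0" "C > 0" and sb: "\<And>y h. y \<in> S \<Longrightarrow> dist y x < r \<Longrightarrow> 0 < h \<Longrightarrow> h < r \<Longrightarrow>
      h < h\<^sub>0 y \<and> step_bound C h y (the_step \<rho> h y)"
    using loc by blast
  obtain D where D: "\<And>y h a l q' \<mu> p'. norm y \<le> norm x + r \<Longrightarrow> 0 < h \<Longrightarrow> h \<le> 1 \<Longrightarrow>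
    scheme T f g \<gamma> h y (a, l, q', \<mu>, p') \<Longrightarrow> step_bound C h y (a, l, q', \<mu>, p') \<Longrightarrow> consistent D h y (q', p')"
    by (rule step_consistent[OF r(2), of "norm x + r"]) blast
  define r' where "r' = min (r / 2) (min 1 (1 / (\<bar>D\<bar> + 1)))"
  have r': "r' > 0" "r' \<le> r / 2" "r' \<le> 1" "D \<le> 1 / r'"
  proof -
    show r0: "r' > 0" unfolding r'_def using r by simp
    have "r' \<le> 1 / (\<bar>D\<bar> + 1)" unfolding r'_def by simp
    then have "\<bar>D\<bar> + 1 \<le> 1 / r'" using r0 by (simp add: field_simps)
    then show "D \<le> 1 / r'" by linarith
    show "r' \<le> 1" unfolding r'_def by (meson min.cobounded1 min.cobounded2 order_trans)
  qed (simp add: r'_def)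
  show ?thesis
  proof (rule exI[of _ r'], rule conjI[OF r'(1)], rule ballI)
    fix z assume z: "z \<in> S \<inter> ball x r'"
    show "uniform_step \<rho> h\<^sub>0 z r'"
      unfolding uniform_step_def
    proof (intro ballI impI allI, elim conjE)
      fix y h assume y: "y \<in> S" "dist y z < r'" and h: "0 < h" "h < r'"
      have yx: "dist y x < r" using dist_triangle[of y x z] y(2) z r' by (simp add: dist_commute)
      have hr: "h < r" "h \<le> 1" using h r' r by linarith+
      obtain a l q' \<mu> p' where s: "the_step \<rho> h y = (a, l, q', \<mu>, p')" by (cases "the_step \<rho> h y")
      have 1: "h < h\<^sub>0 y" and 2: "step_bound C h y (a, l, q', \<mu>, p')"
        using sb[OF y(1) yx h(1) hr(1)] by (simp_all add: s)
      have 3: "scheme T f g \<gamma> h y (a, l, q', \<mu>, p')"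
        using the_step_unique[of h y \<rho>, OF uni[OF y(1) h(1) 1]] by (simp add: s)
      have "norm y \<le> norm x + r" using norm_triangle_sub[of y x] yx by (simp add: dist_norm)
      from D[OF this h(1) hr(2) 3 2] have "consistent (1 / r') h y (q', p')"
        using consistent_mono r'(4) h(1) by (meson less_imp_le)
      then show "h < h\<^sub>0 y \<and> consistent (1 / r') h y (scheme_map T f g \<gamma> \<rho> h y)"
        using 1 by (simp add: scheme_map_eq s)
    qed
  qed
qed

text \<open>Along the compact exact trajectory all local constants can be taken uniform. The error modulo
constraint forces satisfies \<open>e\<^sub>k\<^sub>+\<^sub>1 \<le> e\<^sub>k + D h (e\<^sub>k + h)\<close>, which gives \<open>e\<^sub>k = O(h)\<close>. At every step the
full momentum error and \<open>\<nu>\<close> are recovered from it through \<open>multiplier_bound\<close>; this requires the states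
to be close beforehand, which holds because a single step and the exact solution move by \<open>O(h)\<close> only.
The same closeness keeps the iterates in the domain of the scheme.\<close>
lemma scheme_map_convergent:
  assumes pos: "\<And>x. x \<in> S \<Longrightarrow> h\<^sub>0 x > 0"
    and uni: "\<And>x h. x \<in> S \<Longrightarrow> 0 < h \<Longrightarrow> h < h\<^sub>0 x \<Longrightarrow> \<exists>!s. scheme T f g \<gamma> h x s \<and> near_step (\<rho> x) x s"
    and loc: "\<And>x. x \<in> S \<Longrightarrow> \<exists>r>0. \<forall>z\<in>S \<inter> ball x r. uniform_step \<rho> h\<^sub>0 z r"
  shows "convergent_of_order 1 S (exact_solution T f g \<gamma>) (\<lambda>h. {x \<in> S. h < h\<^sub>0 x}) (scheme_map T f g \<gamma> \<rho>)"
  unfolding convergent_of_order_def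
proof (intro allI impI, elim conjE)
  fix t\<^sub>1 :: real and x
  assume t1: "0 \<le> t\<^sub>1" and x0: "x 0 \<in> S" and sol: "exact_solution T f g \<gamma> t\<^sub>1 x"
  let ?\<Phi> = "scheme_map T f g \<gamma> \<rho>"
  show "\<exists>C. \<exists>h\<^sub>1>0. \<forall>h. 0 < h \<and> h < h\<^sub>1 \<longrightarrow> (\<forall>k::nat. real k * h \<le> t\<^sub>1 \<longrightarrow>
        (?\<Phi> h ^^ k) (x 0) \<in> {x \<in> S. h < h\<^sub>0 x}
      \<and> norm ((?\<Phi> h ^^ k) (x 0) - x (real k * h)) \<le> C * h ^ 1)"
  \<comment> \<open>On the interval \<open>{0..0}\<close> one-sided derivatives carry no information; only \<open>k = 0\<close> occurs there.\<close>
  proof (cases "t\<^sub>1 = 0")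
    case True
    show ?thesis
    proof (rule exI[of _ 0], rule exI[of _ "h\<^sub>0 (x 0)"], intro conjI allI impI)
      show "h\<^sub>0 (x 0) > 0" by (rule pos[OF x0])
      fix h and k :: nat assume h: "0 < h \<and> h < h\<^sub>0 (x 0)" and k: "real k * h \<le> t\<^sub>1"
      have "k = 0"
      proof (rule ccontr)
        assume "k \<noteq> 0"
        then have "real k * h > 0" using h by simp
        with k True show False by simp
      qed
      then show "(?\<Phi> h ^^ k) (x 0) \<in> {x \<in> S. h < h\<^sub>0 x}"
        "norm ((?\<Phi> h ^^ k) (x 0) - x (real k * h)) \<le> 0 * h ^ 1"
        using x0 h by simp_all
    qed
  next
    case False
    with t1 have t1: "t\<^sub>1 > 0" by simp
    obtain C\<^sub>x where Cx: "C\<^sub>x > 0" and cont: "continuous_on {0..t\<^sub>1} x" and xS: "\<And>t. t \<in> {0..t\<^sub>1} \<Longrightarrow> x t \<in> S"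
      and ex: "\<And>t h. 0 \<le> t \<Longrightarrow> 0 < h \<Longrightarrow> t + h \<le> t\<^sub>1 \<Longrightarrow> consistent C\<^sub>x h (x t) (x (t + h))"
      by (rule exact_solution_consistent[OF t1 sol]) blast
    have K: "compact (x ` {0..t\<^sub>1})" "x ` {0..t\<^sub>1} \<subseteq> S"
      using compact_continuous_image[OF cont compact_Icc] xS by auto
    obtain r1 where r1: "r1 > 0" "\<And>y. y \<in> x ` {0..t\<^sub>1} \<Longrightarrow> uniform_step \<rho> h\<^sub>0 y r1"
      by (rule uniform_on_compact[of S "uniform_step \<rho> h\<^sub>0", OF _ loc K]) (blast intro: uniform_step_antimono)+
    obtain r2 where r2: "r2 > 0" "\<And>y. y \<in> x ` {0..t\<^sub>1} \<Longrightarrow> multiplier_bound y r2"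
      by (rule uniform_on_compact[of S multiplier_bound, OF _ multiplier_bound_local K]) (blast intro: multiplier_bound_antimono)+
    obtain B where B: "B > 0" "\<And>t. t \<in> {0..t\<^sub>1} \<Longrightarrow> norm (x t) \<le> B"
      by (rule bounded_continuous_image[OF cont]) blast
    define C where "C = max C\<^sub>x (1 / r1)"
    have C: "C > 0" "C\<^sub>x \<le> C" "1 / r1 \<le> C" unfolding C_def using Cx by auto
    define R where "R = B + r1"
    obtain K where K: "K > 0" "\<And>u w. norm u \<le> R \<Longrightarrow> norm (N u *v w) \<le> K * norm w"
      by (rule data_lipschitz[of R]) blast
    \<comment> \<open>The factor by which \<open>multiplier_bound\<close> bounds the full momentum error and \<open>\<nu>\<close>.\<close>
    define c where "c = 1 + 2 / r2 + K * (2 / r2)"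
    have c: "c > 0" "2 / r2 \<le> c" "1 + K * (2 / r2) \<le> c"
      unfolding c_def using r2(1) K(1) by (simp_all add: add_pos_pos)
    obtain D where D: "D > 0" and step_error:
      "\<And>h e q p q' p' q\<^sub>1 p\<^sub>1 q\<^sub>1' p\<^sub>1' \<nu>. 0 < h \<Longrightarrow> h \<le> 1 \<Longrightarrow> norm (q, p) \<le> R \<Longrightarrow> norm (q', p') \<le> R \<Longrightarrow>
        consistent C h (q, p) (q\<^sub>1, p\<^sub>1) \<Longrightarrow> consistent C h (q', p') (q\<^sub>1', p\<^sub>1') \<Longrightarrow>
        norm (q' - q) \<le> e \<Longrightarrow> norm (p' - p - N q *v \<nu>) \<le> e \<Longrightarrow> norm (p' - p) \<le> c * e \<Longrightarrow> norm \<nu> \<le> c * e \<Longrightarrow>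
        \<exists>\<nu>'. norm (q\<^sub>1' - q\<^sub>1) \<le> e + D * h * (e + h) \<and> norm (p\<^sub>1' - p\<^sub>1 - N q\<^sub>1 *v \<nu>') \<le> e + D * h * (e + h)"
      by (rule error_propagation[OF C(1) c(1), of R]) blast
    define r where "r = min r1 r2"
    define \<Gamma> where "\<Gamma> = exp (D * t\<^sub>1)"
    have r: "r > 0" "r \<le> r1" "r \<le> r2" using r1 r2 by (auto simp: r_def)
    have \<Gamma>: "\<Gamma> > 0" by (simp add: \<Gamma>_def)
    define M where "M = (1 + c) * \<Gamma> + 4 * C"
    have M: "M > 0" "(1 + c) * \<Gamma> \<le> M" unfolding M_def using c(1) \<Gamma> C(1) by (simp_all add: add_pos_pos)
    \<comment> \<open>\<open>M h\<close> bounds the distance of the numerical from the exact state after one further step,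
        before the improved estimate is available.\<close>
    define h\<^sub>1 where "h\<^sub>1 = min (min 1 r) (r / M)"
    have h1: "h\<^sub>1 > 0" "h\<^sub>1 \<le> 1" "h\<^sub>1 \<le> r" "M * h\<^sub>1 \<le> r"
    proof -
      show "h\<^sub>1 > 0" unfolding h\<^sub>1_def using r M by simp
      have "h\<^sub>1 \<le> r / M" unfolding h\<^sub>1_def by simp
      then show "M * h\<^sub>1 \<le> r" using M by (simp add: field_simps)
    qed (simp_all add: h\<^sub>1_def)
    show ?thesis
    proof (rule exI[of _ "(1 + c) * \<Gamma>"], rule exI[of _ h\<^sub>1], intro conjI[OF h1(1)] allI impI)
      fix h and k :: nat
      assume h: "0 < h \<and> h < h\<^sub>1" and k: "real k * h \<le> t\<^sub>1"
      have h: "0 < h" "h < h\<^sub>1" "h \<le> 1" "h < r1" using h h1 r by auto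
      have Mh: "M * h < r" using h h1(4) M(1) mult_strict_left_mono[OF h(2) M(1)] by linarith
      \<comment> \<open>The solution of the error recursion with equality and \<open>E 0 = 0\<close>.\<close>
      define E where "E = (\<lambda>k::nat. h * ((1 + D * h) ^ k - 1))"
      have E_Suc: "E (Suc k) = E k + D * h * (E k + h)" for k
        by (simp add: E_def algebra_simps)
      have E0: "0 \<le> E k" for k
        unfolding E_def using h D by (simp add: one_le_power)
      have E\<Gamma>: "E k \<le> \<Gamma> * h" if "real k * h \<le> t\<^sub>1" for k
      proof -
        have "(1 + D * h) ^ k \<le> exp (D * h) ^ k"
          using h D by (intro power_mono exp_ge_add_one_self) simp
        also have "\<dots> = exp (D * (real k * h))" by (simp add: exp_of_nat_mult[symmetric] mult_ac)
        also have "\<dots> \<le> \<Gamma>" unfolding \<Gamma>_def using that D by simp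
        finally have "(1 + D * h) ^ k - 1 \<le> \<Gamma>" by simp
        then show ?thesis unfolding E_def using mult_left_mono[of _ \<Gamma> h] h by (simp add: mult.commute)
      qed
      define Q where "Q = (\<lambda>t. fst (x t))"
      define P where "P = (\<lambda>t. snd (x t))"
      have xt: "x t = (Q t, P t)" for t by (simp add: Q_def P_def)
      have inv: "(?\<Phi> h ^^ k) (x 0) \<in> S \<and> (\<exists>\<nu>. norm (fst ((?\<Phi> h ^^ k) (x 0)) - Q (real k * h)) \<le> E k
          \<and> norm (snd ((?\<Phi> h ^^ k) (x 0)) - P (real k * h) - N (Q (real k * h)) *v \<nu>) \<le> E k
          \<and> norm (snd ((?\<Phi> h ^^ k) (x 0)) - P (real k * h)) \<le> c * E k \<and> norm \<nu> \<le> c * E k)"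
        and close: "norm ((?\<Phi> h ^^ k) (x 0) - x (real k * h)) \<le> (1 + c) * \<Gamma> * h"
        if "real k * h \<le> t\<^sub>1" for k
      proof -
        have close: "norm (y - x (real k * h)) \<le> (1 + c) * \<Gamma> * h"
          if "norm (fst y - Q (real k * h)) \<le> E k" "norm (snd y - P (real k * h)) \<le> c * E k" "real k * h \<le> t\<^sub>1"
          for y and k :: nat
        proof -
          have "norm (y - x (real k * h)) \<le> norm (fst y - Q (real k * h)) + norm (snd y - P (real k * h))"
            using norm_Pair_le[of "fst y - Q (real k * h)" "snd y - P (real k * h)"]
            by (cases y) (simp add: xt)
          also have "\<dots> \<le> (1 + c) * E k" using that by (simp add: algebra_simps)
          also have "\<dots> \<le> (1 + c) * (\<Gamma> * h)" using c(1) E\<Gamma>[OF that(3)] by (intro mult_left_mono) auto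
          finally show ?thesis by (simp add: mult.assoc)
        qed
        show inv: "(?\<Phi> h ^^ k) (x 0) \<in> S \<and> (\<exists>\<nu>. norm (fst ((?\<Phi> h ^^ k) (x 0)) - Q (real k * h)) \<le> E k
          \<and> norm (snd ((?\<Phi> h ^^ k) (x 0)) - P (real k * h) - N (Q (real k * h)) *v \<nu>) \<le> E k
          \<and> norm (snd ((?\<Phi> h ^^ k) (x 0)) - P (real k * h)) \<le> c * E k \<and> norm \<nu> \<le> c * E k)"
          using that
        proof (induction k)
          case 0
          have "E 0 = 0" by (simp add: E_def)
          then show ?case using x0 by (auto simp: Q_def P_def intro!: exI[of _ 0])
        next
          case (Suc k)
          define t where "t = real k * h"
          have th: "real (Suc k) * h = t + h" by (simp add: t_def algebra_simps)
          have t: "0 \<le> t" "t \<le> t\<^sub>1" "t + h \<le> t\<^sub>1" using Suc.prems h unfolding th by (auto simp: t_def)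
          define y where "y = (?\<Phi> h ^^ k) (x 0)"
          define z where "z = ?\<Phi> h y"
          have z: "(?\<Phi> h ^^ Suc k) (x 0) = z" by (simp add: z_def y_def)
          obtain \<nu> where yS: "y \<in> S" and \<nu>: "norm (fst y - Q t) \<le> E k" "norm (snd y - P t - N (Q t) *v \<nu>) \<le> E k"
              "norm (snd y - P t) \<le> c * E k" "norm \<nu> \<le> c * E k"
            using Suc.IH t(2) unfolding t_def y_def by blast
          have ytn: "norm (y - x t) \<le> (1 + c) * \<Gamma> * h"
            using close[of y k] \<nu> t(2) unfolding t_def by blast
          have "(1 + c) * \<Gamma> * h \<le> M * h" using M(2) h by (intro mult_right_mono) auto
          then have yt: "dist y (x t) < r" using ytn Mh by (simp add: dist_norm)
          have tI: "t \<in> {0..t\<^sub>1}" "t + h \<in> {0..t\<^sub>1}" using t h by auto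
          have us: "uniform_step \<rho> h\<^sub>0 (x t) r1" by (rule r1(2)) (use tI in blast)
          have yr1: "dist y (x t) < r1" using yt r by simp
          note u = uniform_stepD[OF us yS yr1 h(1) h(4), folded z_def]
          have zS: "z \<in> S"
            unfolding z_def by (rule scheme_map_in_S[of h y \<rho>, OF uni[OF yS h(1) u(1)]])
          obtain q p where y_eq: "y = (q, p)" by (cases y)
          obtain q' p' where z_eq: "z = (q', p')" by (cases z)
          have con1: "consistent C h (Q t, P t) (Q (t + h), P (t + h))"
            using consistent_mono[OF ex[OF t(1) h(1) t(3)] C(2)] h(1) by (simp add: xt)
          have con2: "consistent C h (q, p) (q', p')"
            using consistent_mono[OF u(2) C(3)] h(1) by (simp add: y_eq z_eq)
          have R1: "norm (Q t, P t) \<le> R" using B(2)[OF tI(1)] r1(1) unfolding R_def xt by linarith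
          have R2: "norm (q, p) \<le> R"
            using norm_triangle_sub[of y "x t"] B(2)[OF tI(1)] yr1 unfolding R_def y_eq dist_norm by linarith
          have R3: "norm (Q (t + h)) \<le> R"
            using B(2)[OF tI(2)] norm_fst_le[of "Q (t + h)" "P (t + h)"] r1(1) unfolding R_def xt by linarith
          obtain \<nu>' where \<nu>': "norm (q' - Q (t + h)) \<le> E (Suc k)" "norm (p' - P (t + h) - N (Q (t + h)) *v \<nu>') \<le> E (Suc k)"
            using step_error[OF h(1) h(3) R1 R2 con1 con2, of "E k" \<nu>] \<nu> unfolding E_Suc y_eq by auto
          have dz: "norm (q' - q) \<le> C * h" "norm (p' - p) \<le> C * h"
            using con2 unfolding consistent_def prod.case by blast+
          have dx: "norm (Q (t + h) - Q t) \<le> C * h" "norm (P (t + h) - P t) \<le> C * h"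
            using con1 unfolding consistent_def prod.case by blast+
          have zx: "dist (q', p') (Q (t + h), P (t + h)) < r"
          proof -
            have zy: "dist z y \<le> C * h + C * h"
              using dist_Pair_le[of q' p' q p] dz unfolding z_eq y_eq by (simp add: dist_norm)
            have xx: "dist (x t) (x (t + h)) \<le> C * h + C * h"
              using dist_Pair_le[of "Q t" "P t" "Q (t + h)" "P (t + h)"] dx unfolding xt
              by (simp add: dist_norm norm_minus_commute)
            have "dist z (x (t + h)) \<le> dist z y + dist y (x t) + dist (x t) (x (t + h))"
              using dist_triangle[of z "x (t + h)" y] dist_triangle[of y "x (t + h)" "x t"] by linarith
            also have "\<dots> \<le> M * h"
              using zy xx ytn unfolding M_def by (simp add: dist_norm algebra_simps)
            finally show ?thesis using Mh unfolding z_eq xt by linarith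
          qed
          have "E (Suc k) \<le> \<Gamma> * h" using E\<Gamma>[OF Suc.prems] .
          also have "\<dots> \<le> M * h"
          proof (intro mult_right_mono)
            have "\<Gamma> \<le> (1 + c) * \<Gamma>" using c(1) \<Gamma> by simp
            then show "\<Gamma> \<le> M" using M(2) by linarith
          qed (use h in simp)
          finally have Er: "E (Suc k) < r2" using Mh r by linarith
          have mb: "multiplier_bound (Q (t + h), P (t + h)) r2"
            using r2(2)[of "x (t + h)"] tI(2) unfolding xt by blast
          have "norm \<nu>' \<le> (norm (q' - Q (t + h)) + norm (p' - P (t + h) - N (Q (t + h)) *v \<nu>')) / r2"
            using mb zS zx r(3) \<nu>'(2) Er unfolding multiplier_bound_def prod.case z_eq by (meson le_less_trans less_le_trans)
          also have "\<dots> \<le> (E (Suc k) + E (Suc k)) / r2"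
            using \<nu>' r2(1) by (intro divide_right_mono add_mono) auto
          finally have n1: "norm \<nu>' \<le> (2 / r2) * E (Suc k)" by simp
          have "norm (p' - P (t + h)) \<le> norm (p' - P (t + h) - N (Q (t + h)) *v \<nu>') + norm (N (Q (t + h)) *v \<nu>')"
            using norm_triangle_sub[of "p' - P (t + h)" "N (Q (t + h)) *v \<nu>'"] by linarith
          also have "\<dots> \<le> E (Suc k) + K * ((2 / r2) * E (Suc k))"
            using \<nu>'(2) K(1) n1 by (intro add_mono order_trans[OF K(2)[OF R3]] mult_left_mono) auto
          also have "\<dots> = (1 + K * (2 / r2)) * E (Suc k)" by (simp add: algebra_simps)
          also have "\<dots> \<le> c * E (Suc k)" using c(3) E0 by (intro mult_right_mono) auto
          finally have n2: "norm (p' - P (t + h)) \<le> c * E (Suc k)" .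
          have n3: "norm \<nu>' \<le> c * E (Suc k)"
            using n1 mult_right_mono[OF c(2) E0[of "Suc k"]] by linarith
          show ?case
            unfolding z th using zS \<nu>' n2 n3 by (auto simp: z_eq)
        qed
        show "norm ((?\<Phi> h ^^ k) (x 0) - x (real k * h)) \<le> (1 + c) * \<Gamma> * h"
          using inv close[OF _ _ that] by blast
      qed
      let ?y = "(?\<Phi> h ^^ k) (x 0)" and ?t = "real k * h"
      have tI: "?t \<in> {0..t\<^sub>1}" using k h by simp
      have "(1 + c) * \<Gamma> * h \<le> M * h" using M(2) h by (intro mult_right_mono) auto
      then have yt: "dist ?y (x ?t) < r1" using close[OF k] Mh r by (simp add: dist_norm)
      have us: "uniform_step \<rho> h\<^sub>0 (x ?t) r1" by (rule r1(2)) (use tI in blast)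
      have yS: "?y \<in> S" using inv[OF k] by blast
      show "?y \<in> {x \<in> S. h < h\<^sub>0 x} \<and> norm (?y - x ?t) \<le> (1 + c) * \<Gamma> * h ^ 1"
        using yS uniform_stepD(1)[OF us yS yt h(1) h(4)] close[OF k] by simp
    qed
  qed
qed

end

theorem theorem4p3:
  fixes g :: "real^'n \<Rightarrow> real^'m"
    and f T :: "real^'n \<Rightarrow> real"
    and \<gamma> :: real
  assumes "CARD('m) < CARD('n)"
    and "C2 g"
    and "C2 f"
    and "geodesically_convex_on (config_manifold g) f \<or> convex_on UNIV f"
    and "C2 (\<lambda>(q, p). T p + f q)"
    and "\<gamma> > 0"
    and "\<forall>(q, p) \<in> phase_manifold T g.
           invertible (jacobian g (at q) ** hess T p ** transpose (jacobian g (at q)))"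
  shows "\<exists>(h\<^sub>0 :: (real^'n) \<times> (real^'n) \<Rightarrow> real) (\<rho> :: (real^'n) \<times> (real^'n) \<Rightarrow> real).
      continuous_on (phase_manifold T g) h\<^sub>0 \<and> continuous_on (phase_manifold T g) \<rho>
    \<and> (\<forall>x \<in> phase_manifold T g. h\<^sub>0 x > 0 \<and> \<rho> x > 0)
    \<and> (\<forall>x \<in> phase_manifold T g. \<forall>h. 0 < h \<and> h < h\<^sub>0 x \<longrightarrow>
         (\<exists>!s. scheme T f g \<gamma> h x s \<and> near_step (\<rho> x) x s))
    \<and> (\<forall>h > 0. conformal_symplectic (exp (- \<gamma> * h)) (phase_manifold T g)
         {x \<in> phase_manifold T g. h < h\<^sub>0 x} (scheme_map T f g \<gamma> \<rho> h))
    \<and> convergent_of_order 1 (phase_manifold T g) (exact_solution T f g \<gamma>)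
         (\<lambda>h. {x \<in> phase_manifold T g. h < h\<^sub>0 x}) (scheme_map T f g \<gamma> \<rho>)"
proof -
  interpret constrained_system g f T \<gamma>
  proof
    show "C2 T" by (rule C2_separable_kinetic[OF assms(5)])
    show "invertible (jacobian g (at q) ** hess T p ** transpose (jacobian g (at q)))"
      if "(q, p) \<in> phase_manifold T g" for q p
      using assms(7) that by blast
  qed (fact assms)+
  let ?S = "phase_manifold T g"
  obtain \<rho> h\<^sub>0 where cont: "continuous_on ?S h\<^sub>0" "continuous_on ?S \<rho>"
    and pos: "\<And>x. x \<in> ?S \<Longrightarrow> h\<^sub>0 x > 0" "\<And>x. x \<in> ?S \<Longrightarrow> \<rho> x > 0"
    and uni: "\<And>x h. x \<in> ?S \<Longrightarrow> 0 < h \<Longrightarrow> h < h\<^sub>0 x \<Longrightarrow> \<exists>!s. scheme T f g \<gamma> h x s \<and> near_step (\<rho> x) x s"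
    and der: "\<And>x h. x \<in> ?S \<Longrightarrow> 0 < h \<Longrightarrow> h < h\<^sub>0 x \<Longrightarrow> \<exists>L. (the_step \<rho> h has_derivative L) (at x within ?S)"
    and loc: "\<And>x. x \<in> ?S \<Longrightarrow> \<exists>r>0. \<exists>C>0. \<forall>y\<in>?S. dist y x < r \<longrightarrow> (\<forall>h. 0 < h \<and> h < r \<longrightarrow>
       h < h\<^sub>0 y \<and> step_bound C h y (the_step \<rho> h y))"
    by (rule step_domain) blast
  have "\<forall>h > 0. conformal_symplectic (exp (- \<gamma> * h)) ?S
         {x \<in> ?S. h < h\<^sub>0 x} (scheme_map T f g \<gamma> \<rho> h)"
  proof (intro allI impI)
    fix h :: real assume "h > 0"
    show "conformal_symplectic (exp (- \<gamma> * h)) ?S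
         {x \<in> ?S. h < h\<^sub>0 x} (scheme_map T f g \<gamma> \<rho> h)"
    proof (rule scheme_map_conformal_symplectic)
      show "continuous_on ?S h\<^sub>0" by (fact cont)
    qed (fact pos uni der \<open>h > 0\<close>)+
  qed
  moreover have "convergent_of_order 1 ?S (exact_solution T f g \<gamma>)
         (\<lambda>h. {x \<in> ?S. h < h\<^sub>0 x}) (scheme_map T f g \<gamma> \<rho>)"
  proof (rule scheme_map_convergent)
    fix x assume x: "x \<in> ?S"
    show "\<exists>r>0. \<forall>z\<in>?S \<inter> ball x r. uniform_step \<rho> h\<^sub>0 z r"
    proof (rule uniform_step_local)
      show "\<exists>r>0. \<exists>C>0. \<forall>y\<in>?S. dist y x < r \<longrightarrow> (\<forall>h. 0 < h \<and> h < r \<longrightarrow>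
       h < h\<^sub>0 y \<and> step_bound C h y (the_step \<rho> h y))" by (rule loc[OF x])
    qed (fact uni)
  qed (fact pos uni)+
  ultimately show ?thesis
    using cont pos uni by (intro exI[of _ h\<^sub>0] exI[of _ \<rho>] conjI ballI allI impI) auto
qed

end
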